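(* Let $\mathcal{A}$ be a small additive category, $\mathcal{B}$ an abelian category and $n$ a natural number. The inclusion functor $\mathbf{M}(\mathcal{A})\to\mathcal{A}$ induces (by precomposition with its canonical extension $\widetilde{\mathbf{M}(\mathcal{A})}\to\mathcal{A}$) an equivalence of categories $$\mathcal{P}ol_n(\mathcal{A},\mathcal{B})\xrightarrow{\simeq}\mathcal{P}ol_n(\widetilde{\mathbf{M}(\mathcal{A})},\mathcal{B}).$$
   Context: $\mathbf{M}(\mathcal{A})$ is the subcategory of $\mathcal{A}$ with the same objects and whose morphisms are the split(table) monomorphisms. Both $\mathcal{A}$ and $\mathbf{M}(\mathcal{A})$ are symmetric monoidal for the direct sum $\oplus$ (regarded as strict); the unit $0$ is an initial object of $\mathbf{M}(\mathcal{A})$ and a null object of $\mathcal{A}$. **The category $\widetilde{\mathcal{M}}$.** For a small symmetric monoidal category $(\mathcal{M},\oplus,0)$ with $0$ initial, $\widetilde{\mathcal{M}}$ has the same objects and $\widetilde{\mathcal{M}}(a,b)=\mathrm{colim}_{t\in\mathcal{M}}\,\mathcal{M}(a,b\oplus t)$; the composite of the classes of $f:a\to b\oplus t$ and $g:b\to c\oplus u$ is the class of $(g\oplus t)\circ f$. It is symmetric monoidal via $\oplus$, with $0$ a null object, and there is a monoidal functor $\eta_{\mathcal{M}}:\mathcal{M}\to\widetilde{\mathcal{M}}$, the identity on objects, sending $f:a\to b$ to its class with $t=0$. Any monoidal functor $\Phi:\mathcal{M}\to\mathcal{N}$ to a symmetric monoidal category with null unit extends uniquely to a monoidal functor $\widetilde{\mathcal{M}}\to\mathcal{N}$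 along $\eta_{\mathcal{M}}$: it sends the class of $f:a\to b\oplus t$ to $\Phi(a)\xrightarrow{\Phi(f)}\Phi(b)\oplus\Phi(t)\to\Phi(b)$. **Polynomial functors.** For a small symmetric monoidal category $\mathcal{N}$ whose unit is a null object and an abelian category $\mathcal{B}$, $\mathcal{P}ol_n(\mathcal{N},\mathcal{B})$ is the full subcategory of the category $\mathbf{Fct}(\mathcal{N},\mathcal{B})$ of functors defined inductively by: $\{0\}$ for $n<0$; for $n\ge0$, the functors $F$ such that for every object $x$ the cokernel $\delta_x(F)$ of the map $F\to F(x\oplus-)$ induced by $0\to x$ lies in $\mathcal{P}ol_{n-1}(\mathcal{N},\mathcal{B})$. *)

theory Defs
  imports "HOL-Algebra.Group" "HOL-Library.FuncSet"
begin

section \<open>Categories\<close>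

record ('o, 'm) cat =
  Obj :: "'o set"
  Arr :: "'m set"
  Dom :: "'m \<Rightarrow> 'o"
  Cod :: "'m \<Rightarrow> 'o"
  Ide :: "'o \<Rightarrow> 'm"
  Comp :: "'m \<Rightarrow> 'm \<Rightarrow> 'm" (infixl "\<cdot>\<index>" 70)

definition Hom :: "('o, 'm, 'x) cat_scheme \<Rightarrow> 'o \<Rightarrow> 'o \<Rightarrow> 'm set" where
  "Hom C a b = {f \<in> Arr C. Dom C f = a \<and> Cod C f = b}"

locale category =
  fixes C :: "('o, 'm, 'x) cat_scheme" (structure)
  assumes dom_in_Obj: "f \<in> Arr C \<Longrightarrow> Dom C f \<in> Obj C"
    and cod_in_Obj: "f \<in> Arr C \<Longrightarrow> Cod C f \<in> Obj C"
    and ide_in_Hom: "a \<in> Obj C \<Longrightarrow> Ide C a \<in> Hom C a a"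
    and comp_in_Hom: "\<lbrakk>f \<in> Hom C a b; g \<in> Hom C b c\<rbrakk> \<Longrightarrow> g \<cdot> f \<in> Hom C a c"
    and comp_ide_left: "f \<in> Hom C a b \<Longrightarrow> Ide C b \<cdot> f = f"
    and comp_ide_right: "f \<in> Hom C a b \<Longrightarrow> f \<cdot> Ide C a = f"
    and comp_assoc: "\<lbrakk>f \<in> Hom C a b; g \<in> Hom C b c; h \<in> Hom C c d\<rbrakk>
                       \<Longrightarrow> (h \<cdot> g) \<cdot> f = h \<cdot> (g \<cdot> f)"

definition full_subcat :: "('o, 'm, 'x) cat_scheme \<Rightarrow> ('o \<Rightarrow> bool) \<Rightarrow> ('o, 'm, 'x) cat_scheme" where
  "full_subcat C P = C\<lparr>Obj := {a \<in> Obj C. P a}, Arr := {f \<in> Arr C. P (Dom C f) \<and> P (Cod C f)}\<rparr>"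

definition inverse_pair :: "('o, 'm, 'x) cat_scheme \<Rightarrow> 'm \<Rightarrow> 'm \<Rightarrow> bool" where
  "inverse_pair C f g \<longleftrightarrow> f \<in> Arr C \<and> g \<in> Hom C (Cod C f) (Dom C f) \<and>
     g \<cdot>\<^bsub>C\<^esub> f = Ide C (Dom C f) \<and> f \<cdot>\<^bsub>C\<^esub> g = Ide C (Cod C f)"

definition is_iso :: "('o, 'm, 'x) cat_scheme \<Rightarrow> 'm \<Rightarrow> bool" where
  "is_iso C f \<longleftrightarrow> (\<exists>g. inverse_pair C f g)"

definition inv_arr :: "('o, 'm, 'x) cat_scheme \<Rightarrow> 'm \<Rightarrow> 'm" where
  "inv_arr C f = (THE g. inverse_pair C f g)"

definition is_mono :: "('o, 'm, 'x) cat_scheme \<Rightarrow> 'm \<Rightarrow> bool" where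
  "is_mono C f \<longleftrightarrow> f \<in> Arr C \<and>
     (\<forall>c. \<forall>g \<in> Hom C c (Dom C f). \<forall>h \<in> Hom C c (Dom C f). f \<cdot>\<^bsub>C\<^esub> g = f \<cdot>\<^bsub>C\<^esub> h \<longrightarrow> g = h)"

definition is_epi :: "('o, 'm, 'x) cat_scheme \<Rightarrow> 'm \<Rightarrow> bool" where
  "is_epi C f \<longleftrightarrow> f \<in> Arr C \<and>
     (\<forall>c. \<forall>g \<in> Hom C (Cod C f) c. \<forall>h \<in> Hom C (Cod C f) c. g \<cdot>\<^bsub>C\<^esub> f = h \<cdot>\<^bsub>C\<^esub> f \<longrightarrow> g = h)"

definition is_split_mono :: "('o, 'm, 'x) cat_scheme \<Rightarrow> 'm \<Rightarrow> bool" where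
  "is_split_mono C f \<longleftrightarrow> f \<in> Arr C \<and>
     (\<exists>r \<in> Hom C (Cod C f) (Dom C f). r \<cdot>\<^bsub>C\<^esub> f = Ide C (Dom C f))"

definition is_null_obj :: "('o, 'm, 'x) cat_scheme \<Rightarrow> 'o \<Rightarrow> bool" where
  "is_null_obj C z \<longleftrightarrow> z \<in> Obj C \<and>
     (\<forall>a \<in> Obj C. (\<exists>!f. f \<in> Hom C z a) \<and> (\<exists>!f. f \<in> Hom C a z))"

definition is_zero_arr :: "('o, 'm, 'x) cat_scheme \<Rightarrow> 'm \<Rightarrow> bool" where
  "is_zero_arr C f \<longleftrightarrow> (\<exists>z g h. is_null_obj C z \<and> g \<in> Hom C (Dom C f) z \<and> h \<in> Hom C z (Cod C f) \<and>
     f = h \<cdot>\<^bsub>C\<^esub> g)"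

definition is_kernel :: "('o, 'm, 'x) cat_scheme \<Rightarrow> 'm \<Rightarrow> 'm \<Rightarrow> bool" where
  "is_kernel C f k \<longleftrightarrow> f \<in> Arr C \<and> k \<in> Arr C \<and> Cod C k = Dom C f \<and> is_zero_arr C (f \<cdot>\<^bsub>C\<^esub> k) \<and>
     (\<forall>g \<in> Arr C. Cod C g = Dom C f \<and> is_zero_arr C (f \<cdot>\<^bsub>C\<^esub> g) \<longrightarrow>
        (\<exists>!h. h \<in> Hom C (Dom C g) (Dom C k) \<and> k \<cdot>\<^bsub>C\<^esub> h = g))"

definition is_cokernel :: "('o, 'm, 'x) cat_scheme \<Rightarrow> 'm \<Rightarrow> 'm \<Rightarrow> bool" where
  "is_cokernel C f q \<longleftrightarrow> f \<in> Arr C \<and> q \<in> Arr C \<and> Dom C q = Cod C f \<and> is_zero_arr C (q \<cdot>\<^bsub>C\<^esub> f) \<and>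
     (\<forall>g \<in> Arr C. Dom C g = Cod C f \<and> is_zero_arr C (g \<cdot>\<^bsub>C\<^esub> f) \<longrightarrow>
        (\<exists>!h. h \<in> Hom C (Cod C q) (Cod C g) \<and> h \<cdot>\<^bsub>C\<^esub> q = g))"


section \<open>Additive and abelian categories\<close>

text \<open>Additive categories carry a choice of zero object and of binary biproducts; nothing more is
  assumed about the choice (in particular, no strict associativity).\<close>

record ('o, 'm) add_cat = "('o, 'm) cat" +
  AddArr :: "'m \<Rightarrow> 'm \<Rightarrow> 'm"
  ZeroArr :: "'o \<Rightarrow> 'o \<Rightarrow> 'm"
  ZeroObj :: "'o"
  DSum :: "'o \<Rightarrow> 'o \<Rightarrow> 'o"
  Inj1 :: "'o \<Rightarrow> 'o \<Rightarrow> 'm"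
  Inj2 :: "'o \<Rightarrow> 'o \<Rightarrow> 'm"
  Prj1 :: "'o \<Rightarrow> 'o \<Rightarrow> 'm"
  Prj2 :: "'o \<Rightarrow> 'o \<Rightarrow> 'm"

locale additive_category = category C
  for C :: "('o, 'm, 'x) add_cat_scheme" (structure) +
  assumes hom_group: "\<lbrakk>a \<in> Obj C; b \<in> Obj C\<rbrakk>
      \<Longrightarrow> comm_group \<lparr>carrier = Hom C a b, monoid.mult = AddArr C, one = ZeroArr C a b\<rparr>"
    and comp_add_left: "\<lbrakk>f \<in> Hom C a b; g \<in> Hom C b c; h \<in> Hom C b c\<rbrakk>
      \<Longrightarrow> AddArr C g h \<cdot> f = AddArr C (g \<cdot> f) (h \<cdot> f)"
    and comp_add_right: "\<lbrakk>f \<in> Hom C a b; g \<in> Hom C a b; h \<in> Hom C b c\<rbrakk>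
      \<Longrightarrow> h \<cdot> AddArr C f g = AddArr C (h \<cdot> f) (h \<cdot> g)"
    and null_ZeroObj: "is_null_obj C (ZeroObj C)"
    and DSum_in_Obj: "\<lbrakk>a \<in> Obj C; b \<in> Obj C\<rbrakk> \<Longrightarrow> DSum C a b \<in> Obj C"
    and Inj1_in_Hom: "\<lbrakk>a \<in> Obj C; b \<in> Obj C\<rbrakk> \<Longrightarrow> Inj1 C a b \<in> Hom C a (DSum C a b)"
    and Inj2_in_Hom: "\<lbrakk>a \<in> Obj C; b \<in> Obj C\<rbrakk> \<Longrightarrow> Inj2 C a b \<in> Hom C b (DSum C a b)"
    and Prj1_in_Hom: "\<lbrakk>a \<in> Obj C; b \<in> Obj C\<rbrakk> \<Longrightarrow> Prj1 C a b \<in> Hom C (DSum C a b) a"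
    and Prj2_in_Hom: "\<lbrakk>a \<in> Obj C; b \<in> Obj C\<rbrakk> \<Longrightarrow> Prj2 C a b \<in> Hom C (DSum C a b) b"
    and Prj1_Inj1: "\<lbrakk>a \<in> Obj C; b \<in> Obj C\<rbrakk> \<Longrightarrow> Prj1 C a b \<cdot> Inj1 C a b = Ide C a"
    and Prj2_Inj2: "\<lbrakk>a \<in> Obj C; b \<in> Obj C\<rbrakk> \<Longrightarrow> Prj2 C a b \<cdot> Inj2 C a b = Ide C b"
    and Prj1_Inj2: "\<lbrakk>a \<in> Obj C; b \<in> Obj C\<rbrakk> \<Longrightarrow> Prj1 C a b \<cdot> Inj2 C a b = ZeroArr C b a"
    and Prj2_Inj1: "\<lbrakk>a \<in> Obj C; b \<in> Obj C\<rbrakk> \<Longrightarrow> Prj2 C a b \<cdot> Inj1 C a b = ZeroArr C a b"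
    and biproduct_sum: "\<lbrakk>a \<in> Obj C; b \<in> Obj C\<rbrakk>
      \<Longrightarrow> AddArr C (Inj1 C a b \<cdot> Prj1 C a b) (Inj2 C a b \<cdot> Prj2 C a b) = Ide C (DSum C a b)"

locale abelian_category = additive_category C
  for C :: "('o, 'm, 'x) add_cat_scheme" (structure) +
  assumes has_kernel: "f \<in> Arr C \<Longrightarrow> \<exists>k. is_kernel C f k"
    and has_cokernel: "f \<in> Arr C \<Longrightarrow> \<exists>q. is_cokernel C f q"
    and mono_is_kernel: "is_mono C k \<Longrightarrow> \<exists>f. is_kernel C f k"
    and epi_is_cokernel: "is_epi C q \<Longrightarrow> \<exists>f. is_cokernel C f q"


section \<open>Functors and natural transformations\<close>

text \<open>Functors and natural transformations are extensional (\<^const>\<open>undefined\<close> off the objects and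
  arrows of the source), so that equality in the functor category is the mathematical one.\<close>

record ('o, 'm, 'p, 'q) cat_functor =
  FObj :: "'o \<Rightarrow> 'p"
  FArr :: "'m \<Rightarrow> 'q"

definition is_functor ::
  "('o, 'm, 'x) cat_scheme \<Rightarrow> ('p, 'q, 'y) cat_scheme \<Rightarrow> ('o, 'm, 'p, 'q) cat_functor \<Rightarrow> bool" where
  "is_functor C D F \<longleftrightarrow>
     FObj F \<in> Obj C \<rightarrow>\<^sub>E Obj D \<and> FArr F \<in> Arr C \<rightarrow>\<^sub>E Arr D \<and>
     (\<forall>f \<in> Arr C. Dom D (FArr F f) = FObj F (Dom C f) \<and> Cod D (FArr F f) = FObj F (Cod C f)) \<and>
     (\<forall>a \<in> Obj C. FArr F (Ide C a) = Ide D (FObj F a)) \<and>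
     (\<forall>f \<in> Arr C. \<forall>g \<in> Arr C. Dom C g = Cod C f \<longrightarrow>
        FArr F (g \<cdot>\<^bsub>C\<^esub> f) = FArr F g \<cdot>\<^bsub>D\<^esub> FArr F f)"

definition inclusion_functor :: "('o, 'm, 'x) cat_scheme \<Rightarrow> ('o, 'm, 'o, 'm) cat_functor" where
  "inclusion_functor C = \<lparr>FObj = (\<lambda>a \<in> Obj C. a), FArr = (\<lambda>f \<in> Arr C. f)\<rparr>"

definition comp_functor :: "('o, 'm, 'x) cat_scheme \<Rightarrow> ('p, 'q, 'r, 's) cat_functor \<Rightarrow>
    ('o, 'm, 'p, 'q) cat_functor \<Rightarrow> ('o, 'm, 'r, 's) cat_functor" where
  "comp_functor C G F =
     \<lparr>FObj = (\<lambda>a \<in> Obj C. FObj G (FObj F a)), FArr = (\<lambda>f \<in> Arr C. FArr G (FArr F f))\<rparr>"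

record ('o, 'm, 'p, 'q) nat_trans =
  NDom :: "('o, 'm, 'p, 'q) cat_functor"
  NCod :: "('o, 'm, 'p, 'q) cat_functor"
  NCmp :: "'o \<Rightarrow> 'q"

definition is_nat_trans ::
  "('o, 'm, 'x) cat_scheme \<Rightarrow> ('p, 'q, 'y) cat_scheme \<Rightarrow> ('o, 'm, 'p, 'q) nat_trans \<Rightarrow> bool" where
  "is_nat_trans C D \<tau> \<longleftrightarrow>
     is_functor C D (NDom \<tau>) \<and> is_functor C D (NCod \<tau>) \<and> NCmp \<tau> \<in> extensional (Obj C) \<and>
     (\<forall>a \<in> Obj C. NCmp \<tau> a \<in> Hom D (FObj (NDom \<tau>) a) (FObj (NCod \<tau>) a)) \<and>
     (\<forall>f \<in> Arr C. NCmp \<tau> (Cod C f) \<cdot>\<^bsub>D\<^esub> FArr (NDom \<tau>) f = FArr (NCod \<tau>) f \<cdot>\<^bsub>D\<^esub> NCmp \<tau> (Dom C f))"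

definition Fct :: "('o, 'm, 'x) cat_scheme \<Rightarrow> ('p, 'q, 'y) cat_scheme \<Rightarrow>
    (('o, 'm, 'p, 'q) cat_functor, ('o, 'm, 'p, 'q) nat_trans) cat" where
  "Fct C D = \<lparr>Obj = {F. is_functor C D F}, Arr = {\<tau>. is_nat_trans C D \<tau>}, Dom = NDom, Cod = NCod,
     Ide = (\<lambda>F. \<lparr>NDom = F, NCod = F, NCmp = (\<lambda>a \<in> Obj C. Ide D (FObj F a))\<rparr>),
     Comp = (\<lambda>\<sigma> \<tau>. \<lparr>NDom = NDom \<tau>, NCod = NCod \<sigma>, NCmp = (\<lambda>a \<in> Obj C. NCmp \<sigma> a \<cdot>\<^bsub>D\<^esub> NCmp \<tau> a)\<rparr>)\<rparr>"

definition naturally_isomorphic :: "('o, 'm, 'x) cat_scheme \<Rightarrow> ('p, 'q, 'y) cat_scheme \<Rightarrow>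
    ('o, 'm, 'p, 'q) cat_functor \<Rightarrow> ('o, 'm, 'p, 'q) cat_functor \<Rightarrow> bool" where
  "naturally_isomorphic C D F G \<longleftrightarrow> (\<exists>\<tau> \<in> Hom (Fct C D) F G. \<forall>a \<in> Obj C. is_iso D (NCmp \<tau> a))"

definition is_equivalence ::
  "('o, 'm, 'x) cat_scheme \<Rightarrow> ('p, 'q, 'y) cat_scheme \<Rightarrow> ('o, 'm, 'p, 'q) cat_functor \<Rightarrow> bool" where
  "is_equivalence C D F \<longleftrightarrow> is_functor C D F \<and>
     (\<exists>G. is_functor D C G \<and>
        naturally_isomorphic C C (comp_functor C G F) (inclusion_functor C) \<and>
        naturally_isomorphic D D (comp_functor D F G) (inclusion_functor D))"

text \<open>Precomposition with a functor \<open>\<Phi>\<close> out of \<open>C\<close>, on a subcategory \<open>X\<close> of the category of functors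
  out of the target of \<open>\<Phi>\<close>.\<close>

definition precomp_functor ::
  "(('p, 'q, 'r, 's) cat_functor, ('p, 'q, 'r, 's) nat_trans, 'y) cat_scheme \<Rightarrow>
   ('o, 'm, 'x) cat_scheme \<Rightarrow> ('o, 'm, 'p, 'q) cat_functor \<Rightarrow>
   (('p, 'q, 'r, 's) cat_functor, ('p, 'q, 'r, 's) nat_trans,
    ('o, 'm, 'r, 's) cat_functor, ('o, 'm, 'r, 's) nat_trans) cat_functor" where
  "precomp_functor X C \<Phi> =
     \<lparr>FObj = (\<lambda>F \<in> Obj X. comp_functor C F \<Phi>),
      FArr = (\<lambda>\<tau> \<in> Arr X. \<lparr>NDom = comp_functor C (NDom \<tau>) \<Phi>, NCod = comp_functor C (NCod \<tau>) \<Phi>,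
                            NCmp = (\<lambda>a \<in> Obj C. NCmp \<tau> (FObj \<Phi> a))\<rparr>)\<rparr>"


section \<open>Symmetric monoidal structures\<close>

text \<open>\<open>Assoc a b c\<close> goes from \<open>(a \<otimes> b) \<otimes> c\<close> to \<open>a \<otimes> (b \<otimes> c)\<close>, \<open>LUnit a\<close> from \<open>1 \<otimes> a\<close> to \<open>a\<close>,
  \<open>RUnit a\<close> from \<open>a \<otimes> 1\<close> to \<open>a\<close>, and \<open>Braid a b\<close> from \<open>a \<otimes> b\<close> to \<open>b \<otimes> a\<close>. Since the structure is
  not required to be strict, these isomorphisms appear explicitly where the usual formulas leave
  them out.\<close>

record ('o, 'm) mon_cat = "('o, 'm) cat" +
  Tensor :: "'o \<Rightarrow> 'o \<Rightarrow> 'o" (infixr "\<odot>\<index>" 75)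
  TensorArr :: "'m \<Rightarrow> 'm \<Rightarrow> 'm" (infixr "\<boxtimes>\<index>" 75)
  Unit :: "'o"
  Assoc :: "'o \<Rightarrow> 'o \<Rightarrow> 'o \<Rightarrow> 'm"
  LUnit :: "'o \<Rightarrow> 'm"
  RUnit :: "'o \<Rightarrow> 'm"
  Braid :: "'o \<Rightarrow> 'o \<Rightarrow> 'm"

definition pairing :: "('o, 'm, 'x) add_cat_scheme \<Rightarrow> 'm \<Rightarrow> 'm \<Rightarrow> 'm" where
  "pairing A f g = AddArr A (Inj1 A (Cod A f) (Cod A g) \<cdot>\<^bsub>A\<^esub> f) (Inj2 A (Cod A f) (Cod A g) \<cdot>\<^bsub>A\<^esub> g)"

definition direct_sum_monoidal :: "('o, 'm, 'x) add_cat_scheme \<Rightarrow> ('o, 'm) mon_cat" where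
  "direct_sum_monoidal A =
     \<lparr>Obj = Obj A, Arr = Arr A, Dom = Dom A, Cod = Cod A, Ide = Ide A, Comp = Comp A,
      Tensor = DSum A,
      TensorArr = (\<lambda>f g. pairing A (f \<cdot>\<^bsub>A\<^esub> Prj1 A (Dom A f) (Dom A g)) (g \<cdot>\<^bsub>A\<^esub> Prj2 A (Dom A f) (Dom A g))),
      Unit = ZeroObj A,
      Assoc = (\<lambda>a b c. pairing A (Prj1 A a b \<cdot>\<^bsub>A\<^esub> Prj1 A (DSum A a b) c)
                 (pairing A (Prj2 A a b \<cdot>\<^bsub>A\<^esub> Prj1 A (DSum A a b) c) (Prj2 A (DSum A a b) c))),
      LUnit = (\<lambda>a. Prj2 A (ZeroObj A) a),
      RUnit = (\<lambda>a. Prj1 A a (ZeroObj A)),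
      Braid = (\<lambda>a b. pairing A (Prj2 A a b) (Prj1 A a b))\<rparr>"

text \<open>The category \<open>\<^bold>M(C)\<close>.\<close>

definition split_monos :: "('o, 'm, 'x) cat_scheme \<Rightarrow> ('o, 'm, 'x) cat_scheme" where
  "split_monos C = C\<lparr>Arr := {f. is_split_mono C f}\<rparr>"

text \<open>The arrow from the unit to \<open>x\<close> (unit initial), respectively from \<open>x\<close> to the unit (unit terminal).\<close>

definition from_unit :: "('o, 'm, 'x) mon_cat_scheme \<Rightarrow> 'o \<Rightarrow> 'm" where
  "from_unit N x = (THE f. f \<in> Hom N (Unit N) x)"

definition to_unit :: "('o, 'm, 'x) mon_cat_scheme \<Rightarrow> 'o \<Rightarrow> 'm" where
  "to_unit N x = (THE f. f \<in> Hom N x (Unit N))"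

text \<open>The canonical map \<open>(b \<otimes> t) \<otimes> (d \<otimes> u) \<rightarrow> (b \<otimes> d) \<otimes> (t \<otimes> u)\<close>.\<close>

definition interchange :: "('o, 'm, 'x) mon_cat_scheme \<Rightarrow> 'o \<Rightarrow> 'o \<Rightarrow> 'o \<Rightarrow> 'o \<Rightarrow> 'm" where
  "interchange M b t d u =
     inv_arr M (Assoc M b d (t \<odot>\<^bsub>M\<^esub> u)) \<cdot>\<^bsub>M\<^esub>
     (Ide M b \<boxtimes>\<^bsub>M\<^esub>
        (Assoc M d t u \<cdot>\<^bsub>M\<^esub> (Braid M t d \<boxtimes>\<^bsub>M\<^esub> Ide M u) \<cdot>\<^bsub>M\<^esub> inv_arr M (Assoc M t d u))) \<cdot>\<^bsub>M\<^esub>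
     Assoc M b t (d \<odot>\<^bsub>M\<^esub> u)"


section \<open>The category with null unit associated with a symmetric monoidal category\<close>

text \<open>The colimit over \<open>t\<close> of \<open>M(a, b \<otimes> t)\<close> is the quotient of the disjoint union, whose elements
  are the pairs \<open>(t, f)\<close> with \<open>f : a \<rightarrow> b \<otimes> t\<close>, by the equivalence relation generated by
  \<^term>\<open>tilde_step M b\<close>. An arrow is a triple of source, target and equivalence class.\<close>

definition tilde_step :: "('o, 'm, 'x) mon_cat_scheme \<Rightarrow> 'o \<Rightarrow> 'o \<times> 'm \<Rightarrow> 'o \<times> 'm \<Rightarrow> bool" where
  "tilde_step M b = (\<lambda>(t, f) (t', f').
     b \<in> Obj M \<and> t \<in> Obj M \<and> f \<in> Arr M \<and> Cod M f = b \<odot>\<^bsub>M\<^esub> t \<and>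
     (\<exists>s \<in> Hom M t t'. f' = (Ide M b \<boxtimes>\<^bsub>M\<^esub> s) \<cdot>\<^bsub>M\<^esub> f))"

definition tilde_cls :: "('o, 'm, 'x) mon_cat_scheme \<Rightarrow> 'o \<Rightarrow> 'o \<times> 'm \<Rightarrow> ('o \<times> 'm) set" where
  "tilde_cls M b p = {q. equivclp (tilde_step M b) p q}"

type_synonym ('o, 'm) tilde_arr = "'o \<times> 'o \<times> ('o \<times> 'm) set"

definition tilde_comp ::
  "('o, 'm, 'x) mon_cat_scheme \<Rightarrow> ('o, 'm) tilde_arr \<Rightarrow> ('o, 'm) tilde_arr \<Rightarrow> ('o, 'm) tilde_arr" where
  "tilde_comp M = (\<lambda>(b, c, Y) (a, b', X).
     (a, c, \<Union>(t, f) \<in> X. \<Union>(u, g) \<in> Y.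
        tilde_cls M c (u \<odot>\<^bsub>M\<^esub> t, Assoc M c u t \<cdot>\<^bsub>M\<^esub> (g \<boxtimes>\<^bsub>M\<^esub> Ide M t) \<cdot>\<^bsub>M\<^esub> f)))"

definition tilde_tensor ::
  "('o, 'm, 'x) mon_cat_scheme \<Rightarrow> ('o, 'm) tilde_arr \<Rightarrow> ('o, 'm) tilde_arr \<Rightarrow> ('o, 'm) tilde_arr" where
  "tilde_tensor M = (\<lambda>(a, b, X) (c, d, Y).
     (a \<odot>\<^bsub>M\<^esub> c, b \<odot>\<^bsub>M\<^esub> d, \<Union>(t, f) \<in> X. \<Union>(u, g) \<in> Y.
        tilde_cls M (b \<odot>\<^bsub>M\<^esub> d) (t \<odot>\<^bsub>M\<^esub> u, interchange M b t d u \<cdot>\<^bsub>M\<^esub> (f \<boxtimes>\<^bsub>M\<^esub> g))))"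

definition tilde_eta :: "('o, 'm, 'x) mon_cat_scheme \<Rightarrow> 'm \<Rightarrow> ('o, 'm) tilde_arr" where
  "tilde_eta M f = (Dom M f, Cod M f, tilde_cls M (Cod M f) (Unit M, inv_arr M (RUnit M (Cod M f)) \<cdot>\<^bsub>M\<^esub> f))"

definition tilde :: "('o, 'm, 'x) mon_cat_scheme \<Rightarrow> ('o, ('o, 'm) tilde_arr) mon_cat" where
  "tilde M =
     \<lparr>Obj = Obj M,
      Arr = {(a, b, tilde_cls M b (t, f)) | a b t f.
               a \<in> Obj M \<and> b \<in> Obj M \<and> t \<in> Obj M \<and> f \<in> Hom M a (b \<odot>\<^bsub>M\<^esub> t)},
      Dom = (\<lambda>(a, b, X). a), Cod = (\<lambda>(a, b, X). b),
      Ide = (\<lambda>a. tilde_eta M (Ide M a)),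
      Comp = tilde_comp M,
      Tensor = Tensor M,
      TensorArr = tilde_tensor M,
      Unit = Unit M,
      Assoc = (\<lambda>a b c. tilde_eta M (Assoc M a b c)),
      LUnit = (\<lambda>a. tilde_eta M (LUnit M a)),
      RUnit = (\<lambda>a. tilde_eta M (RUnit M a)),
      Braid = (\<lambda>a b. tilde_eta M (Braid M a b))\<rparr>"

text \<open>The canonical extension of a \<^emph>\<open>strict\<close> monoidal functor \<open>\<Phi>\<close> from \<open>M\<close> to a symmetric monoidal
  category \<open>N\<close> with null unit: it sends the class of \<open>f : a \<rightarrow> b \<otimes> t\<close> to the composite
  \<open>\<Phi>(a) \<rightarrow> \<Phi>(b) \<otimes> \<Phi>(t) \<rightarrow> \<Phi>(b) \<otimes> 1 \<rightarrow> \<Phi>(b)\<close>, which depends only on the class.\<close>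

definition tilde_extension :: "('o, 'm, 'x) mon_cat_scheme \<Rightarrow> ('p, 'q, 'y) mon_cat_scheme \<Rightarrow>
    ('o, 'm, 'p, 'q) cat_functor \<Rightarrow> ('o, ('o, 'm) tilde_arr, 'p, 'q) cat_functor" where
  "tilde_extension M N \<Phi> =
     \<lparr>FObj = FObj \<Phi>,
      FArr = (\<lambda>(a, b, X) \<in> Arr (tilde M). THE h. \<forall>(t, f) \<in> X.
         h = RUnit N (FObj \<Phi> b) \<cdot>\<^bsub>N\<^esub>
             (Ide N (FObj \<Phi> b) \<boxtimes>\<^bsub>N\<^esub> to_unit N (FObj \<Phi> t)) \<cdot>\<^bsub>N\<^esub> FArr \<Phi> f)\<rparr>"


section \<open>Polynomial functors\<close>

definition left_tensor :: "('o, 'm, 'x) mon_cat_scheme \<Rightarrow> 'o \<Rightarrow> ('o, 'm, 'o, 'm) cat_functor" where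
  "left_tensor N x = \<lparr>FObj = (\<lambda>y \<in> Obj N. x \<odot>\<^bsub>N\<^esub> y), FArr = (\<lambda>f \<in> Arr N. Ide N x \<boxtimes>\<^bsub>N\<^esub> f)\<rparr>"

text \<open>The map from \<open>F\<close> to \<open>F(x \<otimes> -)\<close> induced by the arrow from the unit to \<open>x\<close>.\<close>

definition shift_map ::
  "('o, 'm, 'x) mon_cat_scheme \<Rightarrow> 'o \<Rightarrow> ('o, 'm, 'p, 'q) cat_functor \<Rightarrow> ('o, 'm, 'p, 'q) nat_trans" where
  "shift_map N x F =
     \<lparr>NDom = F, NCod = comp_functor N F (left_tensor N x),
      NCmp = (\<lambda>y \<in> Obj N. FArr F ((from_unit N x \<boxtimes>\<^bsub>N\<^esub> Ide N y) \<cdot>\<^bsub>N\<^esub> inv_arr N (LUnit N y)))\<rparr>"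

text \<open>The functor \<open>\<delta>\<^sub>x(F)\<close> is only defined up to isomorphism: it is the target of any cokernel
  \<open>\<pi>\<close> of \<^term>\<open>shift_map N x F\<close> in the functor category. Accordingly, \<open>{0}\<close> in negative degrees
  means the functors all of whose values are null objects.\<close>

inductive polynomial ::
  "('o, 'm, 'x) mon_cat_scheme \<Rightarrow> ('p, 'q, 'y) cat_scheme \<Rightarrow> int \<Rightarrow> ('o, 'm, 'p, 'q) cat_functor \<Rightarrow> bool"
  for N :: "('o, 'm, 'x) mon_cat_scheme" and B :: "('p, 'q, 'y) cat_scheme" where
  neg: "\<lbrakk>n < 0; is_functor N B F; \<forall>x \<in> Obj N. is_null_obj B (FObj F x)\<rbrakk> \<Longrightarrow> polynomial N B n F"
| nonneg: "\<lbrakk>0 \<le> n; is_functor N B F;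
     \<forall>x \<in> Obj N. \<exists>\<pi>. is_cokernel (Fct N B) (shift_map N x F) \<pi> \<and> polynomial N B (n - 1) (NCod \<pi>)\<rbrakk>
     \<Longrightarrow> polynomial N B n F"

definition Pol :: "int \<Rightarrow> ('o, 'm, 'x) mon_cat_scheme \<Rightarrow> ('p, 'q, 'y) cat_scheme \<Rightarrow>
    (('o, 'm, 'p, 'q) cat_functor, ('o, 'm, 'p, 'q) nat_trans) cat" where
  "Pol n N B = full_subcat (Fct N B) (polynomial N B n)"

end

theory Submission
  imports Defs
begin

text \<open>An arrow \<open>a \<rightarrow> b\<close> of the category associated with the split monomorphisms is a split
  monomorphism \<open>(f, g) : a \<rightarrow> b \<oplus> t\<close> in which \<open>g\<close> matters only up to mutual divisibility; the canonical
  functor to the additive category keeps \<open>f\<close>, so it is full and the identity on objects. Composing with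
  the idempotent \<open>(1, 1) : a \<rightarrow> a \<oplus> a\<close> replaces \<open>g\<close> by \<open>1\<close>; hence a functor factors through the
  additive category if and only if it sends these idempotents to identities. Polynomial functors do,
  by induction on the degree and a computation with the diagonal. Finally, the map from \<open>F\<close> to
  \<open>F(x \<oplus> -)\<close> is split, so its cokernels are characterised equationally and correspond to each other
  under precomposition. Hence precomposition is even bijective on objects and on arrows.\<close>

section \<open>Calculus in additive categories\<close>

text \<open>The obstacle is that the canonical functor is not faithful: for a non-null object a, the
  idempotent (1, 1) and the identity (1, 0) have the same image, but 1 and 0 do not divide each
  other. Fullness makes precomposition injective; its surjectivity has to be extracted from the
  degree. In negative degree this is immediate, since a null object has only one endomorphism. In
  the inductive step the diagonal a \<rightarrow> a \<oplus> a relates F(1, 1) to the action of (1,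
  1) on F(a \<oplus> -), and hence on a cokernel of lower degree. A second obstacle is that a
  cokernel in a functor category is tested against all functors, and those on the larger side may
  not come from the additive category. It is overcome by a projection x \<oplus> y \<rightarrow> y
  that exists on both sides. It is rarely a split monomorphism, but the braiding with x discarded
  represents it. Its naturality splits the map from F to F(x \<oplus> -) before anything is known
  about a factorization of F.\<close>

context category begin

lemma Hom_iff: "f \<in> Hom C a b \<longleftrightarrow> f \<in> Arr C \<and> Dom C f = a \<and> Cod C f = b"
  by (auto simp: Hom_def)

lemma arr_ide [simp]: "a \<in> Obj C \<Longrightarrow> Ide C a \<in> Arr C"
  and dom_ide [simp]: "a \<in> Obj C \<Longrightarrow> Dom C (Ide C a) = a"
  and cod_ide [simp]: "a \<in> Obj C \<Longrightarrow> Cod C (Ide C a) = a"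
  using ide_in_Hom[of a] by (auto simp: Hom_iff)

lemma obj_dom [simp]: "f \<in> Arr C \<Longrightarrow> Dom C f \<in> Obj C"
  and obj_cod [simp]: "f \<in> Arr C \<Longrightarrow> Cod C f \<in> Obj C"
  by (fact dom_in_Obj cod_in_Obj)+

lemma arr_comp [simp]: "\<lbrakk>f \<in> Arr C; g \<in> Arr C; Dom C g = Cod C f\<rbrakk> \<Longrightarrow> g \<cdot> f \<in> Arr C"
  and dom_comp [simp]: "\<lbrakk>f \<in> Arr C; g \<in> Arr C; Dom C g = Cod C f\<rbrakk> \<Longrightarrow> Dom C (g \<cdot> f) = Dom C f"
  and cod_comp [simp]: "\<lbrakk>f \<in> Arr C; g \<in> Arr C; Dom C g = Cod C f\<rbrakk> \<Longrightarrow> Cod C (g \<cdot> f) = Cod C g"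
  using comp_in_Hom[of f "Dom C f" "Cod C f" g "Cod C g"] by (auto simp: Hom_iff)

lemma ide_comp [simp]: "\<lbrakk>f \<in> Arr C; Cod C f = b\<rbrakk> \<Longrightarrow> Ide C b \<cdot> f = f"
  and comp_ide [simp]: "\<lbrakk>f \<in> Arr C; Dom C f = a\<rbrakk> \<Longrightarrow> f \<cdot> Ide C a = f"
  using comp_ide_left[of f "Dom C f"] comp_ide_right[of f _ "Cod C f"] by (auto simp: Hom_iff)

lemma assoc: "\<lbrakk>f \<in> Arr C; g \<in> Arr C; h \<in> Arr C; Dom C g = Cod C f; Dom C h = Cod C g\<rbrakk>
    \<Longrightarrow> (h \<cdot> g) \<cdot> f = h \<cdot> (g \<cdot> f)"
  using comp_assoc[of f "Dom C f" "Cod C f" g "Cod C g" h "Cod C h"] by (auto simp: Hom_iff)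

lemma inverse_pair_unique: "\<lbrakk>inverse_pair C f g; inverse_pair C f h\<rbrakk> \<Longrightarrow> g = h"
  unfolding inverse_pair_def Hom_iff by (metis assoc ide_comp comp_ide)

lemma inv_arr_eq: "inverse_pair C f g \<Longrightarrow> inv_arr C f = g"
  unfolding inv_arr_def by (blast intro: inverse_pair_unique)

lemma inverse_pair_ide: "a \<in> Obj C \<Longrightarrow> inverse_pair C (Ide C a) (Ide C a)"
  by (simp add: inverse_pair_def Hom_iff)

lemma split_mono_arr: "is_split_mono C f \<Longrightarrow> f \<in> Arr C"
  by (simp add: is_split_mono_def)

lemma split_monoI: "\<lbrakk>f \<in> Arr C; r \<in> Arr C; Dom C r = Cod C f; r \<cdot> f = Ide C (Dom C f)\<rbrakk> \<Longrightarrow> is_split_mono C f"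
  using cod_comp[of f r] by (auto simp: is_split_mono_def Hom_iff)

lemma split_monoE:
  assumes "is_split_mono C f"
  obtains r where "f \<in> Arr C" "r \<in> Arr C" "Dom C r = Cod C f" "Cod C r = Dom C f" "r \<cdot> f = Ide C (Dom C f)"
  using assms by (auto simp: is_split_mono_def Hom_iff)

lemma split_mono_comp:
  assumes "is_split_mono C f" "is_split_mono C g" "Dom C g = Cod C f"
  shows "is_split_mono C (g \<cdot> f)"
proof -
  obtain r where r: "f \<in> Arr C" "r \<in> Arr C" "Dom C r = Cod C f" "Cod C r = Dom C f" "r \<cdot> f = Ide C (Dom C f)"
    using assms(1) by (rule split_monoE)
  obtain s where s: "g \<in> Arr C" "s \<in> Arr C" "Dom C s = Cod C g" "Cod C s = Dom C g" "s \<cdot> g = Ide C (Dom C g)"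
    using assms(2) by (rule split_monoE)
  have "s \<cdot> (g \<cdot> f) = f"
    using r s assms(3) by (simp flip: assoc)
  then show ?thesis
    using r s assms(3) by (intro split_monoI[of _ "r \<cdot> s"]) (simp_all add: assoc)
qed

lemma split_mono_inverse_pair:
  assumes "inverse_pair C f g"
  shows "is_split_mono C f" "is_split_mono C g"
  using assms by (auto simp: inverse_pair_def Hom_iff intro: split_monoI)

end

section \<open>Groups of arrows, null objects and biproducts\<close>

context additive_category begin

lemma arr_add [simp]: "\<lbrakk>f \<in> Arr C; g \<in> Arr C; Dom C f = Dom C g; Cod C f = Cod C g\<rbrakk> \<Longrightarrow> AddArr C f g \<in> Arr C"
  and dom_add [simp]: "\<lbrakk>f \<in> Arr C; g \<in> Arr C; Dom C f = Dom C g; Cod C f = Cod C g\<rbrakk> \<Longrightarrow> Dom C (AddArr C f g) = Dom C g"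
  and cod_add [simp]: "\<lbrakk>f \<in> Arr C; g \<in> Arr C; Dom C f = Dom C g; Cod C f = Cod C g\<rbrakk> \<Longrightarrow> Cod C (AddArr C f g) = Cod C g"
proof (atomize (full), safe)
  assume *: "f \<in> Arr C" "g \<in> Arr C" "Dom C f = Dom C g" "Cod C f = Cod C g"
  then interpret G: comm_group "\<lparr>carrier = Hom C (Dom C g) (Cod C g), monoid.mult = AddArr C, one = ZeroArr C (Dom C g) (Cod C g)\<rparr>"
    by (intro hom_group) auto
  have "AddArr C f g \<in> Hom C (Dom C g) (Cod C g)"
    using G.m_closed[of f g] * by (simp add: Hom_iff)
  then show "AddArr C f g \<in> Arr C" "Dom C (AddArr C f g) = Dom C g" "Cod C (AddArr C f g) = Cod C g"
    by (auto simp: Hom_iff)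
qed

lemma arr_zero [simp]: "\<lbrakk>a \<in> Obj C; b \<in> Obj C\<rbrakk> \<Longrightarrow> ZeroArr C a b \<in> Arr C"
  and dom_zero [simp]: "\<lbrakk>a \<in> Obj C; b \<in> Obj C\<rbrakk> \<Longrightarrow> Dom C (ZeroArr C a b) = a"
  and cod_zero [simp]: "\<lbrakk>a \<in> Obj C; b \<in> Obj C\<rbrakk> \<Longrightarrow> Cod C (ZeroArr C a b) = b"
  using monoid.one_closed[OF group.is_monoid[OF comm_group.axioms(2)[OF hom_group[of a b]]]]
  by (auto simp: Hom_iff)

lemma add_zero [simp]: "\<lbrakk>f \<in> Arr C; Dom C f = a; Cod C f = b\<rbrakk> \<Longrightarrow> AddArr C f (ZeroArr C a b) = f"
  and zero_add [simp]: "\<lbrakk>f \<in> Arr C; Dom C f = a; Cod C f = b\<rbrakk> \<Longrightarrow> AddArr C (ZeroArr C a b) f = f"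
  and add_commute: "\<lbrakk>f \<in> Arr C; g \<in> Arr C; Dom C f = Dom C g; Cod C f = Cod C g\<rbrakk> \<Longrightarrow> AddArr C f g = AddArr C g f"
  and add_self: "\<lbrakk>f \<in> Arr C; AddArr C f f = f\<rbrakk> \<Longrightarrow> f = ZeroArr C (Dom C f) (Cod C f)"
  and add_inverse: "f \<in> Arr C \<Longrightarrow> \<exists>g \<in> Hom C (Dom C f) (Cod C f). AddArr C g f = ZeroArr C (Dom C f) (Cod C f)"
  and add_assoc: "\<lbrakk>f \<in> Arr C; g \<in> Arr C; h \<in> Arr C; Dom C f = Dom C g; Cod C f = Cod C g; Dom C g = Dom C h; Cod C g = Cod C h\<rbrakk>
     \<Longrightarrow> AddArr C (AddArr C f g) h = AddArr C f (AddArr C g h)"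
proof -
  have *: "f \<in> Arr C \<Longrightarrow> comm_group \<lparr>carrier = Hom C (Dom C f) (Cod C f), monoid.mult = AddArr C, one = ZeroArr C (Dom C f) (Cod C f)\<rparr>" for f
    by (intro hom_group) auto
  show "\<lbrakk>f \<in> Arr C; Dom C f = a; Cod C f = b\<rbrakk> \<Longrightarrow> AddArr C f (ZeroArr C a b) = f"
    "\<lbrakk>f \<in> Arr C; Dom C f = a; Cod C f = b\<rbrakk> \<Longrightarrow> AddArr C (ZeroArr C a b) f = f"
    using monoid.r_one[OF group.is_monoid[OF comm_group.axioms(2)[OF *[of f]]], of f]
       monoid.l_one[OF group.is_monoid[OF comm_group.axioms(2)[OF *[of f]]], of f]
    by (auto simp: Hom_iff)
  show "\<lbrakk>f \<in> Arr C; g \<in> Arr C; Dom C f = Dom C g; Cod C f = Cod C g\<rbrakk> \<Longrightarrow> AddArr C f g = AddArr C g f"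
    using comm_monoid.m_comm[OF comm_group.axioms(1)[OF *[of f]], of f g] by (auto simp: Hom_iff)
  show "\<lbrakk>f \<in> Arr C; AddArr C f f = f\<rbrakk> \<Longrightarrow> f = ZeroArr C (Dom C f) (Cod C f)"
    using group.l_cancel_one[OF comm_group.axioms(2)[OF *[of f]], of f f] by (auto simp: Hom_iff)
  show "f \<in> Arr C \<Longrightarrow> \<exists>g \<in> Hom C (Dom C f) (Cod C f). AddArr C g f = ZeroArr C (Dom C f) (Cod C f)"
    using group.l_inv_ex[OF comm_group.axioms(2)[OF *[of f]], of f] by (auto simp: Hom_iff)
  show "\<lbrakk>f \<in> Arr C; g \<in> Arr C; h \<in> Arr C; Dom C f = Dom C g; Cod C f = Cod C g; Dom C g = Dom C h; Cod C g = Cod C h\<rbrakk>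
     \<Longrightarrow> AddArr C (AddArr C f g) h = AddArr C f (AddArr C g h)"
    using monoid.m_assoc[OF group.is_monoid[OF comm_group.axioms(2)[OF *[of f]]], of f g h] by (auto simp: Hom_iff)
qed

lemma add_comp: "\<lbrakk>f \<in> Arr C; g \<in> Arr C; h \<in> Arr C; Dom C g = Cod C f; Dom C h = Cod C f; Cod C g = Cod C h\<rbrakk>
    \<Longrightarrow> AddArr C g h \<cdot> f = AddArr C (g \<cdot> f) (h \<cdot> f)"
  by (rule comp_add_left[of f "Dom C f" "Cod C f" g "Cod C h" h]) (auto simp: Hom_iff)

lemma comp_add: "\<lbrakk>f \<in> Arr C; g \<in> Arr C; h \<in> Arr C; Dom C f = Dom C g; Cod C f = Cod C g; Dom C h = Cod C f\<rbrakk>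
    \<Longrightarrow> h \<cdot> AddArr C f g = AddArr C (h \<cdot> f) (h \<cdot> g)"
  by (rule comp_add_right[of f "Dom C f" "Cod C f" g h "Cod C h"]) (auto simp: Hom_iff)

lemma zero_comp [simp]: "\<lbrakk>f \<in> Arr C; Cod C f = a; b \<in> Obj C\<rbrakk> \<Longrightarrow> ZeroArr C a b \<cdot> f = ZeroArr C (Dom C f) b"
  using add_comp[of f "ZeroArr C a b" "ZeroArr C a b", symmetric] add_self[of "ZeroArr C a b \<cdot> f"] by auto

lemma comp_zero [simp]: "\<lbrakk>f \<in> Arr C; Dom C f = b; a \<in> Obj C\<rbrakk> \<Longrightarrow> f \<cdot> ZeroArr C a b = ZeroArr C a (Cod C f)"
  using comp_add[of "ZeroArr C a b" "ZeroArr C a b" f, symmetric] add_self[of "f \<cdot> ZeroArr C a b"] by auto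

lemma obj_zero [simp]: "ZeroObj C \<in> Obj C"
  using null_ZeroObj by (simp add: is_null_obj_def)

lemma to_null_obj: "\<lbrakk>is_null_obj C z; f \<in> Arr C; Cod C f = z\<rbrakk> \<Longrightarrow> f = ZeroArr C (Dom C f) z"
  unfolding is_null_obj_def
  by (drule conjunct2, drule bspec[of _ _ "Dom C f"], simp) (metis Hom_iff arr_zero cod_zero dom_zero obj_dom obj_cod)

lemma from_null_obj: "\<lbrakk>is_null_obj C z; f \<in> Arr C; Dom C f = z\<rbrakk> \<Longrightarrow> f = ZeroArr C z (Cod C f)"
  unfolding is_null_obj_def
  by (drule conjunct2, drule bspec[of _ _ "Cod C f"], simp) (metis Hom_iff arr_zero cod_zero dom_zero obj_dom obj_cod)

lemma null_obj_iff: "is_null_obj C a \<longleftrightarrow> a \<in> Obj C \<and> Ide C a = ZeroArr C a a"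
proof safe
  assume a: "a \<in> Obj C" "Ide C a = ZeroArr C a a"
  have "f = ZeroArr C a b" if "f \<in> Hom C a b" for f b
    using that a comp_ide[of f a] by (auto simp: Hom_iff simp del: comp_ide)
  moreover have "f = ZeroArr C b a" if "f \<in> Hom C b a" for f b
    using that a ide_comp[of f a] by (auto simp: Hom_iff simp del: ide_comp)
  ultimately show "is_null_obj C a"
    using a(1) unfolding is_null_obj_def by (metis Hom_iff arr_zero cod_zero dom_zero)
qed (use to_null_obj[of a "Ide C a"] in \<open>auto simp: is_null_obj_def\<close>)

lemma obj_dsum [simp]: "\<lbrakk>a \<in> Obj C; b \<in> Obj C\<rbrakk> \<Longrightarrow> DSum C a b \<in> Obj C"
  by (fact DSum_in_Obj)

lemma biproduct_arrows [simp]: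
  assumes "a \<in> Obj C" "b \<in> Obj C"
  shows "Inj1 C a b \<in> Arr C" "Dom C (Inj1 C a b) = a" "Cod C (Inj1 C a b) = DSum C a b"
    "Inj2 C a b \<in> Arr C" "Dom C (Inj2 C a b) = b" "Cod C (Inj2 C a b) = DSum C a b"
    "Prj1 C a b \<in> Arr C" "Dom C (Prj1 C a b) = DSum C a b" "Cod C (Prj1 C a b) = a"
    "Prj2 C a b \<in> Arr C" "Dom C (Prj2 C a b) = DSum C a b" "Cod C (Prj2 C a b) = b"
  using Inj1_in_Hom[OF assms] Inj2_in_Hom[OF assms] Prj1_in_Hom[OF assms] Prj2_in_Hom[OF assms]
  by (auto simp: Hom_iff)

lemma arr_pairing [simp]: "\<lbrakk>f \<in> Arr C; g \<in> Arr C; Dom C f = Dom C g\<rbrakk> \<Longrightarrow> pairing C f g \<in> Arr C"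
  and dom_pairing [simp]: "\<lbrakk>f \<in> Arr C; g \<in> Arr C; Dom C f = Dom C g\<rbrakk> \<Longrightarrow> Dom C (pairing C f g) = Dom C g"
  and cod_pairing [simp]: "\<lbrakk>f \<in> Arr C; g \<in> Arr C; Dom C f = Dom C g\<rbrakk> \<Longrightarrow> Cod C (pairing C f g) = DSum C (Cod C f) (Cod C g)"
  by (simp_all add: pairing_def)

lemma prj1_pairing [simp]: "\<lbrakk>f \<in> Arr C; g \<in> Arr C; Dom C f = Dom C g; Cod C f = a; Cod C g = b\<rbrakk>
    \<Longrightarrow> Prj1 C a b \<cdot> pairing C f g = f"
  by (auto simp: pairing_def comp_add Prj1_Inj1 Prj1_Inj2 simp flip: assoc)

lemma prj2_pairing [simp]: "\<lbrakk>f \<in> Arr C; g \<in> Arr C; Dom C f = Dom C g; Cod C f = a; Cod C g = b\<rbrakk>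
    \<Longrightarrow> Prj2 C a b \<cdot> pairing C f g = g"
  by (auto simp: pairing_def comp_add Prj2_Inj1 Prj2_Inj2 simp flip: assoc)

lemma pairing_prj: "\<lbrakk>f \<in> Arr C; Cod C f = DSum C a b; a \<in> Obj C; b \<in> Obj C\<rbrakk>
    \<Longrightarrow> pairing C (Prj1 C a b \<cdot> f) (Prj2 C a b \<cdot> f) = f"
  using biproduct_sum[of a b] add_comp[of f "Inj1 C a b \<cdot> Prj1 C a b" "Inj2 C a b \<cdot> Prj2 C a b"]
  by (simp add: pairing_def assoc)

lemma prj_eqI:
  assumes "f \<in> Arr C" "g \<in> Arr C" "Cod C f = DSum C a b" "Cod C g = DSum C a b" "a \<in> Obj C" "b \<in> Obj C"
    and "Prj1 C a b \<cdot> f = Prj1 C a b \<cdot> g" "Prj2 C a b \<cdot> f = Prj2 C a b \<cdot> g"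
  shows "f = g"
  using pairing_prj[of f a b] pairing_prj[of g a b] assms by metis

lemma pairing_comp [simp]: "\<lbrakk>f \<in> Arr C; g \<in> Arr C; h \<in> Arr C; Dom C f = Dom C g; Cod C h = Dom C g\<rbrakk>
    \<Longrightarrow> pairing C f g \<cdot> h = pairing C (f \<cdot> h) (g \<cdot> h)"
  by (simp add: pairing_def add_comp assoc)

lemma pairing_prjs [simp]: "\<lbrakk>a \<in> Obj C; b \<in> Obj C\<rbrakk> \<Longrightarrow> pairing C (Prj1 C a b) (Prj2 C a b) = Ide C (DSum C a b)"
  using pairing_prj[of "Ide C (DSum C a b)" a b] by simp

end

section \<open>Functor categories\<close>

lemma is_functorD:
  assumes "is_functor C D F"
  shows "\<And>a. a \<in> Obj C \<Longrightarrow> FObj F a \<in> Obj D"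
    and "\<And>f. f \<in> Arr C \<Longrightarrow> FArr F f \<in> Arr D"
    and "\<And>f. f \<in> Arr C \<Longrightarrow> Dom D (FArr F f) = FObj F (Dom C f)"
    and "\<And>f. f \<in> Arr C \<Longrightarrow> Cod D (FArr F f) = FObj F (Cod C f)"
    and "\<And>a. a \<in> Obj C \<Longrightarrow> FArr F (Ide C a) = Ide D (FObj F a)"
    and "\<And>f g. \<lbrakk>f \<in> Arr C; g \<in> Arr C; Dom C g = Cod C f\<rbrakk> \<Longrightarrow> FArr F (g \<cdot>\<^bsub>C\<^esub> f) = FArr F g \<cdot>\<^bsub>D\<^esub> FArr F f"
    and "FObj F \<in> extensional (Obj C)" "FArr F \<in> extensional (Arr C)"
  using assms by (auto simp: is_functor_def PiE_iff)

lemma is_functorI: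
  assumes "FObj F \<in> extensional (Obj C)" "FArr F \<in> extensional (Arr C)"
    and "\<And>a. a \<in> Obj C \<Longrightarrow> FObj F a \<in> Obj D"
    and "\<And>f. f \<in> Arr C \<Longrightarrow> FArr F f \<in> Arr D"
    and "\<And>f. f \<in> Arr C \<Longrightarrow> Dom D (FArr F f) = FObj F (Dom C f)"
    and "\<And>f. f \<in> Arr C \<Longrightarrow> Cod D (FArr F f) = FObj F (Cod C f)"
    and "\<And>a. a \<in> Obj C \<Longrightarrow> FArr F (Ide C a) = Ide D (FObj F a)"
    and "\<And>f g. \<lbrakk>f \<in> Arr C; g \<in> Arr C; Dom C g = Cod C f\<rbrakk> \<Longrightarrow> FArr F (g \<cdot>\<^bsub>C\<^esub> f) = FArr F g \<cdot>\<^bsub>D\<^esub> FArr F f"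
  shows "is_functor C D F"
  using assms by (auto simp: is_functor_def PiE_iff)

lemma functor_eqI:
  fixes F G :: "('o, 'm, 'p, 'q) cat_functor"
  assumes "is_functor C D F" "is_functor C D G"
    and "\<And>a. a \<in> Obj C \<Longrightarrow> FObj F a = FObj G a" "\<And>f. f \<in> Arr C \<Longrightarrow> FArr F f = FArr G f"
  shows "F = G"
proof -
  have "FObj F = FObj G" "FArr F = FArr G"
    using assms by (auto intro: extensionalityI is_functorD(7,8))
  then show ?thesis by simp
qed

lemma comp_functor_sel [simp]:
  "a \<in> Obj C \<Longrightarrow> FObj (comp_functor C G F) a = FObj G (FObj F a)"
  "f \<in> Arr C \<Longrightarrow> FArr (comp_functor C G F) f = FArr G (FArr F f)"
  by (simp_all add: comp_functor_def)

lemma is_functor_comp: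
  assumes "category C" "is_functor C D F" "is_functor D E G"
  shows "is_functor C E (comp_functor C G F)"
proof -
  interpret category C by fact
  show ?thesis
    using assms(2,3)
    by (intro is_functorI) (auto simp: is_functorD[OF assms(2)] is_functorD[OF assms(3)], auto simp: comp_functor_def)
qed

lemma Fct_sel [simp]:
  "Obj (Fct C D) = {F. is_functor C D F}" "Arr (Fct C D) = {\<tau>. is_nat_trans C D \<tau>}"
  "Dom (Fct C D) = NDom" "Cod (Fct C D) = NCod"
  "Ide (Fct C D) F = \<lparr>NDom = F, NCod = F, NCmp = (\<lambda>a \<in> Obj C. Ide D (FObj F a))\<rparr>"
  "\<sigma> \<cdot>\<^bsub>Fct C D\<^esub> \<tau> = \<lparr>NDom = NDom \<tau>, NCod = NCod \<sigma>, NCmp = (\<lambda>a \<in> Obj C. NCmp \<sigma> a \<cdot>\<^bsub>D\<^esub> NCmp \<tau> a)\<rparr>"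
  by (simp_all add: Fct_def)

lemma Hom_Fct: "Hom (Fct C D) F G = {\<tau>. is_nat_trans C D \<tau> \<and> NDom \<tau> = F \<and> NCod \<tau> = G}"
  by (simp add: Hom_def)

lemma is_nat_transD:
  assumes "is_nat_trans C D \<tau>"
  shows "is_functor C D (NDom \<tau>)" "is_functor C D (NCod \<tau>)" "NCmp \<tau> \<in> extensional (Obj C)"
    and "\<And>a. a \<in> Obj C \<Longrightarrow> NCmp \<tau> a \<in> Arr D"
    and "\<And>a. a \<in> Obj C \<Longrightarrow> Dom D (NCmp \<tau> a) = FObj (NDom \<tau>) a"
    and "\<And>a. a \<in> Obj C \<Longrightarrow> Cod D (NCmp \<tau> a) = FObj (NCod \<tau>) a"
    and "\<And>f. f \<in> Arr C \<Longrightarrow> NCmp \<tau> (Cod C f) \<cdot>\<^bsub>D\<^esub> FArr (NDom \<tau>) f = FArr (NCod \<tau>) f \<cdot>\<^bsub>D\<^esub> NCmp \<tau> (Dom C f)"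
  using assms by (auto simp: is_nat_trans_def Hom_def)

lemma is_nat_transI:
  assumes "is_functor C D (NDom \<tau>)" "is_functor C D (NCod \<tau>)" "NCmp \<tau> \<in> extensional (Obj C)"
    and "\<And>a. a \<in> Obj C \<Longrightarrow> NCmp \<tau> a \<in> Arr D"
    and "\<And>a. a \<in> Obj C \<Longrightarrow> Dom D (NCmp \<tau> a) = FObj (NDom \<tau>) a"
    and "\<And>a. a \<in> Obj C \<Longrightarrow> Cod D (NCmp \<tau> a) = FObj (NCod \<tau>) a"
    and "\<And>f. f \<in> Arr C \<Longrightarrow> NCmp \<tau> (Cod C f) \<cdot>\<^bsub>D\<^esub> FArr (NDom \<tau>) f = FArr (NCod \<tau>) f \<cdot>\<^bsub>D\<^esub> NCmp \<tau> (Dom C f)"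
  shows "is_nat_trans C D \<tau>"
  using assms by (auto simp: is_nat_trans_def Hom_def)

lemma nat_trans_eqI:
  fixes \<sigma> \<tau> :: "('o, 'm, 'p, 'q) nat_trans"
  assumes "is_nat_trans C D \<sigma>" "is_nat_trans C D \<tau>" "NDom \<sigma> = NDom \<tau>" "NCod \<sigma> = NCod \<tau>"
    and "\<And>a. a \<in> Obj C \<Longrightarrow> NCmp \<sigma> a = NCmp \<tau> a"
  shows "\<sigma> = \<tau>"
proof -
  have "NCmp \<sigma> = NCmp \<tau>"
    using assms by (auto intro: extensionalityI is_nat_transD(3))
  then show ?thesis using assms(3,4) by simp
qed

lemma is_nat_trans_ide:
  assumes "category C" "category D" "is_functor C D F"
  shows "is_nat_trans C D (Ide (Fct C D) F)"
proof -
  interpret C: category C by fact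
  interpret D: category D by fact
  show ?thesis
    using assms(3) by (intro is_nat_transI) (auto simp: is_functorD)
qed

lemma is_nat_trans_comp:
  assumes "category C" "category D" "is_nat_trans C D \<sigma>" "is_nat_trans C D \<tau>" "NDom \<sigma> = NCod \<tau>"
  shows "is_nat_trans C D (\<sigma> \<cdot>\<^bsub>Fct C D\<^esub> \<tau>)"
proof -
  interpret C: category C by fact
  interpret D: category D by fact
  note S = is_nat_transD[OF assms(3)] and T = is_nat_transD[OF assms(4)]
  show ?thesis
  proof (rule is_nat_transI)
    fix f assume f: "f \<in> Arr C"
    note [simp] = S(4-6) T(4-6) assms(5) is_functorD(1-4)[OF S(1)] is_functorD(1-4)[OF S(2)] is_functorD(1-4)[OF T(1)]
      is_functorD(1-4)[OF T(2)]
    have "(NCmp \<sigma> (Cod C f) \<cdot>\<^bsub>D\<^esub> NCmp \<tau> (Cod C f)) \<cdot>\<^bsub>D\<^esub> FArr (NDom \<tau>) f =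
        NCmp \<sigma> (Cod C f) \<cdot>\<^bsub>D\<^esub> (FArr (NCod \<tau>) f \<cdot>\<^bsub>D\<^esub> NCmp \<tau> (Dom C f))"
      using f T(7)[OF f] by (subst D.assoc) (auto simp flip: assms(5))
    also have "\<dots> = (NCmp \<sigma> (Cod C f) \<cdot>\<^bsub>D\<^esub> FArr (NDom \<sigma>) f) \<cdot>\<^bsub>D\<^esub> NCmp \<tau> (Dom C f)"
      using f by (subst D.assoc) (auto simp flip: assms(5))
    also have "\<dots> = FArr (NCod \<sigma>) f \<cdot>\<^bsub>D\<^esub> (NCmp \<sigma> (Dom C f) \<cdot>\<^bsub>D\<^esub> NCmp \<tau> (Dom C f))"
      unfolding S(7)[OF f] using f by (subst D.assoc) auto
    finally show "NCmp (\<sigma> \<cdot>\<^bsub>Fct C D\<^esub> \<tau>) (Cod C f) \<cdot>\<^bsub>D\<^esub> FArr (NDom (\<sigma> \<cdot>\<^bsub>Fct C D\<^esub> \<tau>)) f =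
       FArr (NCod (\<sigma> \<cdot>\<^bsub>Fct C D\<^esub> \<tau>)) f \<cdot>\<^bsub>D\<^esub> NCmp (\<sigma> \<cdot>\<^bsub>Fct C D\<^esub> \<tau>) (Dom C f)"
      using f by simp
  qed (use assms(5) S T in auto)
qed

lemma category_Fct:
  assumes "category C" "category D"
  shows "category (Fct C D)"
proof -
  interpret C: category C by fact
  interpret D: category D by fact
  show ?thesis
  proof (unfold_locales, goal_cases)
    case (3 F) then show ?case
      using is_nat_trans_ide[OF assms, of F] by (simp add: Hom_Fct)
  next
    case (4 f a b g c) then show ?case
      using is_nat_trans_comp[OF assms, of g f] by (simp add: Hom_Fct)
  next
    case (5 \<tau> F G)
    then show ?case
      using is_nat_trans_comp[OF assms is_nat_trans_ide[OF assms, of G], of \<tau>]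
      by (intro nat_trans_eqI) (auto simp: Hom_Fct is_nat_transD)
  next
    case (6 \<tau> F G)
    then show ?case
      using is_nat_trans_comp[OF assms _ is_nat_trans_ide[OF assms, of F], of \<tau>]
      by (intro nat_trans_eqI) (auto simp: Hom_Fct is_nat_transD)
  next
    case (7 f a b g c h d)
    then have "is_nat_trans C D f" "is_nat_trans C D g" "is_nat_trans C D h" "NDom g = NCod f" "NDom h = NCod g"
      by (auto simp: Hom_Fct)
    then show ?case
      by (simp add: fun_eq_iff restrict_def is_nat_transD D.assoc)
  qed (auto simp: is_nat_transD)
qed

lemma full_subcat_sel [simp]:
  "Obj (full_subcat C P) = {a \<in> Obj C. P a}"
  "Arr (full_subcat C P) = {f \<in> Arr C. P (Dom C f) \<and> P (Cod C f)}"
  "Dom (full_subcat C P) = Dom C" "Cod (full_subcat C P) = Cod C"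
  "Ide (full_subcat C P) = Ide C" "Comp (full_subcat C P) = Comp C"
  by (simp_all add: full_subcat_def)

lemma category_full_subcat:
  assumes "category C"
  shows "category (full_subcat C P)"
proof -
  interpret category C by fact
  have *: "f \<in> Hom (full_subcat C P) a b \<longleftrightarrow> f \<in> Hom C a b \<and> P a \<and> P b" for f a b
    by (auto simp: Hom_def)
  show ?thesis
    by unfold_locales (auto simp: *, auto simp: Hom_iff assoc)
qed

section \<open>Zero arrows and cokernels of split transformations\<close>

lemma is_zero_arr_Fct:
  assumes "category C" "additive_category B" "is_nat_trans C B \<tau>"
  shows "is_zero_arr (Fct C B) \<tau> \<longleftrightarrow>
    (\<forall>a \<in> Obj C. NCmp \<tau> a = ZeroArr B (FObj (NDom \<tau>) a) (FObj (NCod \<tau>) a))"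
proof
  interpret C: category C by fact
  interpret B: additive_category B by fact
  assume "is_zero_arr (Fct C B) \<tau>"
  then obtain Z g h where Z: "is_null_obj (Fct C B) Z" "is_nat_trans C B g" "NDom g = NDom \<tau>" "NCod g = Z"
    "is_nat_trans C B h" "NDom h = Z" "NCod h = NCod \<tau>" "\<tau> = h \<cdot>\<^bsub>Fct C B\<^esub> g"
    unfolding is_zero_arr_def Hom_Fct mem_Collect_eq Fct_sel(3,4) by blast
  have FZ: "is_functor C B Z" using Z(1) by (simp add: is_null_obj_def)
  \<comment> \<open>A null object Z has only one endomorphism. The identity and the pointwise zero
    both qualify, so the identity of every value of Z is zero, and whatever passes through Z
    vanishes pointwise.\<close>
  have "\<lparr>NDom = Z, NCod = Z, NCmp = (\<lambda>a \<in> Obj C. ZeroArr B (FObj Z a) (FObj Z a))\<rparr> \<in> Hom (Fct C B) Z Z"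
    using FZ by (auto simp: Hom_Fct is_functorD intro!: is_nat_transI)
  moreover have "Ide (Fct C B) Z \<in> Hom (Fct C B) Z Z"
    using is_nat_trans_ide[OF assms(1) B.category_axioms FZ] by (simp add: Hom_Fct)
  ultimately have "Ide (Fct C B) Z = \<lparr>NDom = Z, NCod = Z, NCmp = (\<lambda>a \<in> Obj C. ZeroArr B (FObj Z a) (FObj Z a))\<rparr>"
    using Z(1) FZ unfolding is_null_obj_def by (metis Fct_sel(1) mem_Collect_eq)
  then have eq: "Ide B (FObj Z a) = ZeroArr B (FObj Z a) (FObj Z a)" if "a \<in> Obj C" for a
    using that by (auto simp: fun_eq_iff restrict_def split: if_splits)
  show "\<forall>a \<in> Obj C. NCmp \<tau> a = ZeroArr B (FObj (NDom \<tau>) a) (FObj (NCod \<tau>) a)"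
  proof
    fix a assume a: "a \<in> Obj C"
    have "NCmp h a = NCmp h a \<cdot>\<^bsub>B\<^esub> Ide B (FObj Z a)"
      using a Z(5,6) by (simp add: is_nat_transD)
    also have "\<dots> = ZeroArr B (FObj Z a) (FObj (NCod \<tau>) a)"
      using a Z(5-7) FZ is_nat_transD(6)[OF Z(5) a] by (simp add: eq is_nat_transD is_functorD)
    finally have "NCmp \<tau> a = ZeroArr B (FObj Z a) (FObj (NCod \<tau>) a) \<cdot>\<^bsub>B\<^esub> NCmp g a"
      using a unfolding Z(8) by simp
    then show "NCmp \<tau> a = ZeroArr B (FObj (NDom \<tau>) a) (FObj (NCod \<tau>) a)"
      using a Z(2-4) is_functorD(1)[OF is_nat_transD(2)[OF assms(3)]] by (simp add: is_nat_transD)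
  qed
next
  interpret C: category C by fact
  interpret B: additive_category B by fact
  assume zero: "\<forall>a \<in> Obj C. NCmp \<tau> a = ZeroArr B (FObj (NDom \<tau>) a) (FObj (NCod \<tau>) a)"
  \<comment> \<open>The converse needs a concrete null object, the constant functor at
    \<open>ZeroObj B\<close>; a pointwise zero transformation factors through it.\<close>
  define Z where "Z = \<lparr>FObj = (\<lambda>a \<in> Obj C. ZeroObj B), FArr = (\<lambda>f \<in> Arr C. Ide B (ZeroObj B))\<rparr>"
  have FZ: "is_functor C B Z"
    by (rule is_functorI) (auto simp: Z_def)
  define to where "to F = \<lparr>NDom = F, NCod = Z, NCmp = (\<lambda>a \<in> Obj C. ZeroArr B (FObj F a) (ZeroObj B))\<rparr>" for F
  define from_zero where "from_zero F = \<lparr>NDom = Z, NCod = F, NCmp = (\<lambda>a \<in> Obj C. ZeroArr B (ZeroObj B) (FObj F a))\<rparr>" for F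
  have to: "to F \<in> Hom (Fct C B) F Z" if "is_functor C B F" for F
    using that FZ by (auto simp: Hom_Fct to_def is_functorD Z_def intro!: is_nat_transI)
  have from_z: "from_zero F \<in> Hom (Fct C B) Z F" if "is_functor C B F" for F
    using that FZ by (auto simp: Hom_Fct from_zero_def is_functorD Z_def intro!: is_nat_transI)
  have "is_null_obj (Fct C B) Z"
    unfolding is_null_obj_def
  proof (intro conjI ballI)
    show "Z \<in> Obj (Fct C B)" using FZ by simp
    fix F assume "F \<in> Obj (Fct C B)"
    then have F: "is_functor C B F" by simp
    show "\<exists>!f. f \<in> Hom (Fct C B) Z F"
    proof (intro ex1I[where a = "from_zero F"] from_z[OF F])
      fix \<sigma> assume "\<sigma> \<in> Hom (Fct C B) Z F"
      then have \<sigma>: "is_nat_trans C B \<sigma>" "NDom \<sigma> = Z" "NCod \<sigma> = F" by (auto simp: Hom_Fct)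
      then have "NCmp \<sigma> a = NCmp (from_zero F) a" if "a \<in> Obj C" for a
        using B.from_null_obj[OF B.null_ZeroObj, of "NCmp \<sigma> a"] that is_nat_transD(4-6)[OF \<sigma>(1)]
        by (simp add: from_zero_def Z_def)
      then show "\<sigma> = from_zero F"
        using from_z[OF F] \<sigma> by (intro nat_trans_eqI[of C B]) (simp_all add: Hom_Fct)
    qed
    show "\<exists>!f. f \<in> Hom (Fct C B) F Z"
    proof (intro ex1I[where a = "to F"] to[OF F])
      fix \<sigma> assume "\<sigma> \<in> Hom (Fct C B) F Z"
      then have \<sigma>: "is_nat_trans C B \<sigma>" "NDom \<sigma> = F" "NCod \<sigma> = Z" by (auto simp: Hom_Fct)
      then have "NCmp \<sigma> a = NCmp (to F) a" if "a \<in> Obj C" for a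
        using B.to_null_obj[OF B.null_ZeroObj, of "NCmp \<sigma> a"] that is_nat_transD(4-6)[OF \<sigma>(1)]
        by (simp add: to_def Z_def)
      then show "\<sigma> = to F"
        using to[OF F] \<sigma> by (intro nat_trans_eqI[of C B]) (simp_all add: Hom_Fct)
    qed
  qed
  moreover have F: "is_functor C B (NDom \<tau>)" "is_functor C B (NCod \<tau>)"
    using assms(3) by (auto simp: is_nat_transD)
  moreover have "\<tau> = from_zero (NCod \<tau>) \<cdot>\<^bsub>Fct C B\<^esub> to (NDom \<tau>)"
  proof (rule nat_trans_eqI[OF assms(3)])
    show "is_nat_trans C B (from_zero (NCod \<tau>) \<cdot>\<^bsub>Fct C B\<^esub> to (NDom \<tau>))"
      using from_z[OF F(2)] to[OF F(1)]
      by (intro is_nat_trans_comp[OF assms(1) B.category_axioms]) (auto simp: Hom_Fct)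
    show "NCmp \<tau> a = NCmp (from_zero (NCod \<tau>) \<cdot>\<^bsub>Fct C B\<^esub> to (NDom \<tau>)) a" if "a \<in> Obj C" for a
      using that zero F by (simp add: from_zero_def to_def is_functorD)
  qed (simp_all add: to_def from_zero_def)
  ultimately show "is_zero_arr (Fct C B) \<tau>"
    using to from_z unfolding is_zero_arr_def Fct_sel(3,4) by blast
qed

text \<open>The record of an additive category has no symbol for negatives. Differences such as 1 -
  \<tau> \<rho> are therefore introduced as solutions of an equation, and
  \<open>add_right_cancel\<close> pins them down.\<close>

lemma (in additive_category) difference_exists:
  assumes "f \<in> Arr C" "g \<in> Arr C" "Dom C f = Dom C g" "Cod C f = Cod C g"
  shows "\<exists>h \<in> Hom C (Dom C f) (Cod C f). AddArr C h g = f"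
proof -
  obtain k where "k \<in> Hom C (Dom C g) (Cod C g)" "AddArr C k g = ZeroArr C (Dom C g) (Cod C g)"
    using add_inverse[OF assms(2)] by blast
  then show ?thesis
    using assms by (intro bexI[of _ "AddArr C f k"]) (auto simp: Hom_iff add_assoc)
qed

lemma (in additive_category) add_right_cancel:
  assumes "AddArr C f h = AddArr C g h" "f \<in> Arr C" "g \<in> Arr C" "h \<in> Arr C"
    "Dom C f = Dom C h" "Dom C g = Dom C h" "Cod C f = Cod C h" "Cod C g = Cod C h"
  shows "f = g"
proof -
  obtain k where k: "k \<in> Hom C (Dom C h) (Cod C h)" "AddArr C k h = ZeroArr C (Dom C h) (Cod C h)"
    using add_inverse[OF assms(4)] by blast
  then have hk: "AddArr C h k = ZeroArr C (Dom C h) (Cod C h)"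
    using add_commute[of h k] assms(4) by (simp add: Hom_iff)
  have "f = AddArr C (AddArr C f h) k"
    using assms(2,4,5,7) k(1) by (subst add_assoc) (simp_all add: Hom_iff hk)
  also have "\<dots> = g"
    unfolding assms(1) using assms(3,4,6,8) k(1) by (subst add_assoc) (simp_all add: Hom_iff hk)
  finally show ?thesis .
qed

text \<open>The cokernel of a split monomorphism \<open>\<tau>\<close> with retraction \<open>\<rho>\<close> is a complement of \<open>\<tau>\<close> for
  which \<open>1 - \<tau> \<rho>\<close> is the projection; unlike the universal property, this is an equational condition.\<close>

lemma is_cokernel_split_iff:
  assumes "category C" "additive_category B"
    and \<tau>: "is_nat_trans C B \<tau>" and \<rho>: "is_nat_trans C B \<rho>" "NDom \<rho> = NCod \<tau>" "NCod \<rho> = NDom \<tau>"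
    and retraction: "\<And>a. a \<in> Obj C \<Longrightarrow> NCmp \<rho> a \<cdot>\<^bsub>B\<^esub> NCmp \<tau> a = Ide B (FObj (NDom \<tau>) a)"
    and \<pi>: "is_nat_trans C B \<pi>" "NDom \<pi> = NCod \<tau>"
  shows "is_cokernel (Fct C B) \<tau> \<pi> \<longleftrightarrow>
    (\<forall>a \<in> Obj C. NCmp \<pi> a \<cdot>\<^bsub>B\<^esub> NCmp \<tau> a = ZeroArr B (FObj (NDom \<tau>) a) (FObj (NCod \<pi>) a)) \<and>
    (\<exists>j. is_nat_trans C B j \<and> NDom j = NCod \<pi> \<and> NCod j = NCod \<tau> \<and>
      (\<forall>a \<in> Obj C. AddArr B (NCmp j a \<cdot>\<^bsub>B\<^esub> NCmp \<pi> a) (NCmp \<tau> a \<cdot>\<^bsub>B\<^esub> NCmp \<rho> a) = Ide B (FObj (NCod \<tau>) a) \<and>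
        NCmp \<pi> a \<cdot>\<^bsub>B\<^esub> NCmp j a = Ide B (FObj (NCod \<pi>) a)))"
    (is "?L \<longleftrightarrow> ?R")
proof -
  interpret C: category C by fact
  interpret B: additive_category B by fact
  note nt_comp = is_nat_trans_comp[OF assms(1) B.category_axioms]
  note [simp] = is_nat_transD(4-6)[OF \<tau>] is_nat_transD(4-6)[OF \<rho>(1)] is_nat_transD(4-6)[OF \<pi>(1)] \<rho>(2,3) \<pi>(2)
    is_functorD(1-4)[OF is_nat_transD(1)[OF \<tau>]] is_functorD(1-4)[OF is_nat_transD(2)[OF \<tau>]]
    is_functorD(1-4)[OF is_nat_transD(2)[OF \<pi>(1)]]
  have zero_iff: "is_zero_arr (Fct C B) (\<sigma> \<cdot>\<^bsub>Fct C B\<^esub> \<tau>) \<longleftrightarrow>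
      (\<forall>a \<in> Obj C. NCmp \<sigma> a \<cdot>\<^bsub>B\<^esub> NCmp \<tau> a = ZeroArr B (FObj (NDom \<tau>) a) (FObj (NCod \<sigma>) a))"
    if "is_nat_trans C B \<sigma>" "NDom \<sigma> = NCod \<tau>" for \<sigma>
    using is_zero_arr_Fct[OF assms(1,2) nt_comp[OF that(1) \<tau> that(2)]] by simp
  show ?thesis
  proof
    assume L: ?L
    then have \<pi>\<tau>: "\<forall>a \<in> Obj C. NCmp \<pi> a \<cdot>\<^bsub>B\<^esub> NCmp \<tau> a = ZeroArr B (FObj (NDom \<tau>) a) (FObj (NCod \<pi>) a)"
      using zero_iff[OF \<pi>] by (simp add: is_cokernel_def)
    \<comment> \<open>Here k stands for 1 - \<tau> \<rho>, chosen object by object. Naturality of k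
      and k \<tau> = 0 are not part of the choice; both follow by cancelling in k + \<tau> \<rho> =
      1.\<close>
    have "\<forall>a \<in> Obj C. \<exists>k \<in> Hom B (FObj (NCod \<tau>) a) (FObj (NCod \<tau>) a).
        AddArr B k (NCmp \<tau> a \<cdot>\<^bsub>B\<^esub> NCmp \<rho> a) = Ide B (FObj (NCod \<tau>) a)"
    proof
      fix a assume "a \<in> Obj C"
      then show "\<exists>k \<in> Hom B (FObj (NCod \<tau>) a) (FObj (NCod \<tau>) a).
        AddArr B k (NCmp \<tau> a \<cdot>\<^bsub>B\<^esub> NCmp \<rho> a) = Ide B (FObj (NCod \<tau>) a)"
        using B.difference_exists[of "Ide B (FObj (NCod \<tau>) a)" "NCmp \<tau> a \<cdot>\<^bsub>B\<^esub> NCmp \<rho> a"] by simp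
    qed
    then obtain k where k: "k a \<in> Arr B" "Dom B (k a) = FObj (NCod \<tau>) a" "Cod B (k a) = FObj (NCod \<tau>) a"
      "AddArr B (k a) (NCmp \<tau> a \<cdot>\<^bsub>B\<^esub> NCmp \<rho> a) = Ide B (FObj (NCod \<tau>) a)" if "a \<in> Obj C" for a
      by (metis B.Hom_iff)
    define \<kappa> where "\<kappa> = \<lparr>NDom = NCod \<tau>, NCod = NCod \<tau>, NCmp = restrict k (Obj C)\<rparr>"
    have \<kappa>: "is_nat_trans C B \<kappa>"
    proof (rule is_nat_transI)
      fix f assume f: "f \<in> Arr C"
      let ?a = "Dom C f" and ?b = "Cod C f" and ?G = "FArr (NCod \<tau>) f"
      have nat: "(NCmp \<tau> ?b \<cdot>\<^bsub>B\<^esub> NCmp \<rho> ?b) \<cdot>\<^bsub>B\<^esub> ?G = ?G \<cdot>\<^bsub>B\<^esub> (NCmp \<tau> ?a \<cdot>\<^bsub>B\<^esub> NCmp \<rho> ?a)"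
        using is_nat_transD(7)[OF nt_comp[OF \<tau> \<rho>(1)] f] f by simp
      have 1: "AddArr B (k ?b \<cdot>\<^bsub>B\<^esub> ?G) (?G \<cdot>\<^bsub>B\<^esub> (NCmp \<tau> ?a \<cdot>\<^bsub>B\<^esub> NCmp \<rho> ?a)) = ?G"
        using B.add_comp[of ?G "k ?b" "NCmp \<tau> ?b \<cdot>\<^bsub>B\<^esub> NCmp \<rho> ?b"] k[of ?b] f by (simp add: nat)
      have 2: "AddArr B (?G \<cdot>\<^bsub>B\<^esub> k ?a) (?G \<cdot>\<^bsub>B\<^esub> (NCmp \<tau> ?a \<cdot>\<^bsub>B\<^esub> NCmp \<rho> ?a)) = ?G"
        using B.comp_add[of "k ?a" "NCmp \<tau> ?a \<cdot>\<^bsub>B\<^esub> NCmp \<rho> ?a" ?G] k[of ?a] f by simp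
      have "k ?b \<cdot>\<^bsub>B\<^esub> ?G = ?G \<cdot>\<^bsub>B\<^esub> k ?a"
        by (rule B.add_right_cancel[OF trans[OF 1 2[symmetric]]]) (use k(1-3)[of ?a] k(1-3)[of ?b] f in simp_all)
      then show "NCmp \<kappa> ?b \<cdot>\<^bsub>B\<^esub> FArr (NDom \<kappa>) f = FArr (NCod \<kappa>) f \<cdot>\<^bsub>B\<^esub> NCmp \<kappa> ?a"
        using f by (simp add: \<kappa>_def)
    qed (use k is_nat_transD[OF \<tau>] in \<open>auto simp: \<kappa>_def\<close>)
    have "NCmp \<kappa> a \<cdot>\<^bsub>B\<^esub> NCmp \<tau> a = ZeroArr B (FObj (NDom \<tau>) a) (FObj (NCod \<kappa>) a)" if a: "a \<in> Obj C" for a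
    proof (rule B.add_right_cancel[of _ "NCmp \<tau> a"])
      have "AddArr B (k a \<cdot>\<^bsub>B\<^esub> NCmp \<tau> a) (NCmp \<tau> a) = NCmp \<tau> a"
        using B.add_comp[of "NCmp \<tau> a" "k a" "NCmp \<tau> a \<cdot>\<^bsub>B\<^esub> NCmp \<rho> a"] k[OF a] a by (simp add: B.assoc retraction)
      then show "AddArr B (NCmp \<kappa> a \<cdot>\<^bsub>B\<^esub> NCmp \<tau> a) (NCmp \<tau> a) =
          AddArr B (ZeroArr B (FObj (NDom \<tau>) a) (FObj (NCod \<kappa>) a)) (NCmp \<tau> a)"
        using a by (simp add: \<kappa>_def)
    qed (use a k[OF a] in \<open>simp_all add: \<kappa>_def\<close>)
    then have "is_zero_arr (Fct C B) (\<kappa> \<cdot>\<^bsub>Fct C B\<^esub> \<tau>)"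
      using zero_iff[OF \<kappa>] by (simp add: \<kappa>_def)
    then obtain j where j: "j \<in> Hom (Fct C B) (NCod \<pi>) (NCod \<tau>)" "j \<cdot>\<^bsub>Fct C B\<^esub> \<pi> = \<kappa>"
      using L \<kappa> unfolding is_cokernel_def by (auto simp: \<kappa>_def)
    then have j': "is_nat_trans C B j" "NDom j = NCod \<pi>" "NCod j = NCod \<tau>"
      by (auto simp: Hom_Fct)
    note [simp] = is_nat_transD(4-6)[OF j'(1)] j'(2,3)
    have j\<pi>: "NCmp j a \<cdot>\<^bsub>B\<^esub> NCmp \<pi> a = k a" if "a \<in> Obj C" for a
      using that arg_cong[OF j(2), of "\<lambda>\<sigma>. NCmp \<sigma> a"] by (simp add: \<kappa>_def)
    have \<pi>k: "NCmp \<pi> a \<cdot>\<^bsub>B\<^esub> k a = NCmp \<pi> a" if a: "a \<in> Obj C" for a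
    proof -
      have "NCmp \<pi> a \<cdot>\<^bsub>B\<^esub> (NCmp \<tau> a \<cdot>\<^bsub>B\<^esub> NCmp \<rho> a) = ZeroArr B (FObj (NCod \<tau>) a) (FObj (NCod \<pi>) a)"
        using a \<pi>\<tau> B.assoc[of "NCmp \<rho> a" "NCmp \<tau> a" "NCmp \<pi> a"] by simp
      then show ?thesis
        using B.comp_add[of "k a" "NCmp \<tau> a \<cdot>\<^bsub>B\<^esub> NCmp \<rho> a" "NCmp \<pi> a"] k[OF a] a by simp
    qed
    \<comment> \<open>Both \<pi> j and the identity give \<pi> when composed with \<pi>, because
      \<pi> (1 - \<tau> \<rho>) = \<pi>. Uniqueness in the cokernel property identifies
      them.\<close>
    have \<pi>j: "\<pi> \<cdot>\<^bsub>Fct C B\<^esub> j = Ide (Fct C B) (NCod \<pi>)"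
    proof -
      have "(\<pi> \<cdot>\<^bsub>Fct C B\<^esub> j) \<cdot>\<^bsub>Fct C B\<^esub> \<pi> = \<pi>"
      proof (rule nat_trans_eqI[OF _ \<pi>(1)])
        show "is_nat_trans C B ((\<pi> \<cdot>\<^bsub>Fct C B\<^esub> j) \<cdot>\<^bsub>Fct C B\<^esub> \<pi>)"
          using nt_comp[OF nt_comp[OF \<pi>(1) j'(1)] \<pi>(1)] by simp
      qed (use j\<pi> \<pi>k in \<open>simp_all add: B.assoc\<close>)
      moreover have "Ide (Fct C B) (NCod \<pi>) \<cdot>\<^bsub>Fct C B\<^esub> \<pi> = \<pi>"
        using category.comp_ide_left[OF category_Fct[OF assms(1) B.category_axioms], of \<pi> "NDom \<pi>" "NCod \<pi>"] \<pi>(1)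
        by (simp add: Hom_Fct del: Fct_sel(5,6))
      moreover have "\<pi> \<cdot>\<^bsub>Fct C B\<^esub> j \<in> Hom (Fct C B) (NCod \<pi>) (NCod \<pi>)"
        using nt_comp[OF \<pi>(1) j'(1)] by (simp add: Hom_Fct)
      moreover have "Ide (Fct C B) (NCod \<pi>) \<in> Hom (Fct C B) (NCod \<pi>) (NCod \<pi>)"
        using is_nat_trans_ide[OF assms(1) B.category_axioms is_nat_transD(2)[OF \<pi>(1)]] by (simp add: Hom_Fct)
      moreover have "\<exists>!h. h \<in> Hom (Fct C B) (NCod \<pi>) (NCod \<pi>) \<and> h \<cdot>\<^bsub>Fct C B\<^esub> \<pi> = \<pi>"
        using L unfolding is_cokernel_def Fct_sel(2-4) using \<pi>(1) by blast
      ultimately show ?thesis by blast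
    qed
    have "NCmp \<pi> a \<cdot>\<^bsub>B\<^esub> NCmp j a = Ide B (FObj (NCod \<pi>) a)" if "a \<in> Obj C" for a
      using that arg_cong[OF \<pi>j, of "\<lambda>\<sigma>. NCmp \<sigma> a"] by simp
    then show ?R
      using \<pi>\<tau> j' j\<pi> k(4) by (intro conjI exI[of _ j]) simp_all
  next
    assume R: ?R
    then obtain j where j: "is_nat_trans C B j" "NDom j = NCod \<pi>" "NCod j = NCod \<tau>"
      and sum: "\<And>a. a \<in> Obj C \<Longrightarrow> AddArr B (NCmp j a \<cdot>\<^bsub>B\<^esub> NCmp \<pi> a) (NCmp \<tau> a \<cdot>\<^bsub>B\<^esub> NCmp \<rho> a) = Ide B (FObj (NCod \<tau>) a)"
      and \<pi>j: "\<And>a. a \<in> Obj C \<Longrightarrow> NCmp \<pi> a \<cdot>\<^bsub>B\<^esub> NCmp j a = Ide B (FObj (NCod \<pi>) a)"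
      by blast
    note [simp] = is_nat_transD(4-6)[OF j(1)] j(2,3)
    show ?L
      unfolding is_cokernel_def
    proof (intro conjI ballI impI)
      fix g assume "g \<in> Arr (Fct C B)" and g0: "Dom (Fct C B) g = Cod (Fct C B) \<tau> \<and> is_zero_arr (Fct C B) (g \<cdot>\<^bsub>Fct C B\<^esub> \<tau>)"
      then have g: "is_nat_trans C B g" "NDom g = NCod \<tau>" by auto
      note [simp] = is_nat_transD(4-6)[OF g(1)] g(2) is_functorD(1-4)[OF is_nat_transD(2)[OF g(1)]]
      have g\<tau>: "NCmp g a \<cdot>\<^bsub>B\<^esub> NCmp \<tau> a = ZeroArr B (FObj (NDom \<tau>) a) (FObj (NCod g) a)" if "a \<in> Obj C" for a
        using zero_iff[OF g] g0 that by simp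
      show "\<exists>!h. h \<in> Hom (Fct C B) (Cod (Fct C B) \<pi>) (Cod (Fct C B) g) \<and> h \<cdot>\<^bsub>Fct C B\<^esub> \<pi> = g"
      \<comment> \<open>Composing j \<pi> + \<tau> \<rho> = 1 with g leaves (g j) \<pi> = g, since g
        \<tau> = 0. Any other factor h satisfies h = h \<pi> j = g j.\<close>
      proof (intro ex1I[where a = "g \<cdot>\<^bsub>Fct C B\<^esub> j"] conjI)
        show "g \<cdot>\<^bsub>Fct C B\<^esub> j \<in> Hom (Fct C B) (Cod (Fct C B) \<pi>) (Cod (Fct C B) g)"
          using nt_comp[OF g(1) j(1)] by (simp add: Hom_Fct)
        show "(g \<cdot>\<^bsub>Fct C B\<^esub> j) \<cdot>\<^bsub>Fct C B\<^esub> \<pi> = g"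
        proof (rule nat_trans_eqI[OF _ g(1)])
          show "is_nat_trans C B ((g \<cdot>\<^bsub>Fct C B\<^esub> j) \<cdot>\<^bsub>Fct C B\<^esub> \<pi>)"
            using nt_comp[OF nt_comp[OF g(1) j(1)] \<pi>(1)] by simp
        next
          fix a assume a: "a \<in> Obj C"
          have "NCmp g a \<cdot>\<^bsub>B\<^esub> (NCmp \<tau> a \<cdot>\<^bsub>B\<^esub> NCmp \<rho> a) = ZeroArr B (FObj (NCod \<tau>) a) (FObj (NCod g) a)"
            using a g\<tau>[OF a] B.assoc[of "NCmp \<rho> a" "NCmp \<tau> a" "NCmp g a"] by simp
          then have "NCmp g a \<cdot>\<^bsub>B\<^esub> (NCmp j a \<cdot>\<^bsub>B\<^esub> NCmp \<pi> a) = NCmp g a"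
            using B.comp_add[of "NCmp j a \<cdot>\<^bsub>B\<^esub> NCmp \<pi> a" "NCmp \<tau> a \<cdot>\<^bsub>B\<^esub> NCmp \<rho> a" "NCmp g a"] sum[OF a] a by simp
          then show "NCmp ((g \<cdot>\<^bsub>Fct C B\<^esub> j) \<cdot>\<^bsub>Fct C B\<^esub> \<pi>) a = NCmp g a"
            using a by (simp add: B.assoc)
        qed simp_all
        fix h assume "h \<in> Hom (Fct C B) (Cod (Fct C B) \<pi>) (Cod (Fct C B) g) \<and> h \<cdot>\<^bsub>Fct C B\<^esub> \<pi> = g"
        then have h: "is_nat_trans C B h" "NDom h = NCod \<pi>" "NCod h = NCod g" and h\<pi>: "h \<cdot>\<^bsub>Fct C B\<^esub> \<pi> = g"
          by (auto simp: Hom_Fct)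
        note [simp] = is_nat_transD(4-6)[OF h(1)] h(2,3)
        show "h = g \<cdot>\<^bsub>Fct C B\<^esub> j"
        proof (rule nat_trans_eqI[OF h(1)])
          show "is_nat_trans C B (g \<cdot>\<^bsub>Fct C B\<^esub> j)"
            using nt_comp[OF g(1) j(1)] by simp
        next
          fix a assume a: "a \<in> Obj C"
          have "NCmp h a = NCmp h a \<cdot>\<^bsub>B\<^esub> (NCmp \<pi> a \<cdot>\<^bsub>B\<^esub> NCmp j a)"
            using a by (simp add: \<pi>j)
          also have "\<dots> = (NCmp h a \<cdot>\<^bsub>B\<^esub> NCmp \<pi> a) \<cdot>\<^bsub>B\<^esub> NCmp j a"
            using a by (simp add: B.assoc)
          also have "NCmp h a \<cdot>\<^bsub>B\<^esub> NCmp \<pi> a = NCmp g a"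
            using a arg_cong[OF h\<pi>, of "\<lambda>\<sigma>. NCmp \<sigma> a"] by simp
          finally show "NCmp h a = NCmp (g \<cdot>\<^bsub>Fct C B\<^esub> j) a"
            using a by simp
        qed simp_all
      qed
    qed (use \<tau> \<pi> R zero_iff[OF \<pi>] in auto)
  qed
qed

text \<open>The inverse assignment respects sources and targets because F is injective on objects.
  Both composites are then equal, by extensionality, to the \<open>inclusion_functor\<close>, which
  plays the identity functor.\<close>

lemma is_equivalence_if_bij:
  assumes "category C" "category D" and F: "is_functor C D F"
    and bij: "bij_betw (FObj F) (Obj C) (Obj D)" "bij_betw (FArr F) (Arr C) (Arr D)"
  shows "is_equivalence C D F"
proof -
  interpret C: category C by fact
  interpret D: category D by fact
  define go where "go = the_inv_into (Obj C) (FObj F)"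
  define ga where "ga = the_inv_into (Arr C) (FArr F)"
  note [simp] = is_functorD(1-4)[OF F]
  have go: "go a \<in> Obj C" "FObj F (go a) = a" if "a \<in> Obj D" for a
    using bij(1) that unfolding go_def
    by (auto simp: bij_betw_def f_the_inv_into_f intro: the_inv_into_into)
  have ga: "ga f \<in> Arr C" "FArr F (ga f) = f" if "f \<in> Arr D" for f
    using bij(2) that unfolding ga_def
    by (auto simp: bij_betw_def f_the_inv_into_f intro: the_inv_into_into)
  have go': "go (FObj F a) = a" if "a \<in> Obj C" for a
    using bij(1) that unfolding go_def by (auto simp: bij_betw_def the_inv_into_f_f)
  have ga': "ga (FArr F f) = f" if "f \<in> Arr C" for f
    using bij(2) that unfolding ga_def by (auto simp: bij_betw_def the_inv_into_f_f)
  have dom_ga: "Dom C (ga f) = go (Dom D f)" "Cod C (ga f) = go (Cod D f)" if "f \<in> Arr D" for f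
    using go'[of "Dom C (ga f)"] go'[of "Cod C (ga f)"] ga[OF that]
      is_functorD(3,4)[OF F, of "ga f"] by auto
  define G where "G = \<lparr>FObj = restrict go (Obj D), FArr = restrict ga (Arr D)\<rparr>"
  have G: "is_functor D C G"
  proof (rule is_functorI)
    fix a assume a: "a \<in> Obj D"
    have "ga (FArr F (Ide C (go a))) = Ide C (go a)"
      using go[OF a] by (intro ga') simp
    then show "FArr G (Ide D a) = Ide C (FObj G a)"
      using a go[OF a] is_functorD(5)[OF F, of "go a"] by (simp add: G_def)
  next
    fix f g assume fg: "f \<in> Arr D" "g \<in> Arr D" "Dom D g = Cod D f"
    have "ga (FArr F (ga g \<cdot>\<^bsub>C\<^esub> ga f)) = ga g \<cdot>\<^bsub>C\<^esub> ga f"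
      using ga fg by (intro ga') (simp add: dom_ga)
    moreover have "FArr F (ga g \<cdot>\<^bsub>C\<^esub> ga f) = g \<cdot>\<^bsub>D\<^esub> f"
      using is_functorD(6)[OF F, of "ga f" "ga g"] ga fg by (simp add: dom_ga)
    ultimately show "FArr G (g \<cdot>\<^bsub>D\<^esub> f) = FArr G g \<cdot>\<^bsub>C\<^esub> FArr G f"
      using fg by (simp add: G_def)
  qed (auto simp: G_def go ga dom_ga)
  have incl: "is_functor E E (inclusion_functor E)" if "category E" for E :: "('x, 'y, 'z) cat_scheme"
  proof -
    interpret category E by fact
    show ?thesis by (rule is_functorI) (auto simp: inclusion_functor_def)
  qed
  have refl: "naturally_isomorphic E E (inclusion_functor E) (inclusion_functor E)" if E: "category E" for E :: "('x, 'y, 'z) cat_scheme"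
    unfolding naturally_isomorphic_def
  proof (rule bexI)
    interpret category E by fact
    show "Ide (Fct E E) (inclusion_functor E) \<in> Hom (Fct E E) (inclusion_functor E) (inclusion_functor E)"
      using is_nat_trans_ide[OF E E incl[OF E]] by (simp add: Hom_Fct)
    show "\<forall>a \<in> Obj E. is_iso E (NCmp (Ide (Fct E E) (inclusion_functor E)) a)"
      using inverse_pair_ide by (auto simp: is_iso_def inclusion_functor_def)
  qed
  have "comp_functor C G F = inclusion_functor C"
    by (rule functor_eqI[OF is_functor_comp[OF assms(1) F G] incl[OF assms(1)]])
      (simp_all add: inclusion_functor_def G_def go' ga')
  moreover have "comp_functor D F G = inclusion_functor D"
    by (rule functor_eqI[OF is_functor_comp[OF assms(2) G F] incl[OF assms(2)]])
      (simp_all add: inclusion_functor_def G_def go ga)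
  ultimately show ?thesis
    unfolding is_equivalence_def using F G refl[OF assms(1)] refl[OF assms(2)] by auto
qed

section \<open>Precomposition with a full functor that is the identity on objects\<close>

definition precomp_nat :: "('o, 'm, 'x) cat_scheme \<Rightarrow> ('o, 'm, 'p, 'q) cat_functor \<Rightarrow>
    ('p, 'q, 'r, 's) nat_trans \<Rightarrow> ('o, 'm, 'r, 's) nat_trans" where
  "precomp_nat C \<Phi> \<tau> = \<lparr>NDom = comp_functor C (NDom \<tau>) \<Phi>, NCod = comp_functor C (NCod \<tau>) \<Phi>,
     NCmp = (\<lambda>a \<in> Obj C. NCmp \<tau> (FObj \<Phi> a))\<rparr>"

lemma precomp_nat_sel [simp]:
  "NDom (precomp_nat C \<Phi> \<tau>) = comp_functor C (NDom \<tau>) \<Phi>"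
  "NCod (precomp_nat C \<Phi> \<tau>) = comp_functor C (NCod \<tau>) \<Phi>"
  "a \<in> Obj C \<Longrightarrow> NCmp (precomp_nat C \<Phi> \<tau>) a = NCmp \<tau> (FObj \<Phi> a)"
  by (simp_all add: precomp_nat_def)

text \<open>The transfer of functors, transformations and split cokernels is isolated from the
  colimit construction. Sharing the objects literally lets one family of components serve on both
  sides. Since the intended functor is not faithful, \<open>factorization\<close> puts a condition
  on F instead.\<close>

locale full_identity_on_objects = C: category C + D: category D
  for C :: "('o, 'm, 'x) cat_scheme" and D :: "('o, 'n, 'y) cat_scheme" +
  fixes \<Phi> :: "('o, 'm, 'o, 'n) cat_functor"
  assumes functor_\<Phi>: "is_functor C D \<Phi>"
    and Obj_eq: "Obj C = Obj D"
    and FObj_eq: "a \<in> Obj D \<Longrightarrow> FObj \<Phi> a = a"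
    and full: "f \<in> Arr D \<Longrightarrow> \<exists>u \<in> Arr C. FArr \<Phi> u = f"
begin

lemma \<Phi>_simps [simp]:
  "u \<in> Arr C \<Longrightarrow> FArr \<Phi> u \<in> Arr D"
  "u \<in> Arr C \<Longrightarrow> Dom D (FArr \<Phi> u) = Dom C u"
  "u \<in> Arr C \<Longrightarrow> Cod D (FArr \<Phi> u) = Cod C u"
  using is_functorD[OF functor_\<Phi>] by (auto simp: Obj_eq FObj_eq C.obj_dom[unfolded Obj_eq] C.obj_cod[unfolded Obj_eq])

abbreviation "precomp F \<equiv> comp_functor C F \<Phi>"

lemma precomp_functor: "is_functor D B F \<Longrightarrow> is_functor C B (precomp F)"
  by (rule is_functor_comp[OF C.category_axioms functor_\<Phi>])

lemma precomp_inject: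
  assumes "is_functor D B F" "is_functor D B G" "precomp F = precomp G"
  shows "F = G"
proof (rule functor_eqI[OF assms(1,2)])
  fix a assume "a \<in> Obj D"
  then show "FObj F a = FObj G a"
    using arg_cong[OF assms(3), of "\<lambda>H. FObj H a"] by (simp add: Obj_eq FObj_eq)
next
  fix f assume "f \<in> Arr D"
  then obtain u where "u \<in> Arr C" "FArr \<Phi> u = f" using full by blast
  then show "FArr F f = FArr G f"
    using arg_cong[OF assms(3), of "\<lambda>H. FArr H u"] by simp
qed

text \<open>An arrow of D takes the value of F at a chosen preimage, and \<open>compat\<close> makes
  the choice irrelevant. Preimages of composable arrows are composable because \<Phi> is the
  identity on objects, and their composite is a preimage of the composite.\<close>

lemma factorization:
  assumes F: "is_functor C B F"
    and compat: "\<And>u v. \<lbrakk>u \<in> Arr C; v \<in> Arr C; FArr \<Phi> u = FArr \<Phi> v\<rbrakk> \<Longrightarrow> FArr F u = FArr F v"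
  obtains G where "is_functor D B G" "precomp G = F"
proof -
  define lift where "lift f = (SOME u. u \<in> Arr C \<and> FArr \<Phi> u = f)" for f
  have lift: "lift f \<in> Arr C" "FArr \<Phi> (lift f) = f" if "f \<in> Arr D" for f
    using someI_ex[of "\<lambda>u. u \<in> Arr C \<and> FArr \<Phi> u = f"] full[OF that] by (auto simp: lift_def)
  define G where "G = \<lparr>FObj = FObj F, FArr = (\<lambda>f \<in> Arr D. FArr F (lift f))\<rparr>"
  have G_\<Phi>: "FArr G (FArr \<Phi> u) = FArr F u" if "u \<in> Arr C" for u
    using compat[OF lift(1) that lift(2)] that by (simp add: G_def)
  have dom_lift: "Dom C (lift f) = Dom D f" "Cod C (lift f) = Cod D f" if "f \<in> Arr D" for f
    using \<Phi>_simps(2,3)[of "lift f"] lift[OF that] by auto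
  have G: "is_functor D B G"
  proof (rule is_functorI)
    fix a assume "a \<in> Obj D"
    then show "FArr G (Ide D a) = Ide B (FObj G a)"
      using G_\<Phi>[of "Ide C a"] is_functorD(5)[OF functor_\<Phi>, of a] is_functorD(5)[OF F, of a]
      by (simp add: Obj_eq FObj_eq G_def)
  next
    fix f g assume fg: "f \<in> Arr D" "g \<in> Arr D" "Dom D g = Cod D f"
    have "g \<cdot>\<^bsub>D\<^esub> f = FArr \<Phi> (lift g \<cdot>\<^bsub>C\<^esub> lift f)"
      using is_functorD(6)[OF functor_\<Phi>, of "lift f" "lift g"] lift fg by (simp add: dom_lift)
    then have "FArr G (g \<cdot>\<^bsub>D\<^esub> f) = FArr F (lift g \<cdot>\<^bsub>C\<^esub> lift f)"
      using G_\<Phi>[of "lift g \<cdot>\<^bsub>C\<^esub> lift f"] lift fg by (simp add: dom_lift)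
    also have "\<dots> = FArr G g \<cdot>\<^bsub>B\<^esub> FArr G f"
      using is_functorD(6)[OF F, of "lift f" "lift g"] lift fg by (simp add: dom_lift G_def)
    finally show "FArr G (g \<cdot>\<^bsub>D\<^esub> f) = FArr G g \<cdot>\<^bsub>B\<^esub> FArr G f" .
  qed (use is_functorD[OF F] lift dom_lift in \<open>auto simp: G_def Obj_eq\<close>)
  have "precomp G = F"
    by (rule functor_eqI[OF precomp_functor[OF G] F]) (simp_all add: G_\<Phi>, simp add: G_def Obj_eq FObj_eq)
  with G show thesis by (rule that)
qed

lemma precomp_nat_cmp: "NCmp \<tau> \<in> extensional (Obj D) \<Longrightarrow> NCmp (precomp_nat C \<Phi> \<tau>) = NCmp \<tau>"
  by (auto simp: precomp_nat_def Obj_eq FObj_eq fun_eq_iff extensional_def)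

text \<open>By fullness every naturality square over D is the square of some arrow of C, with the
  same components.\<close>

lemma is_nat_trans_precomp_iff:
  assumes "is_functor D B (NDom \<tau>)" "is_functor D B (NCod \<tau>)" "NCmp \<tau> \<in> extensional (Obj D)"
  shows "is_nat_trans C B (precomp_nat C \<Phi> \<tau>) \<longleftrightarrow> is_nat_trans D B \<tau>"
proof
  assume *: "is_nat_trans D B \<tau>"
  show "is_nat_trans C B (precomp_nat C \<Phi> \<tau>)"
  proof (rule is_nat_transI)
    fix u assume "u \<in> Arr C"
    then show "NCmp (precomp_nat C \<Phi> \<tau>) (Cod C u) \<cdot>\<^bsub>B\<^esub> FArr (NDom (precomp_nat C \<Phi> \<tau>)) u =
        FArr (NCod (precomp_nat C \<Phi> \<tau>)) u \<cdot>\<^bsub>B\<^esub> NCmp (precomp_nat C \<Phi> \<tau>) (Dom C u)"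
      using is_nat_transD(7)[OF *, of "FArr \<Phi> u"] assms(3) by (simp add: precomp_nat_cmp)
  qed (use * assms is_nat_transD[OF *] precomp_functor in \<open>auto simp: precomp_nat_cmp Obj_eq FObj_eq\<close>)
next
  assume *: "is_nat_trans C B (precomp_nat C \<Phi> \<tau>)"
  show "is_nat_trans D B \<tau>"
  proof (rule is_nat_transI)
    fix f assume "f \<in> Arr D"
    then obtain u where "u \<in> Arr C" "f = FArr \<Phi> u" using full by blast
    then show "NCmp \<tau> (Cod D f) \<cdot>\<^bsub>B\<^esub> FArr (NDom \<tau>) f = FArr (NCod \<tau>) f \<cdot>\<^bsub>B\<^esub> NCmp \<tau> (Dom D f)"
      using is_nat_transD(7)[OF *, of u] assms(3) by (simp add: precomp_nat_cmp)
  qed (use assms is_nat_transD[OF *] in \<open>auto simp: precomp_nat_cmp Obj_eq FObj_eq\<close>)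
qed

lemma is_nat_trans_precomp: "is_nat_trans D B \<tau> \<Longrightarrow> is_nat_trans C B (precomp_nat C \<Phi> \<tau>)"
  using is_nat_trans_precomp_iff is_nat_transD(1-3) by metis

lemma nat_trans_lift:
  assumes "is_functor D B F" "is_functor D B G" "is_nat_trans C B \<sigma>" "NDom \<sigma> = precomp F" "NCod \<sigma> = precomp G"
  obtains \<tau> where "is_nat_trans D B \<tau>" "NDom \<tau> = F" "NCod \<tau> = G" "NCmp \<tau> = NCmp \<sigma>" "precomp_nat C \<Phi> \<tau> = \<sigma>"
proof -
  define \<tau> where "\<tau> = \<lparr>NDom = F, NCod = G, NCmp = NCmp \<sigma>\<rparr>"
  have ext: "NCmp \<tau> \<in> extensional (Obj D)"
    using is_nat_transD(3)[OF assms(3)] by (simp add: \<tau>_def Obj_eq)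
  then have "NCmp (precomp_nat C \<Phi> \<tau>) = NCmp \<sigma>"
    by (simp add: precomp_nat_cmp) (simp add: \<tau>_def)
  then have eq: "precomp_nat C \<Phi> \<tau> = \<sigma>"
    using assms(4,5) by (simp add: \<tau>_def)
  have "is_functor D B (NDom \<tau>)" "is_functor D B (NCod \<tau>)"
    using assms(1,2) by (simp_all add: \<tau>_def)
  from is_nat_trans_precomp_iff[OF this ext] have "is_nat_trans D B \<tau>"
    using assms(3) eq by simp
  then show thesis
    using eq by (intro that[of \<tau>]) (simp_all add: \<tau>_def)
qed

text \<open>The universal properties quantify over different functors: those on C need not factor
  through \<Phi>. In the equational form of \<open>is_cokernel_split_iff\<close> the only unknown is
  j, which runs between functors precomposed with \<Phi> and therefore lifts to D.\<close>

lemma is_cokernel_precomp_iff: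
  assumes B: "additive_category B"
    and \<tau>: "is_nat_trans D B \<tau>" and \<rho>: "is_nat_trans D B \<rho>" "NDom \<rho> = NCod \<tau>" "NCod \<rho> = NDom \<tau>"
    and retraction: "\<And>a. a \<in> Obj D \<Longrightarrow> NCmp \<rho> a \<cdot>\<^bsub>B\<^esub> NCmp \<tau> a = Ide B (FObj (NDom \<tau>) a)"
    and \<pi>: "is_nat_trans D B \<pi>" "NDom \<pi> = NCod \<tau>"
  shows "is_cokernel (Fct C B) (precomp_nat C \<Phi> \<tau>) (precomp_nat C \<Phi> \<pi>) \<longleftrightarrow> is_cokernel (Fct D B) \<tau> \<pi>"
proof -
  let ?P = "precomp_nat C \<Phi>"
  have cmp: "NCmp (?P \<sigma>) = NCmp \<sigma>" if "is_nat_trans D B \<sigma>" for \<sigma>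
    using that by (intro precomp_nat_cmp is_nat_transD(3))
  let ?E = "\<lambda>j. \<forall>a \<in> Obj D. AddArr B (NCmp j a \<cdot>\<^bsub>B\<^esub> NCmp \<pi> a) (NCmp \<tau> a \<cdot>\<^bsub>B\<^esub> NCmp \<rho> a) = Ide B (FObj (NCod \<tau>) a) \<and>
        NCmp \<pi> a \<cdot>\<^bsub>B\<^esub> NCmp j a = Ide B (FObj (NCod \<pi>) a)"
  have "(\<exists>j. is_nat_trans C B j \<and> NDom j = NCod (?P \<pi>) \<and> NCod j = NCod (?P \<tau>) \<and> ?E j) \<longleftrightarrow>
      (\<exists>j. is_nat_trans D B j \<and> NDom j = NCod \<pi> \<and> NCod j = NCod \<tau> \<and> ?E j)" (is "?L \<longleftrightarrow> ?R")
  proof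
    assume ?L
    then obtain j where j: "is_nat_trans C B j" "NDom j = precomp (NCod \<pi>)" "NCod j = precomp (NCod \<tau>)" "?E j"
      by auto
    obtain j' where "is_nat_trans D B j'" "NDom j' = NCod \<pi>" "NCod j' = NCod \<tau>" "NCmp j' = NCmp j"
      using nat_trans_lift[OF is_nat_transD(2)[OF \<pi>(1)] is_nat_transD(2)[OF \<tau>] j(1-3)] by metis
    then show ?R using j(4) by auto
  next
    assume ?R
    then obtain j where "is_nat_trans D B j" "NDom j = NCod \<pi>" "NCod j = NCod \<tau>" "?E j"
      by auto
    then show ?L
      using is_nat_trans_precomp[of B j] cmp by (intro exI[of _ "?P j"]) auto
  qed
  moreover have "is_cokernel (Fct C B) (?P \<tau>) (?P \<pi>) \<longleftrightarrow>
    (\<forall>a \<in> Obj D. NCmp \<pi> a \<cdot>\<^bsub>B\<^esub> NCmp \<tau> a = ZeroArr B (FObj (NDom \<tau>) a) (FObj (NCod \<pi>) a)) \<and>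
    (\<exists>j. is_nat_trans C B j \<and> NDom j = NCod (?P \<pi>) \<and> NCod j = NCod (?P \<tau>) \<and> ?E j)"
    by (subst is_cokernel_split_iff[where \<rho> = "?P \<rho>"])
      (use assms cmp C.category_axioms in \<open>simp_all add: is_nat_trans_precomp Obj_eq FObj_eq\<close>)
  moreover have "is_cokernel (Fct D B) \<tau> \<pi> \<longleftrightarrow>
    (\<forall>a \<in> Obj D. NCmp \<pi> a \<cdot>\<^bsub>B\<^esub> NCmp \<tau> a = ZeroArr B (FObj (NDom \<tau>) a) (FObj (NCod \<pi>) a)) \<and>
    (\<exists>j. is_nat_trans D B j \<and> NDom j = NCod \<pi> \<and> NCod j = NCod \<tau> \<and> ?E j)"
    using assms D.category_axioms by (intro is_cokernel_split_iff)
  ultimately show ?thesis by blast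
qed

end

section \<open>The category associated with the split monomorphisms\<close>

context additive_category begin

abbreviation "sums \<equiv> direct_sum_monoidal C"
abbreviation "msums \<equiv> split_monos (direct_sum_monoidal C)"

lemma sums_sel [simp]:
  "Obj sums = Obj C" "Arr sums = Arr C" "Dom sums = Dom C" "Cod sums = Cod C"
  "Ide sums = Ide C" "Comp sums = Comp C" "Tensor sums = DSum C"
  "TensorArr sums f g = pairing C (f \<cdot> Prj1 C (Dom C f) (Dom C g)) (g \<cdot> Prj2 C (Dom C f) (Dom C g))"
  "Unit sums = ZeroObj C"
  "Assoc sums a b c = pairing C (Prj1 C a b \<cdot> Prj1 C (DSum C a b) c)
                 (pairing C (Prj2 C a b \<cdot> Prj1 C (DSum C a b) c) (Prj2 C (DSum C a b) c))"
  "LUnit sums a = Prj2 C (ZeroObj C) a" "RUnit sums a = Prj1 C a (ZeroObj C)"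
  "Braid sums a b = pairing C (Prj2 C a b) (Prj1 C a b)"
  by (simp_all add: direct_sum_monoidal_def)

lemma Hom_sums [simp]: "Hom sums = Hom C"
  by (simp add: fun_eq_iff Hom_def)

lemma split_mono_sums [simp]: "is_split_mono sums = is_split_mono C"
  by (simp add: fun_eq_iff is_split_mono_def)

lemma msums_sel [simp]:
  "Obj msums = Obj C" "Arr msums = {f. is_split_mono C f}" "Dom msums = Dom C" "Cod msums = Cod C"
  "Ide msums = Ide C" "Comp msums = Comp C" "Tensor msums = DSum C"
  "TensorArr msums = TensorArr sums"
  "Unit msums = ZeroObj C" "Assoc msums = Assoc sums"
  "LUnit msums = LUnit sums" "RUnit msums = RUnit sums" "Braid msums = Braid sums"
  by (simp_all add: split_monos_def)

lemma category_sums: "category sums"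
  by unfold_locales (auto simp: Hom_iff assoc)

lemma category_msums: "category msums"
proof -
  have *: "f \<in> Hom msums a b \<longleftrightarrow> is_split_mono C f \<and> f \<in> Arr C \<and> Dom C f = a \<and> Cod C f = b" for f a b
    by (auto simp: Hom_def split_mono_arr)
  show ?thesis
    by unfold_locales
      (auto simp: * assoc split_mono_comp dest: split_mono_arr intro: split_mono_inverse_pair inverse_pair_ide)
qed

text \<open>Both arrows of an inverse pair are split monomorphisms, so the subcategory has the same
  inverses. This makes the inverse structure maps in the definitions of \<open>tilde_eta\<close> and
  \<open>interchange\<close> computable in C.\<close>

lemma inv_arr_msums:
  assumes "inverse_pair C f g"
  shows "inv_arr msums f = g"
proof (rule category.inv_arr_eq[OF category_msums])
  show "inverse_pair msums f g"
    using assms split_mono_inverse_pair[OF assms] by (simp add: inverse_pair_def Hom_def)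
qed

lemma split_mono_ide [simp]: "a \<in> Obj C \<Longrightarrow> is_split_mono C (Ide C a)"
  by (rule split_mono_inverse_pair(1)[OF inverse_pair_ide])

lemma split_mono_sum:
  assumes "is_split_mono C f" "is_split_mono C g"
  shows "is_split_mono C (TensorArr sums f g)"
proof -
  obtain r where r: "f \<in> Arr C" "r \<in> Arr C" "Dom C r = Cod C f" "Cod C r = Dom C f" "r \<cdot> f = Ide C (Dom C f)"
    using assms(1) by (rule split_monoE)
  obtain s where s: "g \<in> Arr C" "s \<in> Arr C" "Dom C s = Cod C g" "Cod C s = Dom C g" "s \<cdot> g = Ide C (Dom C g)"
    using assms(2) by (rule split_monoE)
  show ?thesis
    using r s by (intro split_monoI[of _ "TensorArr sums r s"]) (simp_all add: assoc flip: assoc[of _ f r] assoc[of _ g s])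
qed

section \<open>Divisibility of arrows with a common source\<close>

definition factors :: "'m \<Rightarrow> 'm \<Rightarrow> bool" where
  "factors f g \<longleftrightarrow> (\<exists>h \<in> Arr C. Dom C h = Cod C f \<and> g = h \<cdot> f)"

text \<open>The multipliers are arbitrary arrows of C, whereas the colimit only uses split
  monomorphisms. For the second components of admissible pairs with equal first component,
  \<open>tilde_cls_memberE\<close> and \<open>tmk_cong\<close> show that both give the same
  equivalence relation.\<close>

abbreviation "interfactor f g \<equiv> factors f g \<and> factors g f"

lemma factorsI: "\<lbrakk>h \<in> Arr C; Dom C h = Cod C f; h \<cdot> f = g\<rbrakk> \<Longrightarrow> factors f g"
  by (auto simp: factors_def)

lemma factors_refl [simp]: "f \<in> Arr C \<Longrightarrow> factors f f"
  by (rule factorsI[of "Ide C (Cod C f)"]) auto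

lemma factors_trans: "\<lbrakk>f \<in> Arr C; factors f g; factors g h\<rbrakk> \<Longrightarrow> factors f h"
  unfolding factors_def by (metis arr_comp dom_comp cod_comp assoc)

lemma factors_comp:
  assumes "factors f g" "f \<in> Arr C" "h \<in> Arr C" "Dom C f = Cod C h"
  shows "factors (f \<cdot> h) (g \<cdot> h)"
  using assms unfolding factors_def by (metis assoc cod_comp)

lemma factors_pairing1: "\<lbrakk>f \<in> Arr C; g \<in> Arr C; Dom C f = Dom C g\<rbrakk> \<Longrightarrow> factors (pairing C f g) f"
  and factors_pairing2: "\<lbrakk>f \<in> Arr C; g \<in> Arr C; Dom C f = Dom C g\<rbrakk> \<Longrightarrow> factors (pairing C f g) g"
  by (rule factorsI[of "Prj1 C (Cod C f) (Cod C g)"]; simp)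
     (rule factorsI[of "Prj2 C (Cod C f) (Cod C g)"]; simp)

lemma factors_arr: "\<lbrakk>factors f g; f \<in> Arr C\<rbrakk> \<Longrightarrow> g \<in> Arr C \<and> Dom C g = Dom C f"
  by (auto simp: factors_def)

text \<open>In the preorder in which \<open>factors f g\<close> places f above g, a pairing is a
  least upper bound. Comparisons of nested pairings thus reduce to comparisons of their
  components.\<close>

lemma factors_pairing_iff:
  assumes "f \<in> Arr C" "g \<in> Arr C" "Dom C f = Dom C g" "h \<in> Arr C"
  shows "factors h (pairing C f g) \<longleftrightarrow> factors h f \<and> factors h g"
proof
  assume "factors h (pairing C f g)"
  then show "factors h f \<and> factors h g"
    using assms factors_trans[OF assms(4)] factors_pairing1 factors_pairing2 by blast
next
  assume "factors h f \<and> factors h g"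
  then obtain r s where "r \<in> Arr C" "Dom C r = Cod C h" "f = r \<cdot> h" "s \<in> Arr C" "Dom C s = Cod C h" "g = s \<cdot> h"
    by (auto simp: factors_def)
  then show "factors h (pairing C f g)"
    using assms by (intro factorsI[of "pairing C r s"]) auto
qed

section \<open>Arrows of the associated category as admissible pairs\<close>

definition admissible :: "'m \<Rightarrow> 'm \<Rightarrow> bool" where
  "admissible f g \<longleftrightarrow> f \<in> Arr C \<and> g \<in> Arr C \<and> Dom C f = Dom C g \<and> is_split_mono C (pairing C f g)"

text \<open>Every arrow into b \<oplus> t is a pairing (f, g), so classes can be named by
  components: f survives in C, while g lands in the summand t that is discarded.\<close>

definition tmk :: "'m \<Rightarrow> 'm \<Rightarrow> ('o, 'm) tilde_arr" where
  "tmk f g = (Dom C f, Cod C f, tilde_cls msums (Cod C f) (Cod C g, pairing C f g))"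

lemma admissibleD [simp]:
  assumes "admissible f g"
  shows "f \<in> Arr C" "g \<in> Arr C" "Dom C g = Dom C f" "is_split_mono C (pairing C f g)"
  using assms by (auto simp: admissible_def)

lemma admissibleI: "\<lbrakk>f \<in> Arr C; g \<in> Arr C; Dom C f = Dom C g; is_split_mono C (pairing C f g)\<rbrakk> \<Longrightarrow> admissible f g"
  by (simp only: admissible_def)

lemma admissible_comp:
  assumes "admissible f g" "is_split_mono C s" "Dom C s = Cod C g"
  shows "admissible f (s \<cdot> g)"
proof -
  have s: "s \<in> Arr C" using assms(2) by (rule split_mono_arr)
  have "is_split_mono C (TensorArr sums (Ide C (Cod C f)) s \<cdot> pairing C f g)"
    using assms s by (intro split_mono_comp split_mono_sum) auto
  then show ?thesis
    using assms s by (intro admissibleI) (simp_all add: assoc)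
qed

lemma tilde_stepI:
  assumes "admissible f g" "is_split_mono C s" "Dom C s = Cod C g"
  shows "tilde_step msums (Cod C f) (Cod C g, pairing C f g) (Cod C s, pairing C f (s \<cdot> g))"
  using assms split_mono_arr[OF assms(2)]
  by (auto simp: tilde_step_def Hom_def assoc intro!: exI[of _ s])

lemma tilde_stepE:
  assumes "tilde_step msums b (t, u) (t', u')"
  obtains f g s where "admissible f g" "Cod C f = b" "Cod C g = t" "u = pairing C f g"
    "is_split_mono C s" "s \<in> Arr C" "Dom C s = t" "Cod C s = t'" "u' = pairing C f (s \<cdot> g)"
proof -
  have u: "b \<in> Obj C" "t \<in> Obj C" "is_split_mono C u" "u \<in> Arr C" "Cod C u = DSum C b t"
    using assms by (auto simp: tilde_step_def split_mono_arr)
  obtain s where s: "is_split_mono C s" "s \<in> Arr C" "Dom C s = t" "Cod C s = t'"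
    "u' = TensorArr sums (Ide C b) s \<cdot> u"
    using assms by (auto simp: tilde_step_def Hom_def split_mono_arr)
  show thesis
    by (rule that[of "Prj1 C b t \<cdot> u" "Prj2 C b t \<cdot> u" s])
      (use u s in \<open>auto intro!: admissibleI simp: pairing_prj assoc\<close>)
qed

lemma pairing_inject:
  assumes "pairing C f g = pairing C f' g'" "f \<in> Arr C" "g \<in> Arr C" "f' \<in> Arr C" "g' \<in> Arr C"
    "Dom C f = Dom C g" "Dom C f' = Dom C g'" "Cod C f = Cod C f'" "Cod C g = Cod C g'"
  shows "f = f' \<and> g = g'"
proof
  show "f = f'"
    using prj1_pairing[of f g "Cod C f" "Cod C g"] prj1_pairing[of f' g' "Cod C f" "Cod C g"]
    unfolding assms(1) using assms(2-) by metis
  show "g = g'"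
    using prj2_pairing[of f g "Cod C f" "Cod C g"] prj2_pairing[of f' g' "Cod C f" "Cod C g"]
    unfolding assms(1) using assms(2-) by metis
qed

text \<open>A generating step leaves f alone and replaces g by s g with s split. A retraction of s
  recovers g, so steps taken in either direction preserve f and the divisibility class of g.\<close>

lemma tilde_cls_memberE:
  assumes "q \<in> tilde_cls msums (Cod C f) (Cod C g, pairing C f g)" "admissible f g"
  obtains g' where "admissible f g'" "q = (Cod C g', pairing C f g')" "interfactor g g'"
proof -
  have "equivclp (tilde_step msums (Cod C f)) (Cod C g, pairing C f g) q"
    using assms(1) by (simp add: tilde_cls_def)
  then have "\<exists>g'. admissible f g' \<and> q = (Cod C g', pairing C f g') \<and> interfactor g g'"
  proof (induction rule: equivclp_induct)
    case base
    show ?case using assms(2) by (intro exI[of _ g]) simp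
  next
    case (step y z)
    then obtain g1 where g1: "admissible f g1" "y = (Cod C g1, pairing C f g1)" "interfactor g g1"
      by blast
    obtain t u where z: "z = (t, u)" by (cases z)
    have g: "g \<in> Arr C" "g1 \<in> Arr C" using g1(1) assms(2) by auto
    from step(2) show ?case
    proof
      assume "tilde_step msums (Cod C f) y z"
      then obtain f' h s where h: "admissible f' h" "Cod C f' = Cod C f" "Cod C h = Cod C g1" "pairing C f g1 = pairing C f' h"
        "is_split_mono C s" "s \<in> Arr C" "Dom C s = Cod C g1" "Cod C s = t" "u = pairing C f' (s \<cdot> h)"
        unfolding z g1(2) by (elim tilde_stepE) auto
      have eq: "f' = f" "h = g1" using pairing_inject[OF h(4)] h g1 by auto
      obtain r where "r \<in> Arr C" "Dom C r = Cod C s" "Cod C r = Dom C s" "r \<cdot> s = Ide C (Dom C s)"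
        using h(5) by (rule split_monoE)
      then have "factors (s \<cdot> g1) g1"
        using h g by (intro factorsI[of r]) (auto simp flip: assoc)
      moreover have "factors g1 (s \<cdot> g1)"
        using h g by (intro factorsI[of s]) auto
      ultimately have "interfactor g (s \<cdot> g1)"
        using g1(3) g h factors_trans by (metis arr_comp)
      then show ?thesis
        using h(5-9) z eq admissible_comp[OF g1(1), of s] g by (intro exI[of _ "s \<cdot> g1"]) simp
    next
      assume "tilde_step msums (Cod C f) z y"
      then obtain f' h s where h: "admissible f' h" "Cod C f' = Cod C f" "Cod C h = t" "u = pairing C f' h"
        "is_split_mono C s" "s \<in> Arr C" "Dom C s = t" "Cod C s = Cod C g1" "pairing C f g1 = pairing C f' (s \<cdot> h)"
        unfolding z g1(2) by (elim tilde_stepE) auto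
      have eq: "f = f'" "g1 = s \<cdot> h" using pairing_inject[OF h(9)] h g1 by auto
      obtain r where "r \<in> Arr C" "Dom C r = Cod C s" "Cod C r = Dom C s" "r \<cdot> s = Ide C (Dom C s)"
        using h(5) by (rule split_monoE)
      then have "factors g1 h"
        using h(1,3,6,7) assoc[of h s r, symmetric] unfolding eq(2) by (intro factorsI[of r]) auto
      moreover have "factors h g1"
        using h g eq by (intro factorsI[of s]) auto
      ultimately have "interfactor g h"
        using g1(3) g h factors_trans by (metis admissibleD(2))
      then show ?thesis
        using h(1) unfolding z h(4) h(3)[symmetric] eq(1) by blast
    qed
  qed
  then show thesis using that by blast
qed

lemma tilde_cls_eqI: "equivclp (tilde_step N b) p q \<Longrightarrow> tilde_cls N b p = tilde_cls N b q"
  unfolding tilde_cls_def by (blast intro: equivclp_sym equivclp_trans)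

lemma tmk_self: "(Cod C g, pairing C f g) \<in> tilde_cls msums (Cod C f) (Cod C g, pairing C f g)"
  by (simp add: tilde_cls_def)

text \<open>If \<open>g' = h g\<close> and \<open>g = h' g'\<close>, then \<open>(1, h)\<close> and \<open>(h', 1)\<close> are split monomorphisms which
  carry \<open>g\<close>, respectively \<open>g'\<close>, to \<open>(g, g')\<close>.\<close>

lemma tmk_cong:
  assumes "admissible f g" "admissible f g'" "factors g g'" "factors g' g"
  shows "tmk f g = tmk f g'"
proof -
  obtain h where h: "h \<in> Arr C" "Dom C h = Cod C g" "g' = h \<cdot> g" using assms(3) by (auto simp: factors_def)
  obtain h' where h': "h' \<in> Arr C" "Dom C h' = Cod C g'" "g = h' \<cdot> g'" using assms(4) by (auto simp: factors_def)
  have c: "Cod C g' = Cod C h" "Cod C g = Cod C h'"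
    using h h' assms(1,2) by (metis admissibleD(2) cod_comp)+
  have "is_split_mono C (pairing C (Ide C (Cod C g)) h)"
    using h assms(1) by (intro split_monoI[of _ "Prj1 C (Cod C g) (Cod C h)"]) auto
  from tilde_stepI[OF assms(1) this]
  have 1: "tilde_step msums (Cod C f) (Cod C g, pairing C f g) (DSum C (Cod C g) (Cod C g'), pairing C f (pairing C g g'))"
    using h assms(1) unfolding c(1) by simp
  have "is_split_mono C (pairing C h' (Ide C (Cod C g')))"
    using h' assms(2) by (intro split_monoI[of _ "Prj2 C (Cod C h') (Cod C g')"]) auto
  from tilde_stepI[OF assms(2) this]
  have 2: "tilde_step msums (Cod C f) (Cod C g', pairing C f g') (DSum C (Cod C g) (Cod C g'), pairing C f (pairing C g g'))"
    using h' assms(2) unfolding c(2) by simp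
  show ?thesis
    unfolding tmk_def using 1 2
    by (auto intro!: tilde_cls_eqI intro: equivclp_trans converse_r_into_equivclp r_into_equivclp)
qed

text \<open>Composites and tensor products are defined as unions over all representatives.
  Representatives differ from the given ones only by mutual divisibility in the second component,
  and the classes are nonempty, so a contribution that is constant under such changes is the whole
  union.\<close>

lemma UN_tilde_cls:
  assumes "admissible f g" "admissible f' g'"
    and "\<And>h h'. \<lbrakk>admissible f h; interfactor g h; admissible f' h'; interfactor g' h'\<rbrakk> \<Longrightarrow>
       K (Cod C h) (pairing C f h) (Cod C h') (pairing C f' h') = X"
  shows "(\<Union>(t, u) \<in> tilde_cls msums (Cod C f) (Cod C g, pairing C f g).
          \<Union>(t', u') \<in> tilde_cls msums (Cod C f') (Cod C g', pairing C f' g'). K t u t' u') = X"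
proof -
  have "(\<Union>p \<in> tilde_cls msums (Cod C f) (Cod C g, pairing C f g).
          \<Union>q \<in> tilde_cls msums (Cod C f') (Cod C g', pairing C f' g'). K (fst p) (snd p) (fst q) (snd q)) =
        (\<Union>p \<in> tilde_cls msums (Cod C f) (Cod C g, pairing C f g).
          \<Union>q \<in> tilde_cls msums (Cod C f') (Cod C g', pairing C f' g'). X)"
    using assms by (intro SUP_cong refl) (auto elim!: tilde_cls_memberE)
  also have "\<dots> = X"
    using tmk_self[of g f] tmk_self[of g' f'] by blast
  finally show ?thesis by (simp add: case_prod_beta')
qed

lemma factors_zero [simp]: "\<lbrakk>f \<in> Arr C; Dom C f = a; b \<in> Obj C\<rbrakk> \<Longrightarrow> factors f (ZeroArr C a b)"
  by (rule factorsI[of "ZeroArr C (Cod C f) b"]) auto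

lemma factors_pairing_cong:
  assumes "factors f f'" "factors g g'" "f \<in> Arr C" "g \<in> Arr C" "Dom C f = Dom C g"
  shows "factors (pairing C f g) (pairing C f' g')"
proof -
  have "f' \<in> Arr C \<and> Dom C f' = Dom C f" "g' \<in> Arr C \<and> Dom C g' = Dom C g"
    using assms factors_arr by blast+
  moreover have "factors (pairing C f g) f'" "factors (pairing C f g) g'"
    using assms factors_pairing1 factors_pairing2 factors_trans[of "pairing C f g"] by (meson arr_pairing)+
  ultimately show ?thesis
    using assms by (simp add: factors_pairing_iff)
qed

section \<open>Inverses of associators and unitors\<close>

lemma inverse_pair_assoc:
  assumes "a \<in> Obj C" "b \<in> Obj C" "c \<in> Obj C"
  shows "inverse_pair C (Assoc sums a b c)
    (pairing C (pairing C (Prj1 C a (DSum C b c)) (Prj1 C b c \<cdot> Prj2 C a (DSum C b c))) (Prj2 C b c \<cdot> Prj2 C a (DSum C b c)))"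
  using assms by (simp add: inverse_pair_def Hom_iff assoc pairing_prj)

lemma factors_pairing_assoc:
  assumes "f \<in> Arr C" "g \<in> Arr C" "h \<in> Arr C" "Dom C f = Dom C h" "Dom C g = Dom C h"
  shows "factors (pairing C (pairing C f g) h) (pairing C f (pairing C g h))"
    and "factors (pairing C f (pairing C g h)) (pairing C (pairing C f g) h)"
proof -
  show "factors (pairing C (pairing C f g) h) (pairing C f (pairing C g h))"
    using assms by (intro factorsI[of "Assoc sums (Cod C f) (Cod C g) (Cod C h)"]) (simp_all add: assoc)
  show "factors (pairing C f (pairing C g h)) (pairing C (pairing C f g) h)"
    using assms by (auto simp: factors_pairing_iff intro!: factors_pairing1 factors_pairing2
        intro: factors_trans[OF _ factors_pairing2])
qed

lemma inverse_pair_runit: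
  "a \<in> Obj C \<Longrightarrow> inverse_pair C (RUnit sums a) (pairing C (Ide C a) (ZeroArr C a (ZeroObj C)))"
  using null_ZeroObj to_null_obj[of "ZeroObj C" "Prj2 C a (ZeroObj C)"] pairing_prjs[of a "ZeroObj C"]
  by (auto simp: inverse_pair_def Hom_iff)

lemma inverse_pair_lunit:
  "a \<in> Obj C \<Longrightarrow> inverse_pair C (LUnit sums a) (pairing C (ZeroArr C a (ZeroObj C)) (Ide C a))"
  using null_ZeroObj to_null_obj[of "ZeroObj C" "Prj1 C (ZeroObj C) a"] pairing_prjs[of "ZeroObj C" a]
  by (auto simp: inverse_pair_def Hom_iff)

section \<open>Composition and tensor product on admissible pairs\<close>

lemma arr_tilde: "Arr (tilde msums) = {tmk f g | f g. admissible f g}"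
proof (intro equalityI subsetI)
  fix u assume "u \<in> Arr (tilde msums)"
  then obtain a b t f where u: "u = (a, b, tilde_cls msums b (t, f))" "a \<in> Obj C" "b \<in> Obj C" "t \<in> Obj C"
    "is_split_mono C f" "f \<in> Arr C" "Dom C f = a" "Cod C f = DSum C b t"
    by (auto simp: tilde_def Hom_def split_mono_arr)
  have "u = tmk (Prj1 C b t \<cdot> f) (Prj2 C b t \<cdot> f) \<and> admissible (Prj1 C b t \<cdot> f) (Prj2 C b t \<cdot> f)"
    using u by (auto simp: tmk_def pairing_prj intro!: admissibleI)
  then show "u \<in> {tmk f g | f g. admissible f g}" by blast
next
  fix u assume "u \<in> {tmk f g | f g. admissible f g}"
  then obtain f g where u: "admissible f g" "u = tmk f g" by blast
  then have "Dom C f \<in> Obj msums \<and> Cod C f \<in> Obj msums \<and> Cod C g \<in> Obj msums \<and>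
      pairing C f g \<in> Hom msums (Dom C f) (Cod C f \<odot>\<^bsub>msums\<^esub> Cod C g)"
    by (simp add: Hom_def)
  then show "u \<in> Arr (tilde msums)"
    unfolding u(2) tilde_def tmk_def cat.simps by blast
qed

lemma arr_tilde_tmk [simp]: "admissible f g \<Longrightarrow> tmk f g \<in> Arr (tilde msums)"
  by (auto simp: arr_tilde)

lemma arr_tildeE:
  assumes "u \<in> Arr (tilde msums)"
  obtains f g where "admissible f g" "u = tmk f g"
  using assms by (auto simp: arr_tilde)

lemma tilde_sel [simp]:
  "Obj (tilde msums) = Obj C" "Dom (tilde msums) (tmk f g) = Dom C f" "Cod (tilde msums) (tmk f g) = Cod C f"
  "Comp (tilde msums) = tilde_comp msums" "Tensor (tilde msums) = DSum C" "TensorArr (tilde msums) = tilde_tensor msums"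
  "Unit (tilde msums) = ZeroObj C"
  by (simp_all add: tilde_def tmk_def)

text \<open>What is discarded accumulates: first g, then g' applied after f. Admissibility is read
  off the second equation, whose left side is a composite of split monomorphisms.\<close>

lemma admissible_tilde_comp:
  assumes "admissible f g" "admissible f' g'" "Dom C f' = Cod C f"
  shows "admissible (f' \<cdot> f) (pairing C (g' \<cdot> f) g)"
    and "Assoc msums (Cod C f') (Cod C g') (Cod C g) \<cdot> TensorArr msums (pairing C f' g') (Ide C (Cod C g)) \<cdot> pairing C f g
       = pairing C (f' \<cdot> f) (pairing C (g' \<cdot> f) g)"
proof -
  show *: "Assoc msums (Cod C f') (Cod C g') (Cod C g) \<cdot> TensorArr msums (pairing C f' g') (Ide C (Cod C g)) \<cdot> pairing C f g
       = pairing C (f' \<cdot> f) (pairing C (g' \<cdot> f) g)"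
    using assms by (simp add: assoc)
  have "is_split_mono C (Assoc sums (Cod C f') (Cod C g') (Cod C g) \<cdot> TensorArr sums (pairing C f' g') (Ide C (Cod C g)) \<cdot> pairing C f g)"
    using assms by (intro split_mono_comp split_mono_sum split_mono_inverse_pair(1)[OF inverse_pair_assoc]) auto
  then have "is_split_mono C (pairing C (f' \<cdot> f) (pairing C (g' \<cdot> f) g))"
    using * by simp
  then show "admissible (f' \<cdot> f) (pairing C (g' \<cdot> f) g)"
    using assms by (intro admissibleI) auto
qed

lemma tilde_comp_tmk:
  assumes "admissible f g" "admissible f' g'" "Dom C f' = Cod C f"
  shows "tilde_comp msums (tmk f' g') (tmk f g) = tmk (f' \<cdot> f) (pairing C (g' \<cdot> f) g)"
proof -
  let ?K = "\<lambda>t u t' u'. tilde_cls msums (Cod C f')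
      (t' \<odot>\<^bsub>msums\<^esub> t, Assoc msums (Cod C f') t' t \<cdot>\<^bsub>msums\<^esub> (u' \<boxtimes>\<^bsub>msums\<^esub> Ide msums t) \<cdot>\<^bsub>msums\<^esub> u)"
  have "(\<Union>(t, u) \<in> tilde_cls msums (Cod C f) (Cod C g, pairing C f g).
          \<Union>(t', u') \<in> tilde_cls msums (Cod C f') (Cod C g', pairing C f' g'). ?K t u t' u') =
      snd (snd (tmk (f' \<cdot> f) (pairing C (g' \<cdot> f) g)))"
  proof (rule UN_tilde_cls[OF assms(1,2)])
    fix h h' assume h: "admissible f h" "interfactor g h" "admissible f' h'" "interfactor g' h'"
    have "?K (Cod C h) (pairing C f h) (Cod C h') (pairing C f' h') = snd (snd (tmk (f' \<cdot> f) (pairing C (h' \<cdot> f) h)))"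
      using admissible_tilde_comp(2)[OF h(1,3) assms(3)] h assms by (simp add: tmk_def)
    also have "tmk (f' \<cdot> f) (pairing C (h' \<cdot> f) h) = tmk (f' \<cdot> f) (pairing C (g' \<cdot> f) g)"
      using h assms by (intro tmk_cong admissible_tilde_comp factors_pairing_cong factors_comp) auto
    finally show "?K (Cod C h) (pairing C f h) (Cod C h') (pairing C f' h') = snd (snd (tmk (f' \<cdot> f) (pairing C (g' \<cdot> f) g)))" .
  qed
  then show ?thesis
    using assms by (simp add: tilde_comp_def tmk_def)
qed

lemma interchange_msums:
  assumes "b \<in> Obj C" "t \<in> Obj C" "d \<in> Obj C" "u \<in> Obj C"
  shows "interchange msums b t d u =
    pairing C
      (pairing C (Prj1 C b t \<cdot> Prj1 C (DSum C b t) (DSum C d u)) (Prj1 C d u \<cdot> Prj2 C (DSum C b t) (DSum C d u)))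
      (pairing C (Prj2 C b t \<cdot> Prj1 C (DSum C b t) (DSum C d u)) (Prj2 C d u \<cdot> Prj2 C (DSum C b t) (DSum C d u)))"
  using assms unfolding interchange_def
  by (simp add: inv_arr_msums[OF inverse_pair_assoc, simplified] assoc)

text \<open>Exchanging the two middle summands is undone by exchanging them again, that is, by the
  interchange with t and d swapped.\<close>

lemma split_mono_interchange:
  assumes "b \<in> Obj C" "t \<in> Obj C" "d \<in> Obj C" "u \<in> Obj C"
  shows "is_split_mono C (interchange msums b t d u)"
  by (rule split_monoI[of _ "interchange msums b d t u"])
    (use assms in \<open>simp_all add: interchange_msums assoc pairing_prj\<close>)

lemma admissible_tilde_tensor:
  assumes "admissible f g" "admissible f' g'"
  shows "admissible (TensorArr sums f f') (TensorArr sums g g')"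
    and "interchange msums (Cod C f) (Cod C g) (Cod C f') (Cod C g') \<cdot> TensorArr sums (pairing C f g) (pairing C f' g')
       = pairing C (TensorArr sums f f') (TensorArr sums g g')"
proof -
  show *: "interchange msums (Cod C f) (Cod C g) (Cod C f') (Cod C g') \<cdot> TensorArr sums (pairing C f g) (pairing C f' g')
       = pairing C (TensorArr sums f f') (TensorArr sums g g')"
    using assms by (simp add: interchange_msums assoc)
  have "is_split_mono C (interchange msums (Cod C f) (Cod C g) (Cod C f') (Cod C g') \<cdot> TensorArr sums (pairing C f g) (pairing C f' g'))"
    using assms by (intro split_mono_comp split_mono_sum split_mono_interchange) (auto simp: interchange_msums)
  then show "admissible (TensorArr sums f f') (TensorArr sums g g')"
    unfolding * using assms by (intro admissibleI) auto
qed

lemma tilde_tensor_tmk: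
  assumes "admissible f g" "admissible f' g'"
  shows "tilde_tensor msums (tmk f g) (tmk f' g') = tmk (TensorArr sums f f') (TensorArr sums g g')"
proof -
  let ?K = "\<lambda>t u t' u'. tilde_cls msums (Cod C f \<odot>\<^bsub>msums\<^esub> Cod C f')
      (t \<odot>\<^bsub>msums\<^esub> t', interchange msums (Cod C f) t (Cod C f') t' \<cdot>\<^bsub>msums\<^esub> (u \<boxtimes>\<^bsub>msums\<^esub> u'))"
  have "(\<Union>(t, u) \<in> tilde_cls msums (Cod C f) (Cod C g, pairing C f g).
          \<Union>(t', u') \<in> tilde_cls msums (Cod C f') (Cod C g', pairing C f' g'). ?K t u t' u') =
      snd (snd (tmk (TensorArr sums f f') (TensorArr sums g g')))"
  proof (rule UN_tilde_cls[OF assms])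
    fix h h' assume h: "admissible f h" "interfactor g h" "admissible f' h'" "interfactor g' h'"
    have "?K (Cod C h) (pairing C f h) (Cod C h') (pairing C f' h') = snd (snd (tmk (TensorArr sums f f') (TensorArr sums h h')))"
      using admissible_tilde_tensor(2)[OF h(1,3)] h assms by (simp add: tmk_def)
    also have "tmk (TensorArr sums f f') (TensorArr sums h h') = tmk (TensorArr sums f f') (TensorArr sums g g')"
    proof (rule tmk_cong)
      show "factors (TensorArr sums h h') (TensorArr sums g g')" "factors (TensorArr sums g g') (TensorArr sums h h')"
        using h assms by (auto intro!: factors_pairing_cong factors_comp)
    qed (use h assms in \<open>auto intro: admissible_tilde_tensor(1) simp del: sums_sel\<close>)
    finally show "?K (Cod C h) (pairing C f h) (Cod C h') (pairing C f' h') = snd (snd (tmk (TensorArr sums f f') (TensorArr sums g g')))" .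
  qed
  then show ?thesis
    using assms by (simp add: tilde_tensor_def tmk_def)
qed

text \<open>This is the case t = 0, in which nothing is discarded: f followed by the inverse right
  unitor, an isomorphism, remains split. It gives the pair behind \<open>tilde_eta\<close>.\<close>

lemma admissible_zero: "is_split_mono C f \<Longrightarrow> admissible f (ZeroArr C (Dom C f) (ZeroObj C))"
proof -
  assume f: "is_split_mono C f"
  then have f': "f \<in> Arr C" by (rule split_mono_arr)
  have "is_split_mono C (pairing C (Ide C (Cod C f)) (ZeroArr C (Cod C f) (ZeroObj C)) \<cdot> f)"
    using f f' split_mono_inverse_pair(2)[OF inverse_pair_runit[of "Cod C f"]] by (intro split_mono_comp) auto
  then show ?thesis
    using f' by (intro admissibleI) auto
qed

lemma tilde_eta_msums:
  "is_split_mono C f \<Longrightarrow> tilde_eta msums f = tmk f (ZeroArr C (Dom C f) (ZeroObj C))"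
  using split_mono_arr[of f] inv_arr_msums[OF inverse_pair_runit[of "Cod C f"]]
  by (simp add: tilde_eta_def tmk_def)

lemma ide_tilde [simp]: "a \<in> Obj C \<Longrightarrow> Ide (tilde msums) a = tmk (Ide C a) (ZeroArr C a (ZeroObj C))"
  using tilde_eta_msums[of "Ide C a"] by (simp add: tilde_def)

lemma admissible_ide_zero [simp]: "a \<in> Obj C \<Longrightarrow> admissible (Ide C a) (ZeroArr C a (ZeroObj C))"
  using admissible_zero[of "Ide C a"] by simp

lemma Hom_tilde: "Hom (tilde msums) a b = {tmk f g | f g. admissible f g \<and> Dom C f = a \<and> Cod C f = b}"
  unfolding Hom_def arr_tilde by (auto simp: tilde_sel(2,3) simp del: split_paired_All split_paired_Ex) (metis tilde_sel(2,3))+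

text \<open>On first components every axiom is the one of C. The discarded components agree only up
  to mutual divisibility: (0, g) and (g, 0) with g in the unit laws, and the two bracketings of a
  triple in associativity.\<close>

lemma category_tilde: "category (tilde msums)"
proof (unfold_locales, goal_cases)
  case (1 f) then show ?case by (auto elim!: arr_tildeE)
next
  case (2 f) then show ?case by (auto elim!: arr_tildeE)
next
  case (3 a) then show ?case by (auto simp: Hom_def)
next
  case (4 u a b v c)
  then obtain f g f' g' where u: "admissible f g" "u = tmk f g" "Dom C f = a" "Cod C f = b"
    and v: "admissible f' g'" "v = tmk f' g'" "Dom C f' = b" "Cod C f' = c"
    by (auto simp: Hom_tilde)
  then show ?case
    using admissible_tilde_comp(1)[OF u(1) v(1)] by (auto simp: Hom_def tilde_comp_tmk)
next
  case (5 u a b)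
  then obtain f g where u: "admissible f g" "u = tmk f g" "Dom C f = a" "Cod C f = b"
    by (auto simp: Hom_tilde)
  then have "Ide (tilde msums) b \<cdot>\<^bsub>tilde msums\<^esub> u = tmk f (pairing C (ZeroArr C a (ZeroObj C)) g)"
    by (auto simp: tilde_comp_tmk)
  also have "\<dots> = tmk f g"
    using u admissible_tilde_comp(1)[OF u(1) admissible_ide_zero[of b]]
    by (intro tmk_cong) (auto simp: factors_pairing_iff intro!: factors_pairing2)
  finally show ?case using u by simp
next
  case (6 u a b)
  then obtain f g where u: "admissible f g" "u = tmk f g" "Dom C f = a" "Cod C f = b"
    by (auto simp: Hom_tilde)
  then have "u \<cdot>\<^bsub>tilde msums\<^esub> Ide (tilde msums) a = tmk f (pairing C g (ZeroArr C a (ZeroObj C)))"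
    by (auto simp: tilde_comp_tmk)
  also have "\<dots> = tmk f g"
    using u admissible_tilde_comp(1)[OF admissible_ide_zero[of a] u(1)]
    by (intro tmk_cong) (auto simp: factors_pairing_iff intro!: factors_pairing1)
  finally show ?case using u by simp
next
  case (7 u a b v c w d)
  then obtain f g f' g' f'' g'' where u: "admissible f g" "u = tmk f g" "Cod C f = b"
    and v: "admissible f' g'" "v = tmk f' g'" "Dom C f' = b" "Cod C f' = c"
    and w: "admissible f'' g''" "w = tmk f'' g''" "Dom C f'' = c"
    by (auto simp: Hom_tilde)
  note ad = admissible_tilde_comp(1)
  have 1: "admissible (f'' \<cdot> f') (pairing C (g'' \<cdot> f') g')" "admissible (f' \<cdot> f) (pairing C (g' \<cdot> f) g)"
    using u v w by (auto intro!: ad)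
  have 2: "(w \<cdot>\<^bsub>tilde msums\<^esub> v) \<cdot>\<^bsub>tilde msums\<^esub> u = tmk (f'' \<cdot> f' \<cdot> f) (pairing C (pairing C (g'' \<cdot> f' \<cdot> f) (g' \<cdot> f)) g)"
    using u v w 1 by (simp add: tilde_comp_tmk assoc)
  have 3: "w \<cdot>\<^bsub>tilde msums\<^esub> (v \<cdot>\<^bsub>tilde msums\<^esub> u) = tmk (f'' \<cdot> f' \<cdot> f) (pairing C (g'' \<cdot> f' \<cdot> f) (pairing C (g' \<cdot> f) g))"
    using u v w 1 by (simp add: tilde_comp_tmk assoc)
  have 4: "admissible (f'' \<cdot> f' \<cdot> f) (pairing C (pairing C (g'' \<cdot> f' \<cdot> f) (g' \<cdot> f)) g)"
    "admissible (f'' \<cdot> f' \<cdot> f) (pairing C (g'' \<cdot> f' \<cdot> f) (pairing C (g' \<cdot> f) g))"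
    using u v w ad[OF u(1) 1(1)] ad[OF 1(2) w(1)] by (simp_all add: assoc)
  show ?case
    unfolding 2 3 using u v w 4
    by (intro tmk_cong) (auto intro!: factors_pairing_assoc)
qed

end

section \<open>Polynomial functors on sums of split monomorphisms\<close>

context additive_category begin

lemma to_unit_sums [simp]: "a \<in> Obj C \<Longrightarrow> to_unit sums a = ZeroArr C a (ZeroObj C)"
  unfolding to_unit_def
  by (rule the_equality) (use to_null_obj[OF null_ZeroObj] in \<open>auto simp: Hom_iff\<close>)

lemma from_unit_sums [simp]: "a \<in> Obj C \<Longrightarrow> from_unit sums a = ZeroArr C (ZeroObj C) a"
  unfolding from_unit_def
  by (rule the_equality) (use from_null_obj[OF null_ZeroObj] in \<open>auto simp: Hom_iff\<close>)

lemma factors_pairing1': "\<lbrakk>factors f h; f \<in> Arr C; g \<in> Arr C; Dom C f = Dom C g\<rbrakk> \<Longrightarrow> factors (pairing C f g) h"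
  and factors_pairing2': "\<lbrakk>factors g h; f \<in> Arr C; g \<in> Arr C; Dom C f = Dom C g\<rbrakk> \<Longrightarrow> factors (pairing C f g) h"
  by (rule factors_trans[OF _ factors_pairing1], simp_all) (rule factors_trans[OF _ factors_pairing2], simp_all)

text \<open>Two arrows that discard nothing compose to one that discards a pair of zeros. Zeros with
  a common source divide each other, so this pair may be replaced by the zero arrow to
  \<open>ZeroObj C\<close>.\<close>

lemma tilde_eta_comp:
  assumes "is_split_mono C f" "is_split_mono C g" "Dom C g = Cod C f"
  shows "tilde_eta msums g \<cdot>\<^bsub>tilde msums\<^esub> tilde_eta msums f = tilde_eta msums (g \<cdot> f)"
proof -
  have [simp]: "f \<in> Arr C" "g \<in> Arr C" using assms by (auto dest: split_mono_arr)
  have "is_split_mono C (g \<cdot> f)" using assms by (rule split_mono_comp)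
  then have "tmk (g \<cdot> f) (pairing C (ZeroArr C (Dom C f) (ZeroObj C)) (ZeroArr C (Dom C f) (ZeroObj C))) = tmk (g \<cdot> f) (ZeroArr C (Dom C f) (ZeroObj C))"
    using admissible_tilde_comp(1)[OF admissible_zero admissible_zero, of f g] admissible_zero[of "g \<cdot> f"] assms
    by (intro tmk_cong) (auto simp: factors_pairing_iff intro!: factors_pairing1)
  then show ?thesis
    using assms tilde_comp_tmk[OF admissible_zero[OF assms(1)] admissible_zero[OF assms(2)] assms(3)]
    by (simp add: tilde_eta_msums split_mono_comp)
qed

lemma tilde_eta_tensor:
  assumes "is_split_mono C f" "is_split_mono C g"
  shows "tilde_tensor msums (tilde_eta msums f) (tilde_eta msums g) = tilde_eta msums (TensorArr sums f g)"
proof -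
  have [simp]: "f \<in> Arr C" "g \<in> Arr C" using assms by (auto dest: split_mono_arr)
  have m: "is_split_mono C (TensorArr sums f g)" using assms by (rule split_mono_sum)
  let ?z = "TensorArr sums (ZeroArr C (Dom C f) (ZeroObj C)) (ZeroArr C (Dom C g) (ZeroObj C))"
  have z: "?z = ZeroArr C (DSum C (Dom C f) (Dom C g)) (DSum C (ZeroObj C) (ZeroObj C))"
    by (rule prj_eqI[of _ _ "ZeroObj C" "ZeroObj C"]) simp_all
  have "tmk (TensorArr sums f g) ?z = tmk (TensorArr sums f g) (ZeroArr C (DSum C (Dom C f) (Dom C g)) (ZeroObj C))"
    using admissible_tilde_tensor(1)[OF admissible_zero admissible_zero, OF assms] admissible_zero[OF m]
    unfolding z by (intro tmk_cong) auto
  then show ?thesis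
    using assms m by (simp add: tilde_eta_msums tilde_tensor_tmk admissible_zero)
qed

lemma arr_tilde_eta [simp]: "is_split_mono C f \<Longrightarrow> tilde_eta msums f \<in> Arr (tilde msums)"
  by (simp add: tilde_eta_msums admissible_zero)

lemma tilde_eta_dom_cod [simp]:
  "Dom (tilde msums) (tilde_eta msums f) = Dom C f" "Cod (tilde msums) (tilde_eta msums f) = Cod C f"
  by (simp_all add: tilde_def tilde_eta_def)

lemma ide_tilde_eta: "a \<in> Obj C \<Longrightarrow> Ide (tilde msums) a = tilde_eta msums (Ide C a)"
  by (simp add: tilde_def)

lemma split_mono_from_zero: "a \<in> Obj C \<Longrightarrow> is_split_mono C (ZeroArr C (ZeroObj C) a)"
  using null_ZeroObj by (intro split_monoI[of _ "ZeroArr C a (ZeroObj C)"]) (auto simp: null_obj_iff)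

text \<open>Out of the null object both components of an admissible pair are zero. The discarded
  zeros may have different targets, but mutual divisibility identifies them.\<close>

lemma from_unit_tilde:
  assumes "a \<in> Obj C"
  shows "from_unit (tilde msums) a = tilde_eta msums (ZeroArr C (ZeroObj C) a)"
  unfolding from_unit_def
proof (rule the_equality)
  note m = split_mono_from_zero[OF assms]
  show "tilde_eta msums (ZeroArr C (ZeroObj C) a) \<in> Hom (tilde msums) (Unit (tilde msums)) a"
    using assms m by (simp add: Hom_def)
  fix u assume "u \<in> Hom (tilde msums) (Unit (tilde msums)) a"
  then obtain f g where u: "admissible f g" "u = tmk f g" "Dom C f = ZeroObj C" "Cod C f = a"
    by (auto simp: Hom_tilde)
  have f: "f = ZeroArr C (ZeroObj C) a"
    using from_null_obj[OF null_ZeroObj, of f] u by simp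
  have g: "g = ZeroArr C (ZeroObj C) (Cod C g)"
    using from_null_obj[OF null_ZeroObj, of g] u by simp
  define b where "b = Cod C g"
  have b: "b \<in> Obj C" "admissible f (ZeroArr C (ZeroObj C) b)" "g = ZeroArr C (ZeroObj C) b"
    using u(1) g by (simp_all add: b_def)
  have "admissible f (ZeroArr C (ZeroObj C) (ZeroObj C))"
    using admissible_zero[OF m] assms by (simp add: f)
  then have "tmk f g = tmk f (ZeroArr C (ZeroObj C) (ZeroObj C))"
    unfolding b(3) using b u(3) by (intro tmk_cong) auto
  then show "u = tilde_eta msums (ZeroArr C (ZeroObj C) a)"
    using m assms u(2) f by (simp add: tilde_eta_msums)
qed

lemma inv_lunit_tilde:
  assumes "a \<in> Obj C"
  shows "inv_arr (tilde msums) (LUnit (tilde msums) a) = tilde_eta msums (pairing C (ZeroArr C a (ZeroObj C)) (Ide C a))"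
proof (rule category.inv_arr_eq[OF category_tilde])
  note p = inverse_pair_lunit[OF assms]
  have "LUnit (tilde msums) a = tilde_eta msums (LUnit sums a)"
    by (simp add: tilde_def)
  then show "inverse_pair (tilde msums) (LUnit (tilde msums) a) (tilde_eta msums (pairing C (ZeroArr C a (ZeroObj C)) (Ide C a)))"
    using p split_mono_inverse_pair[OF p] assms
    unfolding inverse_pair_def by (simp add: Hom_def ide_tilde_eta tilde_eta_comp del: ide_tilde tilde_sel(4))
qed

text \<open>This is the inclusion of the second summand y, written in the shape in which the unit
  arrow of x and the left unitor produce it. It underlies \<open>shift_map\<close> in both
  categories.\<close>

definition shift_arr :: "'o \<Rightarrow> 'o \<Rightarrow> 'm" where
  "shift_arr x y = pairing C (ZeroArr C y x) (Ide C y)"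

lemma split_mono_shift_arr:
  assumes "x \<in> Obj C" "y \<in> Obj C"
  shows "is_split_mono C (shift_arr x y)"
  by (rule split_monoI[of _ "Prj2 C x y"]) (use assms in \<open>simp_all add: shift_arr_def\<close>)

lemma shift_arr_sums:
  assumes "x \<in> Obj C" "y \<in> Obj C"
  shows "(from_unit sums x \<boxtimes>\<^bsub>sums\<^esub> Ide sums y) \<cdot>\<^bsub>sums\<^esub> inv_arr sums (LUnit sums y) = shift_arr x y"
proof -
  have "inverse_pair sums (LUnit sums y) (pairing C (ZeroArr C y (ZeroObj C)) (Ide C y))"
    using inverse_pair_lunit[OF assms(2)] by (simp add: inverse_pair_def)
  then show ?thesis
    using assms by (simp add: category.inv_arr_eq[OF category_sums, simplified] shift_arr_def assoc)
qed

lemma shift_arr_tilde: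
  assumes "x \<in> Obj C" "y \<in> Obj C"
  shows "(from_unit (tilde msums) x \<boxtimes>\<^bsub>tilde msums\<^esub> Ide (tilde msums) y) \<cdot>\<^bsub>tilde msums\<^esub>
      inv_arr (tilde msums) (LUnit (tilde msums) y) = tilde_eta msums (shift_arr x y)"
proof -
  note m = split_mono_from_zero[OF assms(1)] split_mono_inverse_pair(2)[OF inverse_pair_lunit[OF assms(2)]]
  have "is_split_mono C (TensorArr sums (ZeroArr C (ZeroObj C) x) (Ide C y))"
    using assms m by (intro split_mono_sum) auto
  then have "tilde_eta msums (TensorArr sums (ZeroArr C (ZeroObj C) x) (Ide C y)) \<cdot>\<^bsub>tilde msums\<^esub>
      tilde_eta msums (pairing C (ZeroArr C y (ZeroObj C)) (Ide C y)) = tilde_eta msums (shift_arr x y)"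
    using m assms by (subst tilde_eta_comp) (auto simp: assoc shift_arr_def)
  moreover have "from_unit (tilde msums) x \<boxtimes>\<^bsub>tilde msums\<^esub> Ide (tilde msums) y =
     tilde_eta msums (TensorArr sums (ZeroArr C (ZeroObj C) x) (Ide C y))"
    using m assms by (simp only: from_unit_tilde ide_tilde_eta tilde_sel tilde_eta_tensor split_mono_ide)
  ultimately show ?thesis
    using assms by (simp only: inv_lunit_tilde)
qed

section \<open>The canonical functor and the shift maps on both sides\<close>

abbreviation "tilde_functor \<equiv> tilde_extension msums sums (inclusion_functor msums)"

lemma tilde_functor_obj: "FObj tilde_functor = (\<lambda>a \<in> Obj C. a)"
  by (simp add: tilde_extension_def inclusion_functor_def)

text \<open>Sending the second summand to the null object and then removing it is the first
  projection. Every representative (f, g') of the class therefore yields f, and a representative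
  exists, so the definite description is f.\<close>

lemma tilde_functor_tmk [simp]:
  assumes "admissible f g"
  shows "FArr tilde_functor (tmk f g) = f"
proof -
  let ?X = "tilde_cls msums (Cod C f) (Cod C g, pairing C f g)"
  let ?E = "\<lambda>t u. RUnit sums (FObj (inclusion_functor msums) (Cod C f)) \<cdot>
      (Ide C (FObj (inclusion_functor msums) (Cod C f)) \<boxtimes>\<^bsub>sums\<^esub> to_unit sums (FObj (inclusion_functor msums) t)) \<cdot>
      FArr (inclusion_functor msums) u"
  have E: "?E t u = f" if "(t, u) \<in> ?X" for t u
    using that assms
  proof (rule tilde_cls_memberE)
    fix g' assume "admissible f g'" "(t, u) = (Cod C g', pairing C f g')"
    then show "?E t u = f"
      by (simp add: inclusion_functor_def assoc)
  qed
  have "FArr tilde_functor (tmk f g) = (THE h. \<forall>(t, u) \<in> ?X. h = ?E t u)"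
    using assms by (simp add: tilde_extension_def tmk_def[of f g] arr_tilde_tmk[unfolded tmk_def])
  also have "\<dots> = f"
    using E tmk_self[of g f] by (intro the_equality) fastforce+
  finally show ?thesis .
qed

lemma full_tilde_functor: "full_identity_on_objects (tilde msums) sums tilde_functor"
proof (intro full_identity_on_objects.intro category_tilde category_sums, unfold_locales)
  show "is_functor (tilde msums) sums tilde_functor"
  proof (rule is_functorI)
    fix a assume "a \<in> Obj (tilde msums)"
    then show "FArr tilde_functor (Ide (tilde msums) a) = Ide sums (FObj tilde_functor a)"
      by (simp add: tilde_functor_obj)
  next
    fix u v assume "u \<in> Arr (tilde msums)" "v \<in> Arr (tilde msums)" "Dom (tilde msums) v = Cod (tilde msums) u"
    then show "FArr tilde_functor (v \<cdot>\<^bsub>tilde msums\<^esub> u) = FArr tilde_functor v \<cdot>\<^bsub>sums\<^esub> FArr tilde_functor u"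
      by (auto elim!: arr_tildeE simp: tilde_comp_tmk admissible_tilde_comp(1))
  next
    show "FArr tilde_functor \<in> extensional (Arr (tilde msums))"
      by (simp add: tilde_extension_def)
  qed (auto elim!: arr_tildeE simp: tilde_functor_obj)
  show "Obj (tilde msums) = Obj sums" by simp
  show "FObj tilde_functor a = a" if "a \<in> Obj sums" for a
    using that by (simp add: tilde_functor_obj)
  show "\<exists>u \<in> Arr (tilde msums). FArr tilde_functor u = f" if "f \<in> Arr sums" for f
  proof
    \<comment> \<open>Fullness: f itself need not be split, but discarding a copy of its source
      repairs this, because the projection to that copy retracts (f, 1).\<close>
    have "is_split_mono C (pairing C f (Ide C (Dom C f)))"
      using that by (intro split_monoI[of _ "Prj2 C (Cod C f) (Dom C f)"]) simp_all
    then have "admissible f (Ide C (Dom C f))"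
      using that by (intro admissibleI) auto
    then show "FArr tilde_functor (tmk f (Ide C (Dom C f))) = f" "tmk f (Ide C (Dom C f)) \<in> Arr (tilde msums)"
      by simp_all
  qed
qed

sublocale tilde_functor: full_identity_on_objects "tilde msums" sums tilde_functor
  by (rule full_tilde_functor)

lemma ide_tensor_arr:
  assumes "x \<in> Obj C" "u \<in> Arr (tilde msums)"
  shows "Ide (tilde msums) x \<boxtimes>\<^bsub>tilde msums\<^esub> u \<in> Arr (tilde msums)"
    "Dom (tilde msums) (Ide (tilde msums) x \<boxtimes>\<^bsub>tilde msums\<^esub> u) = DSum C x (Dom (tilde msums) u)"
    "Cod (tilde msums) (Ide (tilde msums) x \<boxtimes>\<^bsub>tilde msums\<^esub> u) = DSum C x (Cod (tilde msums) u)"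
    "FArr tilde_functor (Ide (tilde msums) x \<boxtimes>\<^bsub>tilde msums\<^esub> u) = Ide sums x \<boxtimes>\<^bsub>sums\<^esub> FArr tilde_functor u"
proof -
  obtain f g where u: "admissible f g" "u = tmk f g" using assms(2) by (rule arr_tildeE)
  note ad = admissible_tilde_tensor(1)[OF admissible_ide_zero[OF assms(1)] u(1)]
  have eq: "Ide (tilde msums) x \<boxtimes>\<^bsub>tilde msums\<^esub> u = tmk (TensorArr sums (Ide C x) f) (TensorArr sums (ZeroArr C x (ZeroObj C)) g)"
    using assms u by (simp add: tilde_tensor_tmk)
  show "Ide (tilde msums) x \<boxtimes>\<^bsub>tilde msums\<^esub> u \<in> Arr (tilde msums)"
    "FArr tilde_functor (Ide (tilde msums) x \<boxtimes>\<^bsub>tilde msums\<^esub> u) = Ide sums x \<boxtimes>\<^bsub>sums\<^esub> FArr tilde_functor u"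
    unfolding eq using ad u by (simp_all only: arr_tilde_tmk tilde_functor_tmk sums_sel(5))
  show "Dom (tilde msums) (Ide (tilde msums) x \<boxtimes>\<^bsub>tilde msums\<^esub> u) = DSum C x (Dom (tilde msums) u)"
    "Cod (tilde msums) (Ide (tilde msums) x \<boxtimes>\<^bsub>tilde msums\<^esub> u) = DSum C x (Cod (tilde msums) u)"
    unfolding eq using u assms(1) by simp_all
qed

lemma left_tensor_sums: "x \<in> Obj C \<Longrightarrow> is_functor sums sums (left_tensor sums x)"
  by (rule is_functorI) (auto simp: left_tensor_def assoc)

lemma precomp_left_tensor:
  assumes "x \<in> Obj C"
  shows "tilde_functor.precomp (comp_functor sums H (left_tensor sums x)) =
    comp_functor (tilde msums) (tilde_functor.precomp H) (left_tensor (tilde msums) x)"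
  unfolding comp_functor_def left_tensor_def
  using assms by (auto simp: fun_eq_iff tilde_functor_obj ide_tensor_arr tilde_functor.\<Phi>_simps[simplified] simp del: tilde_sel(6) ide_tilde sums_sel(5,8))

text \<open>The canonical functor commutes with x \<oplus> - and sends \<open>tilde_eta\<close> of
  an arrow to that arrow. Hence the targets and the components of both transformations coincide on
  the nose.\<close>

lemma precomp_shift_map:
  assumes "x \<in> Obj C"
  shows "precomp_nat (tilde msums) tilde_functor (shift_map sums x H) =
    shift_map (tilde msums) x (tilde_functor.precomp H)"
  unfolding shift_map_def precomp_nat_def
  using precomp_left_tensor[OF assms] shift_arr_tilde[OF assms] shift_arr_sums[OF assms] split_mono_shift_arr[OF assms]
  by (auto simp: fun_eq_iff tilde_functor_obj tilde_eta_msums admissible_zero simp del: tilde_sel(4,6) ide_tilde sums_sel(5,6,8))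

text \<open>The second transformation is the retraction wanted by
  \<open>is_cokernel_precomp_iff\<close>: projecting x \<oplus> y to y splits the inclusion of y,
  naturally in y.\<close>

lemma shift_map_sums:
  assumes "is_functor sums B H" "x \<in> Obj C"
  shows "is_nat_trans sums B (shift_map sums x H)"
    and "is_nat_trans sums B \<lparr>NDom = comp_functor sums H (left_tensor sums x), NCod = H, NCmp = (\<lambda>y \<in> Obj C. FArr H (Prj2 C x y))\<rparr>"
proof -
  note FL = is_functor_comp[OF category_sums left_tensor_sums[OF assms(2)] assms(1)]
  note [simp] = is_functorD(1-4)[OF assms(1), simplified]
  note comp = is_functorD(6)[OF assms(1), simplified, symmetric]
  have shift: "shift_map sums x H = \<lparr>NDom = H, NCod = comp_functor sums H (left_tensor sums x), NCmp = (\<lambda>y \<in> Obj C. FArr H (shift_arr x y))\<rparr>"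
    unfolding shift_map_def using shift_arr_sums[OF assms(2)] by (auto simp: fun_eq_iff simp del: sums_sel(5,6,8))
  have lt: "FObj (left_tensor sums x) y = DSum C x y" if "y \<in> Obj C" for y
    using that by (simp add: left_tensor_def)
  have la: "FArr (left_tensor sums x) f = TensorArr sums (Ide C x) f" if "f \<in> Arr C" for f
    using that by (simp add: left_tensor_def)
  have [simp]: "shift_arr x y \<in> Arr C" "Dom C (shift_arr x y) = y" "Cod C (shift_arr x y) = DSum C x y" if "y \<in> Obj C" for y
    using that assms(2) by (simp_all add: shift_arr_def)
  show "is_nat_trans sums B (shift_map sums x H)"
    unfolding shift
  proof (rule is_nat_transI)
    fix f assume f: "f \<in> Arr sums"
    have "shift_arr x (Cod C f) \<cdot> f = TensorArr sums (Ide C x) f \<cdot> shift_arr x (Dom C f)"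
      using f assms(2) by (simp add: shift_arr_def assoc)
    from arg_cong[OF this, of "FArr H"]
    show "NCmp \<lparr>NDom = H, NCod = comp_functor sums H (left_tensor sums x), NCmp = (\<lambda>y \<in> Obj C. FArr H (shift_arr x y))\<rparr> (Cod sums f) \<cdot>\<^bsub>B\<^esub>
        FArr (NDom \<lparr>NDom = H, NCod = comp_functor sums H (left_tensor sums x), NCmp = (\<lambda>y \<in> Obj C. FArr H (shift_arr x y))\<rparr>) f =
      FArr (NCod \<lparr>NDom = H, NCod = comp_functor sums H (left_tensor sums x), NCmp = (\<lambda>y \<in> Obj C. FArr H (shift_arr x y))\<rparr>) f \<cdot>\<^bsub>B\<^esub>
        NCmp \<lparr>NDom = H, NCod = comp_functor sums H (left_tensor sums x), NCmp = (\<lambda>y \<in> Obj C. FArr H (shift_arr x y))\<rparr> (Dom sums f)"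
      using f assms(2) by (simp add: la comp)
  qed (use assms FL in \<open>auto simp: lt\<close>)
  show "is_nat_trans sums B \<lparr>NDom = comp_functor sums H (left_tensor sums x), NCod = H, NCmp = (\<lambda>y \<in> Obj C. FArr H (Prj2 C x y))\<rparr>"
    by (rule is_nat_transI) (use assms FL in \<open>auto simp: lt la comp\<close>)
qed

lemma is_cokernel_shift_map_iff:
  assumes "additive_category B" "is_functor sums B H" "x \<in> Obj C"
    "is_nat_trans sums B \<pi>" "NDom \<pi> = comp_functor sums H (left_tensor sums x)"
  shows "is_cokernel (Fct (tilde msums) B) (shift_map (tilde msums) x (tilde_functor.precomp H)) (precomp_nat (tilde msums) tilde_functor \<pi>)
    \<longleftrightarrow> is_cokernel (Fct sums B) (shift_map sums x H) \<pi>"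
proof -
  have "NCmp (shift_map sums x H) y = FArr H (shift_arr x y)" if "y \<in> Obj C" for y
    using that shift_arr_sums[OF assms(3)] by (simp add: shift_map_def del: sums_sel(5,6,8))
  moreover have "FArr H (Prj2 C x y) \<cdot>\<^bsub>B\<^esub> FArr H (shift_arr x y) = Ide B (FObj H y)" if "y \<in> Obj C" for y
    using is_functorD(6)[OF assms(2), simplified, of "shift_arr x y" "Prj2 C x y"] is_functorD(5)[OF assms(2), simplified, of y] that assms(3)
    by (simp add: shift_arr_def)
  moreover have "NDom (shift_map sums x H) = H" "NCod (shift_map sums x H) = comp_functor sums H (left_tensor sums x)"
    by (simp_all add: shift_map_def)
  ultimately show ?thesis
    unfolding precomp_shift_map[OF assms(3), symmetric]
    by (intro tilde_functor.is_cokernel_precomp_iff[OF assms(1) shift_map_sums(1)[OF assms(2,3)] shift_map_sums(2)[OF assms(2,3)]])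
      (use assms in auto)
qed

text \<open>The cokernel that certifies the degree of F is carried over by precomposition. It
  remains a cokernel by the equational criterion, and the induction hypothesis covers its
  target.\<close>

lemma polynomial_precomp:
  assumes "polynomial sums B n H" "additive_category B"
  shows "polynomial (tilde msums) B n (tilde_functor.precomp H)"
  using assms(1)
proof (induction rule: polynomial.induct)
  case (neg n F)
  then show ?case
    by (intro polynomial.neg tilde_functor.precomp_functor) (auto simp: tilde_functor_obj)
next
  case (nonneg n F)
  show ?case
  proof (intro polynomial.nonneg ballI)
    fix x assume x: "x \<in> Obj (tilde msums)"
    then obtain \<pi> where \<pi>: "is_cokernel (Fct sums B) (shift_map sums x F) \<pi>"
      "polynomial (tilde msums) B (n - 1) (tilde_functor.precomp (NCod \<pi>))"
      using nonneg(3) by auto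
    then have "is_nat_trans sums B \<pi>" "NDom \<pi> = comp_functor sums F (left_tensor sums x)"
      by (auto simp: is_cokernel_def shift_map_def)
    then show "\<exists>\<pi>. is_cokernel (Fct (tilde msums) B) (shift_map (tilde msums) x (tilde_functor.precomp F)) \<pi> \<and>
        polynomial (tilde msums) B (n - 1) (NCod \<pi>)"
      using is_cokernel_shift_map_iff[OF assms(2) nonneg(2)] \<pi> x
      by (intro exI[of _ "precomp_nat (tilde msums) tilde_functor \<pi>"]) simp
  qed (use nonneg in \<open>auto intro: tilde_functor.precomp_functor\<close>)
qed

section \<open>Idempotents that normalise the discarded component\<close>

lemma factors_split_mono:
  assumes "is_split_mono C f" "g \<in> Arr C" "Dom C g = Dom C f"
  shows "factors f g"
proof -
  obtain r where r: "f \<in> Arr C" "r \<in> Arr C" "Dom C r = Cod C f" "Cod C r = Dom C f" "r \<cdot> f = Ide C (Dom C f)"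
    using assms(1) by (rule split_monoE)
  then show ?thesis
    using assms by (intro factorsI[of "g \<cdot> r"]) (simp_all add: assoc)
qed

lemma admissible_ide:
  assumes "f \<in> Arr C" "Dom C f = a"
  shows "admissible f (Ide C a)"
  using assms split_monoI[of "pairing C f (Ide C a)" "Prj2 C (Cod C f) a"]
  by (intro admissibleI) auto

text \<open>This is the class of the diagonal a \<rightarrow> a \<oplus> a, with one copy kept and
  the other discarded. The canonical functor sends it to the identity, and
  \<open>compatible_if_forget\<close> shows that these arrows account for the whole failure of
  faithfulness.\<close>

definition forget :: "'o \<Rightarrow> ('o, 'm) tilde_arr" where
  "forget a = tmk (Ide C a) (Ide C a)"

lemma forget_arr [simp]:
  assumes "a \<in> Obj C"
  shows "forget a \<in> Arr (tilde msums)" "Dom (tilde msums) (forget a) = a" "Cod (tilde msums) (forget a) = a"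
  using assms by (simp_all add: forget_def admissible_ide)

text \<open>The composite discards (f, g), a split monomorphism. By
  \<open>factors_split_mono\<close> such an arrow and the identity divide each other, so all memory
  of g is lost.\<close>

lemma forget_comp:
  assumes "admissible f g"
  shows "tilde_comp msums (forget (Cod C f)) (tmk f g) = tmk f (Ide C (Dom C f))"
proof -
  have "tilde_comp msums (forget (Cod C f)) (tmk f g) = tmk f (pairing C f g)"
    using assms tilde_comp_tmk[OF assms admissible_ide[of "Ide C (Cod C f)"]] by (simp add: forget_def)
  also have "\<dots> = tmk f (Ide C (Dom C f))"
    using assms admissible_tilde_comp(1)[OF assms admissible_ide[of "Ide C (Cod C f)"]]
    by (intro tmk_cong admissible_ide factors_split_mono) auto
  finally show ?thesis .
qed

text \<open>F takes the same value at an arrow and at its composite with \<open>forget\<close>,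
  whose second component is 1 by \<open>forget_comp\<close>. What remains depends only on the first
  component, the image under the canonical functor.\<close>

lemma compatible_if_forget:
  assumes F: "is_functor (tilde msums) B F" "category B"
    and forget: "\<And>a. a \<in> Obj C \<Longrightarrow> FArr F (forget a) = Ide B (FObj F a)"
    and uv: "u \<in> Arr (tilde msums)" "v \<in> Arr (tilde msums)" "FArr tilde_functor u = FArr tilde_functor v"
  shows "FArr F u = FArr F v"
proof -
  interpret B: category B by fact
  have *: "FArr F (tmk f g) = FArr F (tmk f (Ide C (Dom C f)))" if fg: "admissible f g" for f g
  proof -
    have "FArr F (tmk f g) = FArr F (forget (Cod C f)) \<cdot>\<^bsub>B\<^esub> FArr F (tmk f g)"
      using fg is_functorD[OF F(1)] by (simp add: forget)
    also have "\<dots> = FArr F (tilde_comp msums (forget (Cod C f)) (tmk f g))"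
      using fg is_functorD(6)[OF F(1), of "tmk f g" "forget (Cod C f)"] by simp
    finally show ?thesis using fg by (simp only: forget_comp)
  qed
  obtain f g f' g' where "admissible f g" "u = tmk f g" "admissible f' g'" "v = tmk f' g'"
    using uv(1,2) by (elim arr_tildeE)
  then show ?thesis
    using uv(3) *[of f g] *[of f' g'] by simp
qed

lemma forget_squared: "a \<in> Obj C \<Longrightarrow> tilde_comp msums (forget a) (forget a) = forget a"
  using forget_comp[of "Ide C a" "Ide C a"] admissible_ide[of "Ide C a"] by (simp add: forget_def)

section \<open>Projections and diagonals with discarded summands\<close>

lemma admissible_braid:
  assumes "x \<in> Obj C" "y \<in> Obj C"
  shows "admissible (Prj2 C x y) (Prj1 C x y)"
  using assms split_monoI[of "pairing C (Prj2 C x y) (Prj1 C x y)" "pairing C (Prj2 C y x) (Prj1 C y x)"]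
  by (intro admissibleI) auto

text \<open>The representative is the braiding x \<oplus> y \<rightarrow> y \<oplus> x with x
  regarded as discarded. In this way the projection to y, rarely a split monomorphism, lifts along
  the canonical functor.\<close>

definition tilde_prj :: "'o \<Rightarrow> 'o \<Rightarrow> ('o, 'm) tilde_arr" where
  "tilde_prj x y = tmk (Prj2 C x y) (Prj1 C x y)"

lemma tilde_prj_arr [simp]:
  assumes "x \<in> Obj C" "y \<in> Obj C"
  shows "tilde_prj x y \<in> Arr (tilde msums)" "Dom (tilde msums) (tilde_prj x y) = DSum C x y"
    "Cod (tilde msums) (tilde_prj x y) = y"
  using assms by (simp_all add: tilde_prj_def admissible_braid)

text \<open>Both composites keep \<open>f \<cdot> Prj2\<close>. Up to order and an extra zero, both
  discard \<open>Prj1\<close> together with \<open>g \<cdot> Prj2\<close>, and neither difference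
  affects divisibility.\<close>

lemma tilde_prj_natural:
  assumes "x \<in> Obj C" "u \<in> Arr (tilde msums)"
  shows "tilde_comp msums (tilde_prj x (Cod (tilde msums) u)) (Ide (tilde msums) x \<boxtimes>\<^bsub>tilde msums\<^esub> u) =
    tilde_comp msums u (tilde_prj x (Dom (tilde msums) u))"
proof -
  obtain f g where u: "admissible f g" "u = tmk f g" using assms(2) by (rule arr_tildeE)
  let ?a = "Dom C f" and ?b = "Cod C f"
  have 1: "admissible (TensorArr sums (Ide C x) f) (TensorArr sums (ZeroArr C x (ZeroObj C)) g)"
    using admissible_tilde_tensor(1)[OF admissible_ide_zero[OF assms(1)] u(1)] .
  have 2: "admissible (Prj2 C x ?b) (Prj1 C x ?b)" "admissible (Prj2 C x ?a) (Prj1 C x ?a)"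
    using u assms(1) by (simp_all add: admissible_braid)
  have eq: "Ide (tilde msums) x \<boxtimes>\<^bsub>tilde msums\<^esub> u = tmk (TensorArr sums (Ide C x) f) (TensorArr sums (ZeroArr C x (ZeroObj C)) g)"
    using assms u by (simp add: tilde_tensor_tmk)
  let ?g = "pairing C (Prj1 C x ?a) (pairing C (ZeroArr C (DSum C x ?a) (ZeroObj C)) (g \<cdot> Prj2 C x ?a))"
  have L: "tilde_comp msums (tilde_prj x ?b) (Ide (tilde msums) x \<boxtimes>\<^bsub>tilde msums\<^esub> u) = tmk (f \<cdot> Prj2 C x ?a) ?g"
    unfolding eq tilde_prj_def using u assms(1) by (subst tilde_comp_tmk[OF 1 2(1)]) (auto simp: assoc)
  have L': "admissible (f \<cdot> Prj2 C x ?a) ?g"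
    using admissible_tilde_comp(1)[OF 1 2(1)] u assms(1) by (simp add: assoc)
  have R: "tilde_comp msums u (tilde_prj x ?a) = tmk (f \<cdot> Prj2 C x ?a) (pairing C (g \<cdot> Prj2 C x ?a) (Prj1 C x ?a))"
    unfolding u(2) tilde_prj_def using u assms(1) by (subst tilde_comp_tmk[OF 2(2) u(1)]) auto
  have R': "admissible (f \<cdot> Prj2 C x ?a) (pairing C (g \<cdot> Prj2 C x ?a) (Prj1 C x ?a))"
    using admissible_tilde_comp(1)[OF 2(2) u(1)] u(1) assms(1) by simp
  have "factors ?g (pairing C (g \<cdot> Prj2 C x ?a) (Prj1 C x ?a))"
    using u assms(1) by (simp add: factors_pairing_iff factors_pairing1 factors_pairing2 factors_pairing2')
  moreover have "factors (pairing C (g \<cdot> Prj2 C x ?a) (Prj1 C x ?a)) ?g"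
    using u assms(1) by (simp add: factors_pairing_iff factors_pairing1 factors_pairing2)
  ultimately have "tmk (f \<cdot> Prj2 C x ?a) ?g = tmk (f \<cdot> Prj2 C x ?a) (pairing C (g \<cdot> Prj2 C x ?a) (Prj1 C x ?a))"
    by (intro tmk_cong L' R')
  then show ?thesis using L R u by simp
qed

text \<open>Including y and then projecting to y discards only zeros, which makes the composite the
  pair (1, 0) up to divisibility.\<close>

lemma tilde_prj_shift:
  assumes "x \<in> Obj C" "y \<in> Obj C"
  shows "tilde_comp msums (tilde_prj x y) (tilde_eta msums (shift_arr x y)) = Ide (tilde msums) y"
proof -
  note m = split_mono_shift_arr[OF assms]
  note ad = admissible_zero[OF m] admissible_braid[OF assms]
  let ?g = "pairing C (ZeroArr C y x) (ZeroArr C y (ZeroObj C))"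
  have 1: "tilde_comp msums (tilde_prj x y) (tilde_eta msums (shift_arr x y)) = tmk (Ide C y) ?g"
    unfolding tilde_prj_def tilde_eta_msums[OF m] using assms
    by (subst tilde_comp_tmk[OF ad]) (simp_all add: shift_arr_def)
  have 2: "admissible (Ide C y) ?g"
    using admissible_tilde_comp(1)[OF ad] assms by (simp add: shift_arr_def)
  have "tmk (Ide C y) ?g = tmk (Ide C y) (ZeroArr C y (ZeroObj C))"
    using 2 assms by (intro tmk_cong) (simp_all add: factors_pairing_iff)
  then show ?thesis using 1 assms by simp
qed

text \<open>In the first equation both sides keep the diagonal and discard one copy of a. In the
  second, projecting the diagonal to one copy discards the other, which is not the identity but
  \<open>forget a\<close>. The projection is thus no retraction of the diagonal in general, and the
  third claim needs a different one, whose discarded component vanishes on the diagonal.\<close>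

lemma diagonal_forget:
  assumes "a \<in> Obj C"
  defines "\<Delta> \<equiv> tilde_eta msums (pairing C (Ide C a) (Ide C a))"
  shows "tilde_comp msums (Ide (tilde msums) a \<boxtimes>\<^bsub>tilde msums\<^esub> forget a) \<Delta> = tilde_comp msums \<Delta> (forget a)"
    and "tilde_comp msums (tilde_prj a a) \<Delta> = forget a"
    and "\<exists>r \<in> Arr (tilde msums). Dom (tilde msums) r = DSum C a a \<and> tilde_comp msums r \<Delta> = Ide (tilde msums) a"
proof -
  let ?d = "pairing C (Ide C a) (Ide C a)" and ?z = "ZeroArr C a (ZeroObj C)"
  have m: "is_split_mono C ?d"
    using assms(1) by (intro split_monoI[of _ "Prj1 C a a"]) simp_all
  have \<Delta>: "\<Delta> = tmk ?d ?z" unfolding \<Delta>_def tilde_eta_msums[OF m] using assms(1) by simp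
  have ad: "admissible ?d ?z" using admissible_zero[OF m] assms(1) by simp
  have i: "admissible (Ide C a) (Ide C a)" using assms(1) by (intro admissible_ide) simp_all
  let ?t = "TensorArr sums ?z (Ide C a)"
  have te: "Ide (tilde msums) a \<boxtimes>\<^bsub>tilde msums\<^esub> forget a = tmk (Ide C (DSum C a a)) ?t"
    unfolding forget_def using assms(1) tilde_tensor_tmk[OF admissible_ide_zero[OF assms(1)] i] by simp
  have at: "admissible (Ide C (DSum C a a)) ?t"
    using admissible_tilde_tensor(1)[OF admissible_ide_zero[OF assms(1)] i] assms(1) by simp
  have L: "tilde_comp msums (Ide (tilde msums) a \<boxtimes>\<^bsub>tilde msums\<^esub> forget a) \<Delta> = tmk ?d (pairing C (pairing C ?z (Ide C a)) ?z)"
    unfolding te \<Delta> using assms(1) by (subst tilde_comp_tmk[OF ad at]) (simp_all add: assoc)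
  have L': "admissible ?d (pairing C (pairing C ?z (Ide C a)) ?z)"
    using admissible_tilde_comp(1)[OF ad at] assms(1) by (simp add: assoc)
  have R: "tilde_comp msums \<Delta> (forget a) = tmk ?d (pairing C ?z (Ide C a))"
    unfolding \<Delta> forget_def using assms(1) by (subst tilde_comp_tmk[OF i ad]) simp_all
  have R': "admissible ?d (pairing C ?z (Ide C a))"
    using admissible_tilde_comp(1)[OF i ad] assms(1) by simp
  show "tilde_comp msums (Ide (tilde msums) a \<boxtimes>\<^bsub>tilde msums\<^esub> forget a) \<Delta> = tilde_comp msums \<Delta> (forget a)"
    unfolding L R using assms(1)
    by (intro tmk_cong L' R') (simp_all add: factors_pairing_iff factors_pairing1 factors_pairing1' factors_pairing2)
  have br: "admissible (Prj2 C a a) (Prj1 C a a)" using admissible_braid assms(1) by simp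
  have "tilde_comp msums (tilde_prj a a) \<Delta> = tmk (Ide C a) (pairing C (Ide C a) ?z)"
    unfolding \<Delta> tilde_prj_def using assms(1) by (subst tilde_comp_tmk[OF ad br]) simp_all
  also have "\<dots> = forget a"
    unfolding forget_def using admissible_tilde_comp(1)[OF ad br] assms(1)
    by (intro tmk_cong i) (simp_all add: factors_pairing_iff factors_pairing1)
  finally show "tilde_comp msums (tilde_prj a a) \<Delta> = forget a" .
  \<comment> \<open>Here h is the difference of the second and the first projection, which kills the
    diagonal. The shear (\<open>Prj1\<close>, h) is split by adding the first component back to the
    second, and the first component alone still retracts the diagonal.\<close>
  obtain h where h: "h \<in> Arr C" "Dom C h = DSum C a a" "Cod C h = a" "AddArr C h (Prj1 C a a) = Prj2 C a a"
    using difference_exists[of "Prj2 C a a" "Prj1 C a a"] assms(1) by (auto simp: Hom_iff)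
  have hd: "h \<cdot> ?d = ZeroArr C a a"
  proof (rule add_right_cancel[of _ "Ide C a"])
    show "AddArr C (h \<cdot> ?d) (Ide C a) = AddArr C (ZeroArr C a a) (Ide C a)"
      using add_comp[of ?d h "Prj1 C a a"] h assms(1) by simp
  qed (use h assms(1) in simp_all)
  have "is_split_mono C (pairing C (Prj1 C a a) h)"
  proof (rule split_monoI[of _ "pairing C (Prj1 C a a) (AddArr C (Prj2 C a a) (Prj1 C a a))"])
    have "AddArr C (Prj2 C a a) (Prj1 C a a) \<cdot> pairing C (Prj1 C a a) h = Prj2 C a a"
      using h assms(1) by (subst add_comp) simp_all
    then show "pairing C (Prj1 C a a) (AddArr C (Prj2 C a a) (Prj1 C a a)) \<cdot> pairing C (Prj1 C a a) h = Ide C (Dom C (pairing C (Prj1 C a a) h))"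
      using h assms(1) by simp
  qed (use h assms(1) in simp_all)
  then have r: "admissible (Prj1 C a a) h"
    using h assms(1) by (intro admissibleI) simp_all
  have "tilde_comp msums (tmk (Prj1 C a a) h) \<Delta> = tmk (Ide C a) (pairing C (ZeroArr C a a) ?z)"
    unfolding \<Delta> using assms(1) hd by (subst tilde_comp_tmk[OF ad r]) simp_all
  also have "\<dots> = Ide (tilde msums) a"
    using admissible_tilde_comp(1)[OF ad r] assms(1) hd
    by (simp, intro tmk_cong) (simp_all add: factors_pairing_iff)
  finally show "\<exists>r \<in> Arr (tilde msums). Dom (tilde msums) r = DSum C a a \<and> tilde_comp msums r \<Delta> = Ide (tilde msums) a"
    using r assms(1) by (intro bexI[of _ "tmk (Prj1 C a a) h"]) simp_all
qed

text \<open>At this stage F is not known to factor through C, so the projection of C cannot be used;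
  the retraction comes from \<open>tilde_prj\<close> and its naturality. In the application,
  naturality of the shift map comes with the cokernel at hand.\<close>

lemma shift_map_tilde_retraction:
  assumes F: "is_functor (tilde msums) B F" and B: "category B" and x: "x \<in> Obj C"
    and shift: "is_nat_trans (tilde msums) B (shift_map (tilde msums) x F)"
  defines "\<rho> \<equiv> \<lparr>NDom = NCod (shift_map (tilde msums) x F), NCod = F, NCmp = (\<lambda>y \<in> Obj C. FArr F (tilde_prj x y))\<rparr>"
  shows "is_nat_trans (tilde msums) B \<rho>"
    and "y \<in> Obj C \<Longrightarrow> NCmp \<rho> y \<cdot>\<^bsub>B\<^esub> NCmp (shift_map (tilde msums) x F) y = Ide B (FObj F y)"
proof -
  interpret B: category B by fact
  have cod: "NCod (shift_map (tilde msums) x F) = comp_functor (tilde msums) F (left_tensor (tilde msums) x)"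
    by (simp add: shift_map_def)
  note comp = is_functorD(6)[OF F, symmetric]
  show "is_nat_trans (tilde msums) B \<rho>"
  proof (rule is_nat_transI)
    fix u assume u: "u \<in> Arr (tilde msums)"
    have [simp]: "Cod (tilde msums) u \<in> Obj C" "Dom (tilde msums) u \<in> Obj C"
      using category.obj_cod[OF category_tilde u] category.obj_dom[OF category_tilde u] by simp_all
    note t = ide_tensor_arr[OF x u]
    have "FArr F (tilde_prj x (Cod (tilde msums) u)) \<cdot>\<^bsub>B\<^esub> FArr F (Ide (tilde msums) x \<boxtimes>\<^bsub>tilde msums\<^esub> u) =
        FArr F u \<cdot>\<^bsub>B\<^esub> FArr F (tilde_prj x (Dom (tilde msums) u))"
      using comp[of "Ide (tilde msums) x \<boxtimes>\<^bsub>tilde msums\<^esub> u" "tilde_prj x (Cod (tilde msums) u)"]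
        comp[of "tilde_prj x (Dom (tilde msums) u)" u] tilde_prj_natural[OF x u] t u x
      by (simp only: tilde_prj_arr \<open>Cod (tilde msums) u \<in> Obj C\<close> \<open>Dom (tilde msums) u \<in> Obj C\<close> tilde_sel(4))
    then show "NCmp \<rho> (Cod (tilde msums) u) \<cdot>\<^bsub>B\<^esub> FArr (NDom \<rho>) u = FArr (NCod \<rho>) u \<cdot>\<^bsub>B\<^esub> NCmp \<rho> (Dom (tilde msums) u)"
      using u by (simp add: \<rho>_def cod left_tensor_def)
  qed (use F x is_nat_transD(2)[OF shift] in \<open>auto simp: \<rho>_def is_functorD cod left_tensor_def\<close>)
  assume y: "y \<in> Obj C"
  show "NCmp \<rho> y \<cdot>\<^bsub>B\<^esub> NCmp (shift_map (tilde msums) x F) y = Ide B (FObj F y)"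
  proof -
    have "NCmp (shift_map (tilde msums) x F) y = FArr F (tilde_eta msums (shift_arr x y))"
      using y shift_arr_tilde[OF x y] by (simp add: shift_map_def)
    moreover have "FArr F (tilde_prj x y) \<cdot>\<^bsub>B\<^esub> FArr F (tilde_eta msums (shift_arr x y)) = Ide B (FObj F y)"
      using comp[of "tilde_eta msums (shift_arr x y)" "tilde_prj x y"] tilde_prj_shift[OF x y]
        split_mono_shift_arr[OF x y] is_functorD(5)[OF F, of y] x y
      by (simp add: shift_arr_def)
    ultimately show ?thesis using y by (simp add: \<rho>_def)
  qed
qed

text \<open>By induction \<open>forget a\<close> acts trivially on \<open>\<delta>\<^sub>a(F)\<close>, so \<open>F(a \<oplus> forget a)\<close> differs from the
  identity of \<open>F(a \<oplus> a) = F(a) \<oplus> \<delta>\<^sub>a(F)(a)\<close> only by \<open>F(forget a) - 1\<close> on the first summand. The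
  diagonal \<open>\<Delta>\<close> has component \<open>F(forget a)\<close> there and \<open>forget a\<close> is idempotent, so
  \<open>F(\<Delta> \<circ> forget a) = F((a \<oplus> forget a) \<circ> \<Delta>) = F(\<Delta>)\<close>; moreover \<open>\<Delta>\<close> has a left inverse.\<close>

lemma polynomial_forget:
  assumes "polynomial (tilde msums) B n F" "additive_category B" "a \<in> Obj C"
  shows "FArr F (forget a) = Ide B (FObj F a)"
  using assms(1,3)
proof (induction arbitrary: a rule: polynomial.induct)
  case (neg n F)
  interpret B: additive_category B by fact
  have "is_null_obj B (FObj F a)" using neg by simp
  then show ?case
    using B.to_null_obj[of "FObj F a" "FArr F (forget a)"] is_functorD(2-4)[OF neg(2), of "forget a"] neg.prems
    by (simp add: B.null_obj_iff)
next
  case (nonneg n F)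
  interpret B: additive_category B by fact
  note F = nonneg(2) and a = nonneg.prems
  let ?e = "forget a" and ?\<tau> = "shift_map (tilde msums) a F"
  define \<Delta> where "\<Delta> = tilde_eta msums (pairing C (Ide C a) (Ide C a))"
  note \<Delta> = diagonal_forget[OF a, folded \<Delta>_def]
  have m: "is_split_mono C (pairing C (Ide C a) (Ide C a))"
    using a by (intro split_monoI[of _ "Prj1 C a a"]) simp_all
  have \<Delta>_arr [simp]: "\<Delta> \<in> Arr (tilde msums)" "Dom (tilde msums) \<Delta> = a" "Cod (tilde msums) \<Delta> = DSum C a a"
    unfolding \<Delta>_def using m a by (simp_all)
  obtain \<pi> where \<pi>: "is_cokernel (Fct (tilde msums) B) ?\<tau> \<pi>"
    "\<And>b. b \<in> Obj C \<Longrightarrow> FArr (NCod \<pi>) (forget b) = Ide B (FObj (NCod \<pi>) b)"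
    using nonneg(3) a by fastforce
  have \<tau>: "is_nat_trans (tilde msums) B ?\<tau>" and \<pi>': "is_nat_trans (tilde msums) B \<pi>" "NDom \<pi> = NCod ?\<tau>"
    using \<pi>(1) by (auto simp: is_cokernel_def)
  define \<rho> where "\<rho> = \<lparr>NDom = NCod ?\<tau>, NCod = F, NCmp = (\<lambda>y \<in> Obj C. FArr F (tilde_prj a y))\<rparr>"
  note \<rho> = shift_map_tilde_retraction[OF F B.category_axioms a \<tau>, folded \<rho>_def]
  have dom: "NDom ?\<tau> = F" and cod: "NCod ?\<tau> = comp_functor (tilde msums) F (left_tensor (tilde msums) a)"
    by (simp_all add: shift_map_def)
  have \<rho>_sel: "NDom \<rho> = NCod ?\<tau>" "NCod \<rho> = F" "NCmp \<rho> a = FArr F (tilde_prj a a)"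
    using a by (simp_all add: \<rho>_def)
  obtain j where j: "is_nat_trans (tilde msums) B j" "NDom j = NCod \<pi>" "NCod j = NCod ?\<tau>"
    "AddArr B (NCmp j a \<cdot>\<^bsub>B\<^esub> NCmp \<pi> a) (NCmp ?\<tau> a \<cdot>\<^bsub>B\<^esub> NCmp \<rho> a) = Ide B (FObj (NCod ?\<tau>) a)"
    using iffD1[OF is_cokernel_split_iff[OF category_tilde assms(2) \<tau> \<rho>(1) \<rho>_sel(1) _ _ \<pi>'] \<pi>(1)] \<rho>(2) a
    by (auto simp: \<rho>_sel(2) dom)
  note comp = is_functorD(6)[OF F, symmetric, unfolded tilde_sel(4)]
  \<comment> \<open>The arrow a \<oplus> \<open>forget a\<close> is what the functor F(a \<oplus> -)
    makes of \<open>forget a\<close>, so naturality of \<pi> and \<rho> at \<open>forget a\<close>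
    computes its composites with \<open>?q\<close> and \<open>?p\<close>.\<close>
  define x where "x = Ide (tilde msums) a \<boxtimes>\<^bsub>tilde msums\<^esub> ?e"
  have x: "x \<in> Arr (tilde msums)" "Dom (tilde msums) x = DSum C a a" "Cod (tilde msums) x = DSum C a a"
    unfolding x_def using ide_tensor_arr[OF a, of ?e] a by (simp_all del: tilde_sel(6) ide_tilde)
  have Fx: "FArr (NCod ?\<tau>) ?e = FArr F x"
    using a by (simp add: cod left_tensor_def x_def)
  have FO: "FObj (NCod ?\<tau>) a = FObj F (DSum C a a)"
    using a by (simp add: cod left_tensor_def)
  let ?i = "NCmp ?\<tau> a" and ?p = "FArr F (tilde_prj a a)" and ?q = "NCmp \<pi> a" and ?j = "NCmp j a"
  let ?D = "FArr F \<Delta>" and ?E = "FArr F ?e" and ?X = "FArr F x"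
  have [simp]: "a \<in> Obj (tilde msums)" using a by simp
  note [simp] = is_nat_transD(4-6)[OF \<tau>] is_nat_transD(4-6)[OF \<pi>'(1)] is_nat_transD(4-6)[OF j(1)]
    \<pi>'(2) j(2,3) dom FO is_functorD(1-4)[OF F] x
  have qX: "?q \<cdot>\<^bsub>B\<^esub> ?X = ?q"
    using is_nat_transD(7)[OF \<pi>'(1), of ?e] a \<pi>(2)[of a] by (simp add: Fx)
  have pX: "?p \<cdot>\<^bsub>B\<^esub> ?X = ?E \<cdot>\<^bsub>B\<^esub> ?p"
    using is_nat_transD(7)[OF \<rho>(1), of ?e] a by (simp add: \<rho>_sel Fx)
  have pD: "?p \<cdot>\<^bsub>B\<^esub> ?D = ?E"
    using comp[of \<Delta> "tilde_prj a a"] a by (simp add: \<Delta>(2))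
  have EE: "?E \<cdot>\<^bsub>B\<^esub> ?E = ?E"
    using comp[of ?e ?e] a by (simp add: forget_squared)
  \<comment> \<open>F(a \<oplus> a) is a biproduct with projections \<open>?q\<close> and
    \<open>?p\<close>, so an arrow into it is determined by its composites with these two. This is
    applied to \<open>?X \<cdot> ?D\<close> and \<open>?D\<close>.\<close>
  have split: "f = AddArr B (?j \<cdot>\<^bsub>B\<^esub> (?q \<cdot>\<^bsub>B\<^esub> f)) (?i \<cdot>\<^bsub>B\<^esub> (?p \<cdot>\<^bsub>B\<^esub> f))"
    if f: "f \<in> Arr B" "Cod B f = FObj F (DSum C a a)" for f
  proof -
    have "f = AddArr B (?j \<cdot>\<^bsub>B\<^esub> ?q) (?i \<cdot>\<^bsub>B\<^esub> ?p) \<cdot>\<^bsub>B\<^esub> f"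
      using j(4) f by (simp add: \<rho>_sel)
    also have "\<dots> = AddArr B (?j \<cdot>\<^bsub>B\<^esub> (?q \<cdot>\<^bsub>B\<^esub> f)) (?i \<cdot>\<^bsub>B\<^esub> (?p \<cdot>\<^bsub>B\<^esub> f))"
      using f a by (subst B.add_comp) (simp_all add: B.assoc)
    finally show ?thesis .
  qed
  have "?q \<cdot>\<^bsub>B\<^esub> (?X \<cdot>\<^bsub>B\<^esub> ?D) = ?q \<cdot>\<^bsub>B\<^esub> ?D"
    using B.assoc[of ?D ?X ?q] qX a by simp
  moreover have "?p \<cdot>\<^bsub>B\<^esub> (?X \<cdot>\<^bsub>B\<^esub> ?D) = ?p \<cdot>\<^bsub>B\<^esub> ?D"
  proof -
    have "?p \<cdot>\<^bsub>B\<^esub> (?X \<cdot>\<^bsub>B\<^esub> ?D) = (?p \<cdot>\<^bsub>B\<^esub> ?X) \<cdot>\<^bsub>B\<^esub> ?D"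
      using a by (subst B.assoc) simp_all
    also have "\<dots> = ?E \<cdot>\<^bsub>B\<^esub> (?p \<cdot>\<^bsub>B\<^esub> ?D)"
      unfolding pX using a by (subst B.assoc) simp_all
    finally show ?thesis by (simp only: pD EE)
  qed
  ultimately have "?X \<cdot>\<^bsub>B\<^esub> ?D = ?D"
    using split[of "?X \<cdot>\<^bsub>B\<^esub> ?D"] split[of ?D] a by simp
  then have DE: "?D \<cdot>\<^bsub>B\<^esub> ?E = ?D"
    using comp[of \<Delta> x] comp[of ?e \<Delta>] \<Delta>(1) a by (simp add: x_def[symmetric] del: tilde_sel(6) ide_tilde)
  obtain r where r: "r \<in> Arr (tilde msums)" "Dom (tilde msums) r = DSum C a a"
    "tilde_comp msums r \<Delta> = Ide (tilde msums) a"
    using \<Delta>(3) by blast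
  have rcod: "Cod (tilde msums) r = a"
    using category.cod_comp[OF category_tilde, of \<Delta> r] category.cod_ide[OF category_tilde, of a] r a by simp
  have rD: "FArr F r \<cdot>\<^bsub>B\<^esub> ?D = Ide B (FObj F a)"
    using comp[of \<Delta> r] is_functorD(5)[OF F, of a] r a by (simp del: ide_tilde)
  have "?E = (FArr F r \<cdot>\<^bsub>B\<^esub> ?D) \<cdot>\<^bsub>B\<^esub> ?E"
    unfolding rD using a by simp
  also have "\<dots> = FArr F r \<cdot>\<^bsub>B\<^esub> ?D"
    using r rcod a by (subst B.assoc) (simp_all add: DE)
  finally show ?case by (simp only: rD)
qed

section \<open>Descent of polynomial functors and the equivalence\<close>

lemma polynomial_factorization:
  assumes "polynomial (tilde msums) B n F" "additive_category B"
  obtains H where "is_functor sums B H" "tilde_functor.precomp H = F"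
proof -
  have F: "is_functor (tilde msums) B F"
    using assms(1) by (cases rule: polynomial.cases)
  have B: "category B" using assms(2) by (simp add: additive_category_def)
  show thesis
    by (rule tilde_functor.factorization[OF F _ that])
      (rule compatible_if_forget[OF F B polynomial_forget[OF assms]])
qed

text \<open>The cokernel given upstairs has a polynomial target of lower degree, so
  \<open>polynomial_factorization\<close> makes that target a precomposition with some K. Then \<pi>
  itself descends, the equational criterion keeps it a cokernel, and the induction, being over
  arbitrary H, applies to K.\<close>

lemma polynomial_descend:
  assumes "polynomial (tilde msums) B n (tilde_functor.precomp H)" "is_functor sums B H" "additive_category B"
  shows "polynomial sums B n H"
  using assms(1,2)
proof (induction n "tilde_functor.precomp H" arbitrary: H rule: polynomial.induct)
  case (neg n)
  then show ?case
    by (intro polynomial.neg) (auto simp: tilde_functor_obj)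
next
  case (nonneg n)
  show ?case
  proof (intro polynomial.nonneg ballI)
    fix x assume "x \<in> Obj sums"
    then have x: "x \<in> Obj C" by simp
    then obtain \<pi> where \<pi>: "is_cokernel (Fct (tilde msums) B) (shift_map (tilde msums) x (tilde_functor.precomp H)) \<pi>"
      "polynomial (tilde msums) B (n - 1) (NCod \<pi>)"
      "\<And>K. NCod \<pi> = tilde_functor.precomp K \<Longrightarrow> is_functor sums B K \<Longrightarrow> polynomial sums B (n - 1) K"
      using nonneg(3) by fastforce
    obtain K where K: "is_functor sums B K" "tilde_functor.precomp K = NCod \<pi>"
      using polynomial_factorization[OF \<pi>(2) assms(3)] .
    have \<pi>': "is_nat_trans (tilde msums) B \<pi>"
      "NDom \<pi> = tilde_functor.precomp (comp_functor sums H (left_tensor sums x))"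
      using \<pi>(1) precomp_left_tensor[OF x, of H] by (auto simp: is_cokernel_def shift_map_def)
    obtain \<sigma> where \<sigma>: "is_nat_trans sums B \<sigma>" "NDom \<sigma> = comp_functor sums H (left_tensor sums x)" "NCod \<sigma> = K"
      "precomp_nat (tilde msums) tilde_functor \<sigma> = \<pi>"
      using tilde_functor.nat_trans_lift[OF is_functor_comp[OF category_sums left_tensor_sums[OF x] nonneg(4)] K(1) \<pi>'] K(2) by metis
    show "\<exists>\<pi>. is_cokernel (Fct sums B) (shift_map sums x H) \<pi> \<and> polynomial sums B (n - 1) (NCod \<pi>)"
      using is_cokernel_shift_map_iff[OF assms(3) nonneg(4) x \<sigma>(1,2)] \<sigma>(3,4) \<pi>(1,3) K by (intro exI[of _ \<sigma>]) simp
  qed (use nonneg in auto)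
qed

lemma is_equivalence_polynomial:
  fixes B :: "('p, 'q, 'y) add_cat_scheme"
  assumes "additive_category B"
  shows "is_equivalence (Pol n sums B) (Pol n (tilde msums) B) (precomp_functor (Pol n sums B) (tilde msums) tilde_functor)"
    (is "is_equivalence ?P ?Q ?R")
proof (rule is_equivalence_if_bij)
  interpret B: additive_category B by fact
  show catP: "category ?P" unfolding Pol_def
    by (intro category_full_subcat category_Fct category_sums B.category_axioms)
  show catQ: "category ?Q" unfolding Pol_def
    by (intro category_full_subcat category_Fct category_tilde B.category_axioms)
  interpret P: category ?P by fact
  let ?p = "precomp_nat (tilde msums) tilde_functor"
  have FObj: "FObj ?R H = tilde_functor.precomp H" if "H \<in> Obj ?P" for H
    using that by (simp add: precomp_functor_def)
  have FArr: "FArr ?R \<tau> = ?p \<tau>" if "\<tau> \<in> Arr ?P" for \<tau>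
    using that by (simp add: precomp_functor_def precomp_nat_def)
  have objP: "H \<in> Obj ?P \<longleftrightarrow> is_functor sums B H \<and> polynomial sums B n H" for H
    by (auto simp: Pol_def)
  have objQ: "F \<in> Obj ?Q \<longleftrightarrow> is_functor (tilde msums) B F \<and> polynomial (tilde msums) B n F" for F
    by (auto simp: Pol_def)
  have arrP: "\<tau> \<in> Arr ?P \<longleftrightarrow> is_nat_trans sums B \<tau> \<and> polynomial sums B n (NDom \<tau>) \<and> polynomial sums B n (NCod \<tau>)" for \<tau>
    by (auto simp: Pol_def)
  have arrQ: "\<tau> \<in> Arr ?Q \<longleftrightarrow> is_nat_trans (tilde msums) B \<tau> \<and> polynomial (tilde msums) B n (NDom \<tau>) \<and> polynomial (tilde msums) B n (NCod \<tau>)" for \<tau>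
    by (auto simp: Pol_def)
  have selP: "Dom ?P = NDom" "Cod ?P = NCod" "Ide ?P = Ide (Fct sums B)" "Comp ?P = Comp (Fct sums B)"
    and selQ: "Dom ?Q = NDom" "Cod ?Q = NCod" "Ide ?Q = Ide (Fct (tilde msums) B)" "Comp ?Q = Comp (Fct (tilde msums) B)"
    by (simp_all add: Pol_def)
  note pre_poly = polynomial_precomp[OF _ assms]
  show "is_functor ?P ?Q ?R"
  proof (rule is_functorI)
    fix H assume H: "H \<in> Obj ?P"
    then show "FObj ?R H \<in> Obj ?Q"
      by (auto simp: FObj objP objQ intro: pre_poly tilde_functor.precomp_functor)
    show "FArr ?R (Ide ?P H) = Ide ?Q (FObj ?R H)"
      using H by (simp add: FObj FArr) (auto simp: selP selQ precomp_nat_def fun_eq_iff tilde_functor_obj)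
  next
    fix \<tau> assume \<tau>: "\<tau> \<in> Arr ?P"
    then show "FArr ?R \<tau> \<in> Arr ?Q"
      by (auto simp: FArr arrP arrQ intro: pre_poly tilde_functor.is_nat_trans_precomp)
    show "Dom ?Q (FArr ?R \<tau>) = FObj ?R (Dom ?P \<tau>)" "Cod ?Q (FArr ?R \<tau>) = FObj ?R (Cod ?P \<tau>)"
      using P.obj_dom[OF \<tau>] P.obj_cod[OF \<tau>] by (simp_all add: FArr[OF \<tau>] FObj) (simp_all add: selP selQ)
  next
    fix \<sigma> \<tau> assume \<sigma>\<tau>: "\<sigma> \<in> Arr ?P" "\<tau> \<in> Arr ?P" "Dom ?P \<tau> = Cod ?P \<sigma>"
    show "FArr ?R (\<tau> \<cdot>\<^bsub>?P\<^esub> \<sigma>) = FArr ?R \<tau> \<cdot>\<^bsub>?Q\<^esub> FArr ?R \<sigma>"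
      using P.arr_comp[OF \<sigma>\<tau>] \<sigma>\<tau>(1,2)
      by (simp add: FArr) (auto simp: selP selQ precomp_nat_def fun_eq_iff tilde_functor_obj)
  qed (simp_all add: precomp_functor_def)
  show "bij_betw (FObj ?R) (Obj ?P) (Obj ?Q)"
    unfolding bij_betw_def
  proof (intro conjI inj_onI equalityI subsetI)
    fix H K assume "H \<in> Obj ?P" "K \<in> Obj ?P" "FObj ?R H = FObj ?R K"
    then show "H = K"
      using tilde_functor.precomp_inject by (auto simp: FObj objP)
  next
    fix F assume "F \<in> FObj ?R ` Obj ?P"
    then show "F \<in> Obj ?Q"
      by (auto simp: FObj objP objQ intro: pre_poly tilde_functor.precomp_functor)
  next
    fix F assume "F \<in> Obj ?Q"
    then have F: "polynomial (tilde msums) B n F" by (simp add: objQ)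
    obtain H where H: "is_functor sums B H" "tilde_functor.precomp H = F"
      using polynomial_factorization[OF F assms] .
    then have "H \<in> Obj ?P"
      using F polynomial_descend[OF _ H(1) assms] by (simp add: objP)
    then show "F \<in> FObj ?R ` Obj ?P"
      using FObj H(2) by (intro image_eqI[of _ _ H]) simp_all
  qed
  show "bij_betw (FArr ?R) (Arr ?P) (Arr ?Q)"
    unfolding bij_betw_def
  proof (intro conjI inj_onI equalityI subsetI)
    fix \<sigma> \<tau> assume \<sigma>: "\<sigma> \<in> Arr ?P" and \<tau>: "\<tau> \<in> Arr ?P" and "FArr ?R \<sigma> = FArr ?R \<tau>"
    then have eq: "?p \<sigma> = ?p \<tau>" by (simp add: FArr)
    have nat: "is_nat_trans sums B \<sigma>" "is_nat_trans sums B \<tau>" using \<sigma> \<tau> by (auto simp: arrP)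
    show "\<sigma> = \<tau>"
    proof (rule nat_trans_eqI[OF nat])
      show "NDom \<sigma> = NDom \<tau>" "NCod \<sigma> = NCod \<tau>"
        using arg_cong[OF eq, of NDom] arg_cong[OF eq, of NCod]
        by (auto intro!: tilde_functor.precomp_inject is_nat_transD(1,2) nat)
      show "NCmp \<sigma> a = NCmp \<tau> a" if "a \<in> Obj sums" for a
        using arg_cong[OF eq, of "\<lambda>\<tau>. NCmp \<tau> a"] that by (simp add: tilde_functor_obj)
    qed
  next
    fix \<sigma> assume "\<sigma> \<in> FArr ?R ` Arr ?P"
    then show "\<sigma> \<in> Arr ?Q"
      by (auto simp: FArr arrP arrQ intro: pre_poly tilde_functor.is_nat_trans_precomp)
  next
    fix \<sigma> assume "\<sigma> \<in> Arr ?Q"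
    then have \<sigma>: "is_nat_trans (tilde msums) B \<sigma>" "polynomial (tilde msums) B n (NDom \<sigma>)" "polynomial (tilde msums) B n (NCod \<sigma>)"
      by (auto simp: arrQ)
    obtain H where H: "is_functor sums B H" "tilde_functor.precomp H = NDom \<sigma>"
      using polynomial_factorization[OF \<sigma>(2) assms] .
    obtain K where K: "is_functor sums B K" "tilde_functor.precomp K = NCod \<sigma>"
      using polynomial_factorization[OF \<sigma>(3) assms] .
    \<comment> \<open>The source and the target of \<sigma> have been factored separately. Its
      components need no change: by fullness they are natural between the factors H and K.\<close>
    obtain \<tau> where \<tau>: "is_nat_trans sums B \<tau>" "NDom \<tau> = H" "NCod \<tau> = K" "?p \<tau> = \<sigma>"
      using tilde_functor.nat_trans_lift[OF H(1) K(1) \<sigma>(1) H(2)[symmetric] K(2)[symmetric]] by metis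
    have "\<tau> \<in> Arr ?P"
      using \<tau>(1-3) H K \<sigma>(2,3) polynomial_descend[OF _ H(1) assms] polynomial_descend[OF _ K(1) assms] by (simp add: arrP)
    then show "\<sigma> \<in> FArr ?R ` Arr ?P"
      using FArr \<tau>(4) by (intro image_eqI[of _ _ \<tau>]) simp_all
  qed
qed

end

theorem proposition6p10:
  fixes A :: "('o, 'm) add_cat" and B :: "('p, 'q) add_cat" and n :: nat
  assumes "additive_category A" and "abelian_category B"
  defines "A_sum \<equiv> direct_sum_monoidal A"
  defines "M \<equiv> split_monos A_sum"
  shows "is_equivalence (Pol (int n) A_sum B) (Pol (int n) (tilde M) B)
           (precomp_functor (Pol (int n) A_sum B) (tilde M)
              (tilde_extension M A_sum (inclusion_functor M)))"
  unfolding M_def A_sum_def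
  by (intro additive_category.is_equivalence_polynomial abelian_category.axioms(1) assms)

end
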